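(* Let $T$ be the quasi-nilpotent DT-operator and let $Y$ be a circular operator $*$-free from $T$. For every $\epsilon>0$, the operator $T+\sqrt\epsilon\,Y$ is not a DT-operator.
   Context: The quasi-nilpotent DT-operator $T$ is realized as follows. Let $(D_0,X)$ be a pair of free selfadjoint elements in a tracial $W^*$-probability space (von Neumann algebra with faithful normal tracial state $\tau$) such that $D_0$ has the uniform distribution on $[0,1]$ and $X$ is standard semicircular (distribution $\frac1{2\pi}\sqrt{4-t^2}\,1_{[-2,2]}(t)\,dt$). For $N\in\mathbb N$ put $T_N=\sum_{j=1}^{2^N}p_{N,j}Xq_{N,j}$ with $p_{N,j}=1_{[\frac{j-1}{2^N},\frac{j}{2^N}]}(D_0)$ and $q_{N,j}=1_{[\frac{j}{2^N},1]}(D_0)$. Then $(T_N)$ converges in norm and $T$ is its limit. A circular operator is $Y=\frac{1}{\sqrt2}(X_1+iX_2)$ with $X_1,X_2$ free standard semicircular elements (so $\tau(Y^*Y)=1$). $T$ and $Y$ live in a common tracial $W^*$-probability space in which they are $*$-free. DT-operators: let $\mu$ be a compactly supported Borel probability measure on $\mathbb C$ and $c>0$. An element $Z$ of a tracial $W^*$-probability space is a $\mathrm{DT}(\mu,c)$-operator if it has the same $*$-moments as $D+cT$, where $D=f(D_0)$ for some $f\in L^\infty([0,1])$ such that the push-forward of Lebesgue measure on $[0,1]$ under $f$ is $\mu$ (the $*$-moments depend only on $\mu$ and $c$). The Brown measure of a $\mathrm{DT}(\mu,c)$-operator is $\mu$. $Z$ is a DT-operator if it is a $\mathrm{DT}(\mu,c)$-operator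 for some such $\mu$ and $c$. *)

theory Defs
  imports "HOL-Probability.Probability"
begin

text \<open>The real inner product is the real part of the complex one, so norm, topology and completeness
  are those of the underlying real Hilbert space. The complex inner product is linear in the first
  argument.\<close>

class complex_hilbert = real_inner + complete_space +
  fixes scaleC :: "complex \<Rightarrow> 'a \<Rightarrow> 'a"
    and cinner :: "'a \<Rightarrow> 'a \<Rightarrow> complex"
  assumes scaleC_add_right: "scaleC a (x + y) = scaleC a x + scaleC a y"
    and scaleC_add_left: "scaleC (a + b) x = scaleC a x + scaleC b x"
    and scaleC_scaleC: "scaleC a (scaleC b x) = scaleC (a * b) x"
    and scaleC_of_real: "scaleC (complex_of_real r) x = r *\<^sub>R x"
    and cinner_add_left: "cinner (x + y) z = cinner x z + cinner y z"
    and cinner_scaleC_left: "cinner (scaleC a x) y = a * cinner x y"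
    and cinner_commute: "cinner x y = cnj (cinner y x)"
    and inner_eq_Re_cinner: "inner x y = Re (cinner x y)"

lemma cinner_self:
  fixes x :: "'a::complex_hilbert"
  shows "cinner x x = complex_of_real ((norm x)\<^sup>2)"
proof -
  have "Im (cinner x x) = 0"
    using cinner_commute[of x x] by (simp add: complex_eq_iff)
  then show ?thesis
    by (simp add: complex_eq_iff power2_norm_eq_inner inner_eq_Re_cinner)
qed

lemma norm_scaleC:
  fixes x :: "'a::complex_hilbert"
  shows "norm (scaleC a x) = cmod a * norm x"
proof -
  have "cinner x (scaleC a x) = cnj a * cinner x x"
    by (metis cinner_commute cinner_scaleC_left complex_cnj_mult)
  then have "cinner (scaleC a x) (scaleC a x) = (a * cnj a) * cinner x x"
    by (simp add: cinner_scaleC_left)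
  then have "complex_of_real ((norm (scaleC a x))\<^sup>2) = complex_of_real ((cmod a * norm x)\<^sup>2)"
    by (simp only: cinner_self complex_norm_square[symmetric] of_real_mult[symmetric]
        power_mult_distrib)
  then have "(norm (scaleC a x))\<^sup>2 = (cmod a * norm x)\<^sup>2"
    by (simp only: of_real_eq_iff)
  then show ?thesis
    by (simp add: power2_eq_iff_nonneg)
qed

lemma bounded_linear_scaleC: "bounded_linear (scaleC a :: 'a::complex_hilbert \<Rightarrow> 'a)"
proof (rule bounded_linear_intro[where K = "cmod a"])
  fix r and x :: 'a
  show "scaleC a (r *\<^sub>R x) = r *\<^sub>R scaleC a x"
    by (metis scaleC_of_real scaleC_scaleC mult.commute)
qed (simp_all add: scaleC_add_right norm_scaleC mult.commute)

text \<open>The type \<^typ>\<open>'h \<Rightarrow>\<^sub>L 'h\<close> consists of the bounded real-linear operators;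
  those in \<open>clinear_ops\<close> form B(H).\<close>

type_synonym 'h oper = "'h \<Rightarrow>\<^sub>L 'h"

definition clinear_ops :: "'h::complex_hilbert oper set" where
  "clinear_ops = {A :: 'h oper. \<forall>c x. A (scaleC c x) = scaleC c (A x)}"

definition scaleC_op :: "complex \<Rightarrow> 'h::complex_hilbert oper \<Rightarrow> 'h oper" where
  "scaleC_op c A = Blinfun (scaleC c) o\<^sub>L A"

lemma scaleC_op_apply: "blinfun_apply (scaleC_op c A) x = scaleC c (blinfun_apply A x)"
  by (simp add: scaleC_op_def bounded_linear_Blinfun_apply bounded_linear_scaleC)

definition is_adjoint :: "'h::complex_hilbert oper \<Rightarrow> 'h oper \<Rightarrow> bool" where
  "is_adjoint A B \<longleftrightarrow> (\<forall>x y. cinner (A x) y = cinner x (B y))"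

definition adj :: "'h::complex_hilbert oper \<Rightarrow> 'h oper" where
  "adj A = (THE B. is_adjoint A B)"

lemma is_adjoint_unique:
  assumes "is_adjoint A B" "is_adjoint A C"
  shows "B = C"
proof (rule blinfun_eqI)
  fix y
  have "inner x (B y - C y) = 0" for x
    using assms by (simp add: is_adjoint_def inner_diff_right) (simp add: inner_eq_Re_cinner)
  from this[of "B y - C y"] show "B y = C y"
    by simp
qed

lemma adj_eqI: "is_adjoint A B \<Longrightarrow> adj A = B"
  unfolding adj_def using is_adjoint_unique by blast

definition selfadj :: "'h::complex_hilbert oper \<Rightarrow> bool" where
  "selfadj A \<longleftrightarrow> is_adjoint A A"

definition positive_op :: "'h::complex_hilbert oper \<Rightarrow> bool" where
  "positive_op A \<longleftrightarrow> (\<forall>x. cinner (A x) x \<in> \<real>\<^sub>\<ge>\<^sub>0)"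

definition op_le :: "'h::complex_hilbert oper \<Rightarrow> 'h oper \<Rightarrow> bool" where
  "op_le A B \<longleftrightarrow> positive_op (B - A)"

definition op_prod :: "'h::complex_hilbert oper list \<Rightarrow> 'h oper" where
  "op_prod As = foldr (o\<^sub>L) As id_blinfun"

definition op_power :: "'h::complex_hilbert oper \<Rightarrow> nat \<Rightarrow> 'h oper" where
  "op_power A n = op_prod (replicate n A)"

definition star_subalgebra :: "'h::complex_hilbert oper set \<Rightarrow> bool" where
  "star_subalgebra M \<longleftrightarrow> M \<subseteq> clinear_ops \<and> id_blinfun \<in> M \<and>
     (\<forall>A\<in>M. \<forall>B\<in>M. A + B \<in> M \<and> A o\<^sub>L B \<in> M) \<and>
     (\<forall>c. \<forall>A\<in>M. scaleC_op c A \<in> M) \<and>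
     (\<forall>A\<in>M. \<exists>B\<in>M. is_adjoint A B)"

definition commutant :: "'h::complex_hilbert oper set \<Rightarrow> 'h oper set" where
  "commutant M = {B \<in> clinear_ops. \<forall>A\<in>M. A o\<^sub>L B = B o\<^sub>L A}"

definition von_neumann_algebra :: "'h::complex_hilbert oper set \<Rightarrow> bool" where
  "von_neumann_algebra M \<longleftrightarrow> star_subalgebra M \<and> commutant (commutant M) = M"

definition state_on :: "'h::complex_hilbert oper set \<Rightarrow> ('h oper \<Rightarrow> complex) \<Rightarrow> bool" where
  "state_on M \<tau> \<longleftrightarrow>
     (\<forall>A\<in>M. \<forall>B\<in>M. \<tau> (A + B) = \<tau> A + \<tau> B) \<and>
     (\<forall>c. \<forall>A\<in>M. \<tau> (scaleC_op c A) = c * \<tau> A) \<and>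
     (\<forall>A\<in>M. positive_op A \<longrightarrow> \<tau> A \<in> \<real>\<^sub>\<ge>\<^sub>0) \<and>
     \<tau> id_blinfun = 1"

definition faithful_on :: "'h::complex_hilbert oper set \<Rightarrow> ('h oper \<Rightarrow> complex) \<Rightarrow> bool" where
  "faithful_on M \<tau> \<longleftrightarrow> (\<forall>A\<in>M. positive_op A \<and> \<tau> A = 0 \<longrightarrow> A = 0)"

definition tracial_on :: "'h::complex_hilbert oper set \<Rightarrow> ('h oper \<Rightarrow> complex) \<Rightarrow> bool" where
  "tracial_on M \<tau> \<longleftrightarrow> (\<forall>A\<in>M. \<forall>B\<in>M. \<tau> (A o\<^sub>L B) = \<tau> (B o\<^sub>L A))"

text \<open>Normality: \<open>\<tau>\<close> preserves the least upper bound \<open>A\<close> of every upward directed family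
  \<open>S\<close> of positive elements of \<open>M\<close> that has one.\<close>

definition normal_on :: "'h::complex_hilbert oper set \<Rightarrow> ('h oper \<Rightarrow> complex) \<Rightarrow> bool" where
  "normal_on M \<tau> \<longleftrightarrow>
     (\<forall>S A. S \<noteq> {} \<and> S \<subseteq> {B \<in> M. positive_op B} \<and>
        (\<forall>B\<in>S. \<forall>C\<in>S. \<exists>D\<in>S. op_le B D \<and> op_le C D) \<and>
        A \<in> M \<and> (\<forall>B\<in>S. op_le B A) \<and>
        (\<forall>A'\<in>M. (\<forall>B\<in>S. op_le B A') \<longrightarrow> op_le A A') \<longrightarrow>
        Re (\<tau> A) = (SUP B\<in>S. Re (\<tau> B)))"

definition tracial_wstar_space :: "'h::complex_hilbert oper set \<Rightarrow> ('h oper \<Rightarrow> complex) \<Rightarrow> bool" where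
  "tracial_wstar_space M \<tau> \<longleftrightarrow> von_neumann_algebra M \<and>
     state_on M \<tau> \<and> faithful_on M \<tau> \<and> tracial_on M \<tau> \<and> normal_on M \<tau>"

definition has_distribution ::
    "('h::complex_hilbert oper \<Rightarrow> complex) \<Rightarrow> 'h oper \<Rightarrow> real measure \<Rightarrow> bool" where
  "has_distribution \<tau> A \<mu> \<longleftrightarrow> prob_space \<mu> \<and> sets \<mu> = sets borel \<and>
     (\<exists>R. AE t in \<mu>. \<bar>t\<bar> \<le> R) \<and>
     (\<forall>n. \<tau> (op_power A n) = complex_of_real (\<integral>t. t ^ n \<partial>\<mu>))"

abbreviation uniform01 :: "real measure" where
  "uniform01 \<equiv> uniform_measure lborel {0..1}"

definition semicircle_measure :: "real measure" where
  "semicircle_measure =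
     density lborel (\<lambda>t. ennreal (1 / (2 * pi) * sqrt (4 - t\<^sup>2) * indicator {-2..2} t))"

text \<open>A word is a list of Booleans: \<open>False\<close> stands for the operator, \<open>True\<close> for its adjoint.\<close>

definition star_word :: "'h::complex_hilbert oper \<Rightarrow> bool list \<Rightarrow> 'h oper" where
  "star_word A w = op_prod (map (\<lambda>s. if s then adj A else A) w)"

definition same_star_moments ::
    "('h::complex_hilbert oper \<Rightarrow> complex) \<Rightarrow> 'h oper \<Rightarrow>
     ('k::complex_hilbert oper \<Rightarrow> complex) \<Rightarrow> 'k oper \<Rightarrow> bool" where
  "same_star_moments \<tau> A \<sigma> B \<longleftrightarrow> (\<forall>w. \<tau> (star_word A w) = \<sigma> (star_word B w))"

definition free_subalgebras ::
    "('h::complex_hilbert oper \<Rightarrow> complex) \<Rightarrow> ('i \<Rightarrow> 'h oper set) \<Rightarrow> bool" where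
  "free_subalgebras \<tau> \<A> \<longleftrightarrow>
     (\<forall>w. w \<noteq> [] \<and> distinct_adj (map fst w) \<and> (\<forall>(i, A)\<in>set w. A \<in> \<A> i \<and> \<tau> A = 0)
        \<longrightarrow> \<tau> (op_prod (map snd w)) = 0)"

definition star_free ::
    "('h::complex_hilbert oper \<Rightarrow> complex) \<Rightarrow> 'h oper \<Rightarrow> 'h oper \<Rightarrow> bool" where
  "star_free \<tau> A B \<longleftrightarrow>
     free_subalgebras \<tau> (\<lambda>i::bool. star_subalgebra hull {if i then B else A})"

definition semicircular ::
    "'h::complex_hilbert oper set \<Rightarrow> ('h oper \<Rightarrow> complex) \<Rightarrow> 'h oper \<Rightarrow> bool" where
  "semicircular M \<tau> X \<longleftrightarrow> X \<in> M \<and> selfadj X \<and> has_distribution \<tau> X semicircle_measure"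

definition circular ::
    "'h::complex_hilbert oper set \<Rightarrow> ('h oper \<Rightarrow> complex) \<Rightarrow> 'h oper \<Rightarrow> bool" where
  "circular M \<tau> Y \<longleftrightarrow>
     (\<exists>X1 X2. semicircular M \<tau> X1 \<and> semicircular M \<tau> X2 \<and> star_free \<tau> X1 X2 \<and>
        Y = (1 / sqrt 2) *\<^sub>R (X1 + scaleC_op \<i> X2))"

definition vector_measure :: "(real set \<Rightarrow> 'h::complex_hilbert oper) \<Rightarrow> 'h \<Rightarrow> real measure" where
  "vector_measure E x = measure_of UNIV (sets borel) (\<lambda>S. ennreal (Re (cinner (E S x) x)))"

definition projection_valued_measure ::
    "'h::complex_hilbert oper set \<Rightarrow> (real set \<Rightarrow> 'h oper) \<Rightarrow> bool" where
  "projection_valued_measure M E \<longleftrightarrow>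
     (\<forall>S\<in>sets borel. E S \<in> M \<and> selfadj (E S) \<and> E S o\<^sub>L E S = E S) \<and>
     E UNIV = id_blinfun \<and>
     (\<forall>S\<in>sets borel. \<forall>S'\<in>sets borel. E (S \<inter> S') = E S o\<^sub>L E S') \<and>
     (\<forall>F x. range F \<subseteq> sets borel \<and> disjoint_family F \<longrightarrow>
        (\<lambda>n::nat. E (F n) x) sums E (\<Union>n. F n) x)"

text \<open>\<open>fun_calculus M E f B\<close> says that \<open>B\<close> is the integral of \<open>f\<close> against \<open>E\<close>,
  that is, \<open>B = f(A)\<close> if \<open>E\<close> is the spectral measure of \<open>A\<close>.
  By polarization \<open>B\<close> is determined by its quadratic form, as \<open>B\<close> is complex-linear.\<close>

definition fun_calculus ::
    "'h::complex_hilbert oper set \<Rightarrow> (real set \<Rightarrow> 'h oper) \<Rightarrow> (real \<Rightarrow> complex) \<Rightarrow> 'h oper \<Rightarrow> bool" where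
  "fun_calculus M E f B \<longleftrightarrow> B \<in> M \<and>
     (\<forall>x. integrable (vector_measure E x) f \<and>
          cinner (B x) x = (\<integral>t. f t \<partial>(vector_measure E x)))"

text \<open>By the spectral theorem a selfadjoint \<open>A\<close> in a von Neumann algebra \<open>M\<close> has exactly one
  spectral measure \<open>E\<close> on the Borel sets, and its values lie in \<open>M\<close>; then \<open>E S\<close> is the
  projection \<open>1\<^sub>S(A)\<close>.\<close>

definition spectral_measure ::
    "'h::complex_hilbert oper set \<Rightarrow> 'h oper \<Rightarrow> (real set \<Rightarrow> 'h oper) \<Rightarrow> bool" where
  "spectral_measure M A E \<longleftrightarrow>
     projection_valued_measure M E \<and> fun_calculus M E complex_of_real A"

definition T_approx ::
    "(real set \<Rightarrow> 'h::complex_hilbert oper) \<Rightarrow> 'h oper \<Rightarrow> nat \<Rightarrow> 'h oper" where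
  "T_approx E X N =
     (\<Sum>j = 1..2 ^ N. E {(real j - 1) / 2 ^ N .. real j / 2 ^ N} o\<^sub>L X o\<^sub>L E {real j / 2 ^ N .. 1})"

definition DT_realization ::
    "'h::complex_hilbert oper set \<Rightarrow> ('h oper \<Rightarrow> complex) \<Rightarrow> 'h oper \<Rightarrow> (real set \<Rightarrow> 'h oper) \<Rightarrow>
     'h oper \<Rightarrow> 'h oper \<Rightarrow> bool" where
  "DT_realization M \<tau> D0 E X T \<longleftrightarrow>
     tracial_wstar_space M \<tau> \<and>
     D0 \<in> M \<and> selfadj D0 \<and> has_distribution \<tau> D0 uniform01 \<and> spectral_measure M D0 E \<and>
     semicircular M \<tau> X \<and> star_free \<tau> D0 X \<and>
     T_approx E X \<longlonglongrightarrow> T"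

text \<open>Both \<open>T\<close> and DT-operators are given up to *-moments by a realization that may live in a
  different tracial W*-probability space, over any Hilbert space type \<^typ>\<open>'k\<close>.\<close>

definition quasinilpotent_DT ::
    "'k::complex_hilbert itself \<Rightarrow> ('h::complex_hilbert oper \<Rightarrow> complex) \<Rightarrow> 'h oper \<Rightarrow> bool" where
  "quasinilpotent_DT _ \<tau> T \<longleftrightarrow>
     (\<exists>(M::'k oper set) \<sigma> D0 E X T'. DT_realization M \<sigma> D0 E X T' \<and> same_star_moments \<tau> T \<sigma> T')"

definition DT_op ::
    "'k::complex_hilbert itself \<Rightarrow> ('h::complex_hilbert oper \<Rightarrow> complex) \<Rightarrow> 'h oper \<Rightarrow>
     complex measure \<Rightarrow> real \<Rightarrow> bool" where
  "DT_op _ \<tau> Z \<mu> c \<longleftrightarrow>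
     (\<exists>(M::'k oper set) \<sigma> D0 E X T f D.
        DT_realization M \<sigma> D0 E X T \<and>
        f \<in> borel_measurable borel \<and> (\<exists>b. AE t in uniform01. norm (f t) \<le> b) \<and>
        distr uniform01 borel f = \<mu> \<and>
        fun_calculus M E f D \<and>
        same_star_moments \<tau> Z \<sigma> (D + c *\<^sub>R T))"

definition is_DT_op ::
    "'k::complex_hilbert itself \<Rightarrow> ('h::complex_hilbert oper \<Rightarrow> complex) \<Rightarrow> 'h oper \<Rightarrow> bool" where
  "is_DT_op k \<tau> Z \<longleftrightarrow>
     (\<exists>\<mu> c. sets \<mu> = sets borel \<and> prob_space \<mu> \<and> (\<exists>K. compact K \<and> (AE z in \<mu>. z \<in> K)) \<and>
            c > 0 \<and> DT_op k \<tau> Z \<mu> c)"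

end

theory Submission
  imports Defs "HOL-Complex_Analysis.Complex_Analysis"
begin

text \<open>Suppose that \<open>Z = T + sqrt \<epsilon> Y\<close> has the *-moments of \<open>D + c T\<close> with \<open>D = f(D0)\<close>. Only the moments
  \<open>w k l = \<tau>(Z\<^sup>k (Z\<^sup>*)\<^sup>l)\<close> are compared. The Schwinger-Dyson equation of the circular \<open>Y\<close> expresses them by those of \<open>T\<close>:
  they vanish for \<open>k \<noteq> l\<close>, and \<open>\<Sum> w n n t\<^sup>n = V / (1 - \<epsilon> t V)\<close> with \<open>t V = exp t - 1\<close>. On the other side \<open>D + c T\<close> is upper
  triangular over the diagonal algebra of \<open>D0\<close>, and the Schwinger-Dyson equation of the semicircular element becomes a
  Volterra equation; it yields
  \<open>1 + c\<^sup>2 \<Sum> w k l a\<^sup>k\<^sup>+\<^sup>1 b\<^sup>l\<^sup>+\<^sup>1 = exp (c\<^sup>2 a b \<integral> 1 / ((1 - a f) (1 - b cnj f)))\<close>. Comparing the logarithmic derivatives,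
  \<open>\<integral> 1 / (1 - t \<bar>f\<bar>\<^sup>2)\<^sup>2\<close> times \<open>(1 + (c\<^sup>2 - \<epsilon>) (exp t - 1)) (1 - \<epsilon> (exp t - 1))\<close> equals \<open>exp t\<close> near 0, hence by
  analytic continuation also at \<open>2 \<pi> \<i>\<close>, where it says that \<open>\<integral> 1 / (1 - 2 \<pi> \<i> \<bar>f\<bar>\<^sup>2)\<^sup>2 = 1\<close>. This forces \<open>f = 0\<close>
  almost everywhere, and then the identity fails.\<close>

text \<open>The words \<open>op_power Z k o\<^sub>L op_power (adj Z) l\<close> are chosen because
  both Schwinger-Dyson equations close on them: \<open>Y\<close> is uncorrelated with itself, and in
  the triangular model two factors \<open>Z\<close> cannot be contracted with each other, so a
  contraction always joins a \<open>Z\<close> to an \<open>adj Z\<close>. The point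
  \<open>2 \<pi> \<i>\<close> comes from the period of the exponential function:
  \<open>exp t - 1\<close> vanishes there as it does at 0, so both parameters drop out of the
  identity. The continuation is possible because the integral has its singularities on the positive
  real axis only. At \<open>2 \<pi> \<i>\<close> the integrand has modulus
  \<open>1 / (1 + 4 \<pi>\<^sup>2 \<bar>f\<bar>\<^sup>4)\<close>, which is less than 1 wherever
  \<open>f\<close> is not zero. The operator side has its own obstacle: freeness is assumed for the
  algebra generated by \<open>D0\<close>, which in general contains neither the spectral projections
  of \<open>D0\<close> nor \<open>f(D0)\<close>; hence the closure in the 2-norm. The distribution
  of the spectral measure, in turn, has to be recovered from the moments of
  \<open>D0\<close>.\<close>

unbundle no vec_syntax
unbundle fps_syntax

section \<open>Operators and tracial spaces\<close>

lemmas comp_simps = blinfun.bilinear_simps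

lemma scaleC_zero [simp]: "scaleC c (0::'a::complex_hilbert) = 0"
  by (metis bounded_linear_scaleC linear_simps(3))

lemma scaleC_one [simp]: "scaleC 1 (x::'a::complex_hilbert) = x"
  using scaleC_of_real[of 1 x] by simp

lemma cinner_add_right: "cinner x (y + z) = cinner x y + cinner (x::'a::complex_hilbert) z"
  by (metis cinner_add_left cinner_commute complex_cnj_add)

lemma cinner_scaleC_right: "cinner x (scaleC a y) = cnj a * cinner (x::'a::complex_hilbert) y"
  by (metis cinner_scaleC_left cinner_commute complex_cnj_mult)

lemma cinner_scaleR_left: "cinner (r *\<^sub>R x) y = r * cinner (x::'a::complex_hilbert) y"
  by (metis scaleC_of_real cinner_scaleC_left)

lemma cinner_scaleR_right: "cinner x (r *\<^sub>R y) = r * cinner (x::'a::complex_hilbert) y"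
  by (metis scaleC_of_real cinner_scaleC_right complex_cnj_complex_of_real)

lemma cinner_zero_left [simp]: "cinner 0 (y::'a::complex_hilbert) = 0"
  using cinner_scaleR_left[of 0 0 y] by simp

lemma cinner_zero_right [simp]: "cinner (y::'a::complex_hilbert) 0 = 0"
  using cinner_scaleR_right[of y 0 0] by simp

lemma cinner_minus_left: "cinner (- x) y = - cinner (x::'a::complex_hilbert) y"
  using cinner_scaleR_left[of "-1" x y] by simp

lemma cinner_minus_right: "cinner x (- y) = - cinner (x::'a::complex_hilbert) y"
  using cinner_scaleR_right[of x "-1" y] by simp

lemma cinner_diff_left: "cinner (x - y) z = cinner x z - cinner (y::'a::complex_hilbert) z"
  using cinner_add_left[of x "-y" z] by (simp add: cinner_minus_left)

lemma cinner_diff_right: "cinner z (x - y) = cinner z x - cinner (z::'a::complex_hilbert) y"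
  using cinner_add_right[of z x "-y"] by (simp add: cinner_minus_right)

lemma Im_cinner: "Im (cinner x y) = inner x (scaleC \<i> (y::'a::complex_hilbert))"
  by (simp add: inner_eq_Re_cinner cinner_scaleC_right)

lemma norm_cinner_le: "cmod (cinner x y) \<le> norm x * norm (y::'a::complex_hilbert)"
proof (cases "cinner x y = 0")
  case False
  \<comment> \<open>Rotating \<open>y\<close> by this phase makes the inner product real and
    nonnegative, so the Cauchy-Schwarz inequality of the real inner product suffices.\<close>
  define a where "a = sgn (cinner x y)"
  have "cmod a = 1" using False by (simp add: a_def norm_sgn)
  have "cinner x y = of_real (cmod (cinner x y)) * a"
    using False by (simp add: a_def sgn_eq)
  then have "cnj a * cinner x y = of_real (cmod (cinner x y)) * (a * cnj a)"
    by (metis mult.assoc mult.commute)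
  then have "cnj a * cinner x y = complex_of_real (cmod (cinner x y))"
    using \<open>cmod a = 1\<close> by (simp add: complex_norm_square[symmetric])
  then have "cmod (cinner x y) = Re (cinner x (scaleC a y))"
    by (simp add: cinner_scaleC_right)
  also have "\<dots> = inner x (scaleC a y)" by (simp add: inner_eq_Re_cinner)
  also have "\<dots> \<le> norm x * norm (scaleC a y)" by (rule norm_cauchy_schwarz)
  finally show ?thesis by (simp add: norm_scaleC \<open>cmod a = 1\<close>)
qed auto

lemma compose_assoc: "(a o\<^sub>L b) o\<^sub>L c = a o\<^sub>L (b o\<^sub>L c)"
  by (rule blinfun_eqI) simp

lemma compose_id [simp]: "id_blinfun o\<^sub>L a = a" "a o\<^sub>L id_blinfun = a"
  by (rule blinfun_eqI, simp)+

lemmas compose_add = bounded_bilinear.add_left[OF bounded_bilinear_blinfun_compose]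
  bounded_bilinear.add_right[OF bounded_bilinear_blinfun_compose]
lemmas compose_diff = bounded_bilinear.diff_left[OF bounded_bilinear_blinfun_compose]
  bounded_bilinear.diff_right[OF bounded_bilinear_blinfun_compose]
lemmas compose_scaleR = bounded_bilinear.scaleR_left[OF bounded_bilinear_blinfun_compose]
  bounded_bilinear.scaleR_right[OF bounded_bilinear_blinfun_compose]
lemmas compose_sum = bounded_bilinear.sum_left[OF bounded_bilinear_blinfun_compose]
  bounded_bilinear.sum_right[OF bounded_bilinear_blinfun_compose]

lemma clinear_opsD: "A \<in> clinear_ops \<Longrightarrow> blinfun_apply A (scaleC c x) = scaleC c (A x)"
  by (simp add: clinear_ops_def)

lemma scaleC_op_compose_left: "scaleC_op c A o\<^sub>L B = scaleC_op c (A o\<^sub>L B)"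
  by (rule blinfun_eqI) (simp add: scaleC_op_apply)

lemma scaleC_op_compose_right: "A \<in> clinear_ops \<Longrightarrow> A o\<^sub>L scaleC_op c B = scaleC_op c (A o\<^sub>L B)"
  by (rule blinfun_eqI) (simp add: scaleC_op_apply clinear_opsD)

lemma scaleC_op_add: "scaleC_op c (A + B) = scaleC_op c A + scaleC_op c B"
  by (rule blinfun_eqI) (simp add: scaleC_op_apply comp_simps scaleC_add_right)

lemma scaleC_op_scaleC_op: "scaleC_op c (scaleC_op d A) = scaleC_op (c * d) A"
  by (rule blinfun_eqI) (simp add: scaleC_op_apply scaleC_scaleC)

lemma scaleC_op_of_real: "scaleC_op (complex_of_real r) A = r *\<^sub>R A"
  by (rule blinfun_eqI) (simp add: scaleC_op_apply comp_simps scaleC_of_real)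

lemma scaleC_op_simps [simp]: "scaleC_op 0 A = 0" "scaleC_op 1 A = A" "scaleC_op c 0 = 0"
    "scaleC_op (-1) A = - A"
  using scaleC_op_of_real[of 0 A] scaleC_op_of_real[of 1 A] scaleC_op_of_real[of "-1" A]
  by (auto intro!: blinfun_eqI simp: scaleC_op_apply)

lemma norm_scaleC_op: "norm (scaleC_op c A) \<le> cmod c * norm A"
  by (rule norm_blinfun_bound)
    (auto simp: scaleC_op_apply norm_scaleC mult.assoc intro!: mult_left_mono norm_blinfun)

lemma is_adjoint_sym: "is_adjoint A B \<Longrightarrow> is_adjoint B A"
  unfolding is_adjoint_def by (metis cinner_commute)

lemma is_adjoint_id: "is_adjoint id_blinfun id_blinfun"
  by (simp add: is_adjoint_def)

lemma adj_id [simp]: "adj id_blinfun = id_blinfun"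
  by (rule adj_eqI[OF is_adjoint_id])

lemma is_adjoint_zero: "is_adjoint 0 0"
  by (simp add: is_adjoint_def)

lemma is_adjoint_add: "is_adjoint A B \<Longrightarrow> is_adjoint A' B' \<Longrightarrow> is_adjoint (A + A') (B + B')"
  by (simp add: is_adjoint_def comp_simps cinner_add_left cinner_add_right)

lemma is_adjoint_compose: "is_adjoint A B \<Longrightarrow> is_adjoint A' B' \<Longrightarrow> is_adjoint (A o\<^sub>L A') (B' o\<^sub>L B)"
  by (simp add: is_adjoint_def)

lemma is_adjoint_scaleC: "is_adjoint A B \<Longrightarrow> is_adjoint (scaleC_op c A) (scaleC_op (cnj c) B)"
  by (simp add: is_adjoint_def scaleC_op_apply cinner_scaleC_left cinner_scaleC_right)

lemma is_adjoint_scaleR: "is_adjoint A B \<Longrightarrow> is_adjoint (r *\<^sub>R A) (r *\<^sub>R B)"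
  using is_adjoint_scaleC[of A B "complex_of_real r"] by (simp add: scaleC_op_of_real)

lemma is_adjoint_diff: "is_adjoint A B \<Longrightarrow> is_adjoint A' B' \<Longrightarrow> is_adjoint (A - A') (B - B')"
  by (simp add: is_adjoint_def comp_simps cinner_diff_left cinner_diff_right)

lemma is_adjoint_sum:
  "(\<And>i. i \<in> I \<Longrightarrow> is_adjoint (f i) (g i)) \<Longrightarrow> is_adjoint (\<Sum>i\<in>I. f i) (\<Sum>i\<in>I. g i)"
  by (induction I rule: infinite_finite_induct) (auto simp: is_adjoint_zero is_adjoint_add)

lemma norm_adjoint_le:
  assumes "is_adjoint A B"
  shows "norm B \<le> norm A"
proof (rule norm_blinfun_bound)
  fix x
  have "(norm (B x))\<^sup>2 = Re (cinner (B x) (B x))"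
    by (simp add: cinner_self)
  also have "\<dots> = Re (cinner (A (B x)) x)"
    using assms by (simp add: is_adjoint_def)
  also have "\<dots> \<le> norm (A (B x)) * norm x"
    using complex_Re_le_cmod norm_cinner_le order_trans by blast
  also have "\<dots> \<le> norm A * norm (B x) * norm x"
    by (intro mult_right_mono norm_blinfun) auto
  finally have "norm (B x) * norm (B x) \<le> norm (B x) * (norm A * norm x)"
    by (simp add: power2_eq_square algebra_simps)
  then show "norm (B x) \<le> norm A * norm x"
    by (cases "norm (B x) = 0") (auto simp: mult_le_cancel_left)
qed auto

lemma op_prod_simps [simp]: "op_prod [] = id_blinfun" "op_prod (A # As) = A o\<^sub>L op_prod As"
  by (simp_all add: op_prod_def)

lemma op_prod_append: "op_prod (As @ Bs) = op_prod As o\<^sub>L op_prod Bs"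
  by (induction As) (auto simp: compose_assoc)

lemma op_power_simps [simp]: "op_power A 0 = id_blinfun" "op_power A (Suc n) = A o\<^sub>L op_power A n"
  by (simp_all add: op_power_def)

lemma op_power_add: "op_power A (m + n) = op_power A m o\<^sub>L op_power A n"
  by (simp add: op_power_def replicate_add op_prod_append)

lemma op_power_Suc2: "op_power A (Suc n) = op_power A n o\<^sub>L A"
  using op_power_add[of A n 1] by simp

text \<open>The hull is an intersection of star-subalgebras. Closure under adjoints passes to it
  because an adjoint is unique: the one found in \<open>M\<close> is the one found in every other
  member of the intersection.\<close>

lemma star_subalgebra_hull:
  assumes "star_subalgebra M" "S \<subseteq> M"
  shows "star_subalgebra (star_subalgebra hull S)" "star_subalgebra hull S \<subseteq> M"
proof -
  show sub: "star_subalgebra hull S \<subseteq> M"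
    using assms by (simp add: hull_minimal)
  have *: "\<exists>B. is_adjoint A B \<and> (\<forall>N. star_subalgebra N \<longrightarrow> S \<subseteq> N \<longrightarrow> B \<in> N)"
    if A: "\<And>N. star_subalgebra N \<Longrightarrow> S \<subseteq> N \<Longrightarrow> A \<in> N" for A
  proof -
    obtain B where B: "is_adjoint A B"
      using A[OF assms] assms(1) unfolding star_subalgebra_def by blast
    have "B \<in> N" if N: "star_subalgebra N" "S \<subseteq> N" for N
      using A[OF N] N(1) B is_adjoint_unique unfolding star_subalgebra_def by metis
    then show ?thesis using B by blast
  qed
  have **: "star_subalgebra hull S \<subseteq> clinear_ops"
    using sub assms(1) unfolding star_subalgebra_def by blast
  have "\<forall>A\<in>star_subalgebra hull S. \<exists>B\<in>star_subalgebra hull S. is_adjoint A B"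
  proof
    fix A assume "A \<in> star_subalgebra hull S"
    then have "\<And>N. star_subalgebra N \<Longrightarrow> S \<subseteq> N \<Longrightarrow> A \<in> N"
      by (auto simp: hull_def)
    from *[OF this] show "\<exists>B\<in>star_subalgebra hull S. is_adjoint A B"
      by (auto simp: hull_def)
  qed
  moreover have "id_blinfun \<in> star_subalgebra hull S \<and>
     (\<forall>A\<in>star_subalgebra hull S. \<forall>B\<in>star_subalgebra hull S. A + B \<in> star_subalgebra hull S \<and> A o\<^sub>L B \<in> star_subalgebra hull S) \<and>
     (\<forall>c. \<forall>A\<in>star_subalgebra hull S. scaleC_op c A \<in> star_subalgebra hull S)"
    unfolding hull_def star_subalgebra_def by auto
  ultimately show "star_subalgebra (star_subalgebra hull S)"
    using ** by (auto simp only: star_subalgebra_def[of "star_subalgebra hull S"])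
qed

section \<open>Tracial W*-spaces and the 2-norm of the trace\<close>

locale tracial =
  fixes M :: "'h::complex_hilbert oper set" and \<tau> :: "'h oper \<Rightarrow> complex"
  assumes space: "tracial_wstar_space M \<tau>"
begin

lemma star_M: "star_subalgebra M"
  using space by (simp add: tracial_wstar_space_def von_neumann_algebra_def)

lemma M_clinear: "A \<in> M \<Longrightarrow> A \<in> clinear_ops"
  using star_M by (auto simp: star_subalgebra_def)

lemma M_id [simp, intro]: "id_blinfun \<in> M"
  using star_M by (auto simp: star_subalgebra_def)

lemma M_add [simp, intro]: "A \<in> M \<Longrightarrow> B \<in> M \<Longrightarrow> A + B \<in> M"
  using star_M by (auto simp: star_subalgebra_def)

lemma M_comp [simp, intro]: "A \<in> M \<Longrightarrow> B \<in> M \<Longrightarrow> A o\<^sub>L B \<in> M"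
  using star_M by (auto simp: star_subalgebra_def)

lemma M_scaleC [simp, intro]: "A \<in> M \<Longrightarrow> scaleC_op c A \<in> M"
  using star_M by (auto simp: star_subalgebra_def)

lemma M_scaleR [simp, intro]: "A \<in> M \<Longrightarrow> r *\<^sub>R A \<in> M"
  using M_scaleC[of A "complex_of_real r"] by (simp add: scaleC_op_of_real)

lemma M_zero [simp, intro]: "0 \<in> M"
  using M_scaleR[of id_blinfun 0] by simp

lemma M_minus [simp, intro]: "A \<in> M \<Longrightarrow> - A \<in> M"
  using M_scaleR[of A "-1"] by simp

lemma M_diff [simp, intro]: "A \<in> M \<Longrightarrow> B \<in> M \<Longrightarrow> A - B \<in> M"
  using M_add[of A "-B"] by simp

lemma M_sum [intro]: "(\<And>i. i \<in> I \<Longrightarrow> f i \<in> M) \<Longrightarrow> (\<Sum>i\<in>I. f i) \<in> M"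
  by (induction I rule: infinite_finite_induct) auto

lemma M_prod [intro]: "set As \<subseteq> M \<Longrightarrow> op_prod As \<in> M"
  by (induction As) auto

lemma M_power [simp, intro]: "A \<in> M \<Longrightarrow> op_power A n \<in> M"
  by (induction n) auto

lemma adj_M: assumes "A \<in> M" shows "adj A \<in> M" "is_adjoint A (adj A)"
  using assms star_M adj_eqI unfolding star_subalgebra_def by metis+

lemmas [simp, intro] = adj_M(1)

lemma adj_adj [simp]: "A \<in> M \<Longrightarrow> adj (adj A) = A"
  by (simp add: adj_M adj_eqI is_adjoint_sym)

lemma adj_add: "A \<in> M \<Longrightarrow> B \<in> M \<Longrightarrow> adj (A + B) = adj A + adj B"
  by (simp add: adj_M adj_eqI is_adjoint_add)

lemma adj_diff: "A \<in> M \<Longrightarrow> B \<in> M \<Longrightarrow> adj (A - B) = adj A - adj B"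
  by (simp add: adj_M adj_eqI is_adjoint_diff)

lemma adj_comp: "A \<in> M \<Longrightarrow> B \<in> M \<Longrightarrow> adj (A o\<^sub>L B) = adj B o\<^sub>L adj A"
  by (simp add: adj_M adj_eqI is_adjoint_compose)

lemma adj_scaleC: "A \<in> M \<Longrightarrow> adj (scaleC_op c A) = scaleC_op (cnj c) (adj A)"
  by (simp add: adj_M adj_eqI is_adjoint_scaleC)

lemma adj_scaleR: "A \<in> M \<Longrightarrow> adj (r *\<^sub>R A) = r *\<^sub>R adj A"
  by (simp add: adj_M adj_eqI is_adjoint_scaleR)

lemma norm_adj: "A \<in> M \<Longrightarrow> norm (adj A) = norm A"
  by (meson adj_M is_adjoint_sym norm_adjoint_le order_antisym)

lemma tau_id [simp]: "\<tau> id_blinfun = 1"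
  using space by (simp add: tracial_wstar_space_def state_on_def)

lemma tau_add: "A \<in> M \<Longrightarrow> B \<in> M \<Longrightarrow> \<tau> (A + B) = \<tau> A + \<tau> B"
  using space by (simp add: tracial_wstar_space_def state_on_def)

lemma tau_scaleC: "A \<in> M \<Longrightarrow> \<tau> (scaleC_op c A) = c * \<tau> A"
  using space by (simp add: tracial_wstar_space_def state_on_def)

lemma tau_scaleR: "A \<in> M \<Longrightarrow> \<tau> (r *\<^sub>R A) = r * \<tau> A"
  using tau_scaleC[of A "complex_of_real r"] by (simp add: scaleC_op_of_real)

lemma tau_zero [simp]: "\<tau> 0 = 0"
  using tau_scaleR[of 0 0] by simp

lemma tau_minus: "A \<in> M \<Longrightarrow> \<tau> (- A) = - \<tau> A"
  using tau_scaleR[of A "-1"] by simp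

lemma tau_diff: "A \<in> M \<Longrightarrow> B \<in> M \<Longrightarrow> \<tau> (A - B) = \<tau> A - \<tau> B"
  using tau_add[of A "-B"] by (simp add: tau_minus)

lemma tau_sum: "(\<And>i. i \<in> I \<Longrightarrow> f i \<in> M) \<Longrightarrow> \<tau> (\<Sum>i\<in>I. f i) = (\<Sum>i\<in>I. \<tau> (f i))"
  by (induction I rule: infinite_finite_induct) (auto simp: tau_add M_sum)

lemma tau_comm: "A \<in> M \<Longrightarrow> B \<in> M \<Longrightarrow> \<tau> (A o\<^sub>L B) = \<tau> (B o\<^sub>L A)"
  using space by (simp add: tracial_wstar_space_def tracial_on_def)

lemma tau_pos: "A \<in> M \<Longrightarrow> positive_op A \<Longrightarrow> \<tau> A \<in> \<real>\<^sub>\<ge>\<^sub>0"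
  using space by (simp add: tracial_wstar_space_def state_on_def)

lemma tau_pos_Re: "A \<in> M \<Longrightarrow> positive_op A \<Longrightarrow> 0 \<le> Re (\<tau> A) \<and> Im (\<tau> A) = 0"
  using tau_pos[of A] by (simp add: complex_nonneg_Reals_iff)

lemma tau_faithful: "A \<in> M \<Longrightarrow> positive_op A \<Longrightarrow> \<tau> A = 0 \<Longrightarrow> A = 0"
  using space by (simp add: tracial_wstar_space_def faithful_on_def)

lemma cinner_adj: "A \<in> M \<Longrightarrow> cinner (adj A x) y = cinner x (A y)"
  using adj_M(2)[of A] is_adjoint_sym unfolding is_adjoint_def by blast

lemma positive_adj_comp: "A \<in> M \<Longrightarrow> positive_op (adj A o\<^sub>L A)"
  by (simp add: positive_op_def cinner_adj cinner_self complex_nonneg_Reals_iff)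

text \<open>The norm of \<open>A\<close> as a vector of the GNS space of
  \<open>\<tau>\<close>.\<close>

definition n2 :: "'h oper \<Rightarrow> real" where "n2 A = sqrt (Re (\<tau> (adj A o\<^sub>L A)))"

lemma n2_nonneg [simp]: "A \<in> M \<Longrightarrow> 0 \<le> n2 A"
  using tau_pos_Re[OF _ positive_adj_comp, of A] by (simp add: n2_def)

lemma n2_sq: assumes "A \<in> M" shows "complex_of_real ((n2 A)\<^sup>2) = \<tau> (adj A o\<^sub>L A)"
  using tau_pos_Re[OF _ positive_adj_comp, of A] assms by (simp add: n2_def complex_eq_iff)

lemma n2_zero: "n2 0 = 0"
  by (simp add: n2_def)

lemma n2_adj: "A \<in> M \<Longrightarrow> n2 (adj A) = n2 A"
  by (simp add: n2_def tau_comm[of "adj A" A])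

text \<open>The trace of the operator \<open>?P\<close> is nonnegative, since \<open>?P\<close> is
  positive by \<open>norm (A (B x)) \<le> norm A * norm (B x)\<close>.\<close>

lemma n2_comp_left:
  assumes "A \<in> M" "B \<in> M"
  shows "n2 (A o\<^sub>L B) \<le> norm A * n2 B"
proof -
  let ?P = "(norm A)\<^sup>2 *\<^sub>R (adj B o\<^sub>L B) - (adj (A o\<^sub>L B) o\<^sub>L (A o\<^sub>L B))"
  have "(norm (A (B x)))\<^sup>2 \<le> (norm A * norm (B x))\<^sup>2" for x
    by (intro power_mono norm_blinfun) auto
  then have "positive_op ?P"
    using assms by (auto simp: positive_op_def comp_simps cinner_diff_left cinner_scaleR_left
        cinner_adj cinner_self complex_nonneg_Reals_iff power_mult_distrib
        simp flip: of_real_mult of_real_diff)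
  from tau_pos_Re[OF _ this] assms
  have "Re (\<tau> (adj (A o\<^sub>L B) o\<^sub>L (A o\<^sub>L B))) \<le> (norm A)\<^sup>2 * Re (\<tau> (adj B o\<^sub>L B))"
    by (simp add: tau_diff tau_scaleR)
  then show ?thesis
    unfolding n2_def by (metis real_sqrt_le_mono real_sqrt_mult real_sqrt_unique norm_ge_zero)
qed

lemma n2_comp_right:
  assumes "A \<in> M" "B \<in> M"
  shows "n2 (A o\<^sub>L B) \<le> n2 A * norm B"
  using n2_comp_left[of "adj B" "adj A"] assms
  by (metis adj_M(1) adj_comp n2_adj norm_adj mult.commute M_comp)

lemma n2_id: "n2 id_blinfun = 1"
  by (simp add: n2_def)

lemma n2_le_norm: "A \<in> M \<Longrightarrow> n2 A \<le> norm A"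
  using n2_comp_left[of A id_blinfun] by (simp add: n2_id)

lemma n2_scaleC: "A \<in> M \<Longrightarrow> n2 (scaleC_op c A) = cmod c * n2 A"
proof -
  assume A: "A \<in> M"
  have "\<tau> (adj (scaleC_op c A) o\<^sub>L scaleC_op c A) = (c * cnj c) * \<tau> (adj A o\<^sub>L A)"
    using A by (simp add: adj_scaleC scaleC_op_compose_left scaleC_op_compose_right M_clinear
        scaleC_op_scaleC_op tau_scaleC mult.commute)
  then have "\<tau> (adj (scaleC_op c A) o\<^sub>L scaleC_op c A) = complex_of_real ((cmod c)\<^sup>2) * \<tau> (adj A o\<^sub>L A)"
    by (simp only: complex_norm_square)
  then show ?thesis
    by (simp add: n2_def real_sqrt_mult)
qed

text \<open>Positivity of \<open>\<tau>\<close> makes the trace of \<open>adj C o\<^sub>L C\<close>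
  real; expanding it for \<open>C = A + 1\<close> and \<open>C = A + \<i>\<close> yields the real
  and the imaginary part of the claim.\<close>

lemma tau_adj: assumes "A \<in> M" shows "\<tau> (adj A) = cnj (\<tau> A)"
proof -
  have *: "Im (\<tau> (adj B o\<^sub>L B)) = 0" if "B \<in> M" for B
    using tau_pos_Re[OF _ positive_adj_comp[OF that]] that by auto
  have "Im (\<tau> (adj (A + id_blinfun) o\<^sub>L (A + id_blinfun))) = 0"
    "Im (\<tau> (adj (A + scaleC_op \<i> id_blinfun) o\<^sub>L (A + scaleC_op \<i> id_blinfun))) = 0"
    "Im (\<tau> (adj A o\<^sub>L A)) = 0"
    by (rule *; use assms in simp)+
  then show ?thesis using assms
    by (simp add: adj_add adj_scaleC compose_add tau_add
        scaleC_op_compose_left scaleC_op_compose_right M_clinear scaleC_op_scaleC_op tau_scaleC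
        complex_eq_iff)
qed

lemma tau_cauchy_schwarz:
  assumes "A \<in> M" "B \<in> M"
  shows "cmod (\<tau> (adj A o\<^sub>L B)) \<le> n2 A * n2 B"
proof -
  define t where "t = \<tau> (adj A o\<^sub>L B)"
  have ineq: "0 \<le> (cmod c)\<^sup>2 * (n2 A)\<^sup>2 + 2 * Re (cnj c * t) + (n2 B)\<^sup>2" for c
  proof -
    let ?X = "scaleC_op c A + B"
    have XM: "?X \<in> M" using assms by simp
    have "\<tau> (adj B o\<^sub>L A) = cnj t"
      using tau_adj[of "adj A o\<^sub>L B"] assms by (simp add: adj_comp t_def)
    then have "\<tau> (adj ?X o\<^sub>L ?X) = (cnj c * c) * \<tau> (adj A o\<^sub>L A) + cnj c * t + c * cnj t + \<tau> (adj B o\<^sub>L B)"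
      using assms
      by (simp add: adj_add adj_scaleC compose_add scaleC_op_compose_left scaleC_op_compose_right M_clinear
        scaleC_op_scaleC_op tau_add tau_scaleC t_def scaleC_op_add)
    also have "cnj c * c = (cmod c)\<^sup>2"
      by (simp only: complex_norm_square mult.commute)
    finally have "\<tau> (adj ?X o\<^sub>L ?X) = (cmod c)\<^sup>2 * \<tau> (adj A o\<^sub>L A) + cnj c * t + c * cnj t + \<tau> (adj B o\<^sub>L B)" .
    then have "(n2 ?X)\<^sup>2 = (cmod c)\<^sup>2 * (n2 A)\<^sup>2 + 2 * Re (cnj c * t) + (n2 B)\<^sup>2"
      using n2_sq[OF XM] n2_sq[OF assms(1)] n2_sq[OF assms(2)]
      by (simp add: complex_eq_iff)
    then show ?thesis by (metis zero_le_power2)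
  qed
  have "(cmod t)\<^sup>2 \<le> (n2 A)\<^sup>2 * (n2 B)\<^sup>2"
  proof (cases "n2 A = 0")
    case True
    have "t = 0"
    proof (rule ccontr)
      assume "t \<noteq> 0"
      \<comment> \<open>Where \<open>n2 A\<close> vanishes the inequality is affine in the
        multiplier of \<open>t\<close>; this value makes its right side equal to
        \<open>-1\<close>.\<close>
      define s where "s = - ((n2 B)\<^sup>2 + 1) / (2 * (cmod t)\<^sup>2)"
      have "Re (cnj (of_real s * t) * t) = s * (cmod t)\<^sup>2"
        by (simp add: cmod_power2 algebra_simps) (simp add: power2_eq_square)
      with ineq[of "of_real s * t"] True have "0 \<le> 2 * (s * (cmod t)\<^sup>2) + (n2 B)\<^sup>2"
        by simp
      moreover have "s * (cmod t)\<^sup>2 = - ((n2 B)\<^sup>2 + 1) / 2"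
        using \<open>t \<noteq> 0\<close> by (simp add: s_def)
      moreover have "\<not> (0 \<le> 2 * k + X \<and> k = - (X + 1) / 2)" for k X :: real
        by (auto simp: field_simps)
      ultimately show False by blast
    qed
    then show ?thesis by simp
  next
    case False
    \<comment> \<open>The minimizer of the quadratic polynomial in the multiplier of
      \<open>t\<close>.\<close>
    define s where "s = - 1 / (n2 A)\<^sup>2"
    have "Re (cnj (of_real s * t) * t) = s * (cmod t)\<^sup>2"
      by (simp add: cmod_power2 algebra_simps) (simp add: power2_eq_square)
    then have "0 \<le> (s * cmod t)\<^sup>2 * (n2 A)\<^sup>2 + 2 * (s * (cmod t)\<^sup>2) + (n2 B)\<^sup>2"
      using ineq[of "of_real s * t"] by (simp add: norm_mult power_mult_distrib)
    then have "0 \<le> (n2 B)\<^sup>2 - (cmod t)\<^sup>2 / (n2 A)\<^sup>2"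
      using False by (simp add: s_def power_mult_distrib power_divide power2_eq_square)
    then show ?thesis
      using False by (simp add: divide_le_eq mult.commute)
  qed
  then show ?thesis
    using assms by (metis n2_nonneg power_mult_distrib power2_le_imp_le t_def mult_nonneg_nonneg)
qed

lemma tau_le_n2: "A \<in> M \<Longrightarrow> cmod (\<tau> A) \<le> n2 A"
  using tau_cauchy_schwarz[of id_blinfun A] by (simp add: n2_id)

lemma tau_le_norm: "A \<in> M \<Longrightarrow> cmod (\<tau> A) \<le> norm A"
  using tau_le_n2 n2_le_norm order_trans by blast

lemma n2_triangle:
  assumes "A \<in> M" "B \<in> M"
  shows "n2 (A + B) \<le> n2 A + n2 B"
proof -
  have "\<tau> (adj B o\<^sub>L A) = cnj (\<tau> (adj A o\<^sub>L B))"
    using tau_adj[of "adj A o\<^sub>L B"] assms by (simp add: adj_comp)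
  then have "(n2 (A + B))\<^sup>2 = (n2 A)\<^sup>2 + (n2 B)\<^sup>2 + 2 * Re (\<tau> (adj A o\<^sub>L B))"
    using n2_sq[of "A + B"] n2_sq[OF assms(1)] n2_sq[OF assms(2)] assms
    by (simp add: complex_eq_iff adj_add compose_add tau_add)
  also have "\<dots> \<le> (n2 A + n2 B)\<^sup>2"
    using tau_cauchy_schwarz[OF assms] complex_Re_le_cmod[of "\<tau> (adj A o\<^sub>L B)"]
    by (simp add: power2_sum)
  finally show ?thesis
    using assms by (meson n2_nonneg add_nonneg_nonneg power2_le_imp_le)
qed

text \<open>A norm limit remains complex-linear and commutes with everything that commutes with
  \<open>M\<close>; the bicommutant condition then returns it to \<open>M\<close>.\<close>

lemma M_closed: 
  assumes "\<And>n. A n \<in> M" "A \<longlonglongrightarrow> B" shows "B \<in> M"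
proof -
  have vn: "commutant (commutant M) = M"
    using space by (simp add: tracial_wstar_space_def von_neumann_algebra_def)
  have lim: "(\<lambda>n. A n x) \<longlonglongrightarrow> B x" for x
    using assms(2) by (rule blinfun.tendsto[OF _ tendsto_const])
  have "B \<in> clinear_ops"
    unfolding clinear_ops_def
  proof (intro CollectI allI)
    fix c x
    have "(\<lambda>n. scaleC c (A n x)) \<longlonglongrightarrow> scaleC c (B x)"
      by (rule bounded_linear.tendsto[OF bounded_linear_scaleC lim])
    moreover have "(\<lambda>n. scaleC c (A n x)) \<longlonglongrightarrow> B (scaleC c x)"
      using lim[of "scaleC c x"] assms(1) M_clinear by (simp add: clinear_opsD)
    ultimately show "B (scaleC c x) = scaleC c (B x)"
      using LIMSEQ_unique by blast
  qed
  moreover have "C o\<^sub>L B = B o\<^sub>L C" if C: "C \<in> commutant M" for C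
  proof -
    have "(\<lambda>n. C o\<^sub>L A n) \<longlonglongrightarrow> (C o\<^sub>L B)" "(\<lambda>n. A n o\<^sub>L C) \<longlonglongrightarrow> (B o\<^sub>L C)"
      using assms(2) by (auto intro!: bounded_bilinear.tendsto[OF bounded_bilinear_blinfun_compose])
    moreover have "C o\<^sub>L A n = A n o\<^sub>L C" for n
      using C assms(1) by (simp add: commutant_def)
    ultimately show ?thesis
      by (simp add: LIMSEQ_unique)
  qed
  ultimately have "B \<in> commutant (commutant M)"
    by (auto simp: commutant_def[of "commutant M"])
  then show ?thesis by (simp add: vn)
qed

lemma tau_tendsto:
  assumes "\<And>n. A n \<in> M" "A \<longlonglongrightarrow> B"
  shows "(\<lambda>n. \<tau> (A n)) \<longlonglongrightarrow> \<tau> B"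
proof -
  have B: "B \<in> M" using M_closed[OF assms] .
  have "(\<lambda>n. norm (A n - B)) \<longlonglongrightarrow> 0"
    using assms(2) by (simp add: LIM_zero tendsto_norm_zero)
  then have "(\<lambda>n. \<tau> (A n) - \<tau> B) \<longlonglongrightarrow> 0"
    by (rule Lim_null_comparison[rotated])
      (use tau_le_norm[of "A _ - B"] assms(1) B in \<open>simp add: tau_diff\<close>)
  then show ?thesis by (simp add: LIM_zero_iff)
qed

end

section \<open>Schwinger-Dyson equations and freeness\<close>

lemma sum_list_map_zero: "(\<And>x. x \<in> set p \<Longrightarrow> f x = 0) \<Longrightarrow> (\<Sum>x\<leftarrow>p. f x) = (0::'b::comm_monoid_add)"
  by (induction p) auto

definition (in tracial) subalg :: "'h oper set \<Rightarrow> bool" where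
  "subalg A \<longleftrightarrow> A \<subseteq> M \<and> id_blinfun \<in> A \<and> (\<forall>a\<in>A. \<forall>b\<in>A. a + b \<in> A \<and> (a o\<^sub>L b) \<in> A) \<and>
     (\<forall>c. \<forall>a\<in>A. scaleC_op c a \<in> A)"

text \<open>\<open>dpair G y a F\<close> encodes a noncommutative polynomial with value \<open>a\<close> in \<open>y\<close> and the elements of \<open>G\<close>, together
  with its free difference quotient \<open>\<partial>a\<close> (the derivation with \<open>\<partial>y = 1 \<otimes> 1\<close> that vanishes on \<open>G\<close>) in the form
  \<open>F u v = (\<tau> \<otimes> \<tau>)(u \<partial>a v)\<close>. It is a relation, since different polynomials may have the same value. Beware that \<open>o\<^sub>L\<close>
  binds weaker than \<open>+\<close>.\<close>

inductive (in tracial) dpair :: "'h oper set \<Rightarrow> 'h oper \<Rightarrow> 'h oper \<Rightarrow> ('h oper \<Rightarrow> 'h oper \<Rightarrow> complex) \<Rightarrow> bool"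
  for G :: "'h oper set" and y :: "'h oper" where
  const: "b \<in> G \<Longrightarrow> dpair G y b (\<lambda>u v. 0)"
| mark: "dpair G y y (\<lambda>u v. \<tau> u * \<tau> v)"
| add: "dpair G y a F \<Longrightarrow> dpair G y b H \<Longrightarrow> dpair G y (a + b) (\<lambda>u v. F u v + H u v)"
| mult: "dpair G y a F \<Longrightarrow> dpair G y b H \<Longrightarrow>
    dpair G y (a o\<^sub>L b) (\<lambda>u v. F u (b o\<^sub>L v) + H (u o\<^sub>L a) v)"
| scale: "dpair G y a F \<Longrightarrow> dpair G y (scaleC_op c a) (\<lambda>u v. c * F u v)"

context tracial
begin

lemma subalgD: assumes "subalg A"
  shows "a \<in> A \<Longrightarrow> a \<in> M" "id_blinfun \<in> A" "a \<in> A \<Longrightarrow> b \<in> A \<Longrightarrow> a + b \<in> A"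
    "a \<in> A \<Longrightarrow> b \<in> A \<Longrightarrow> (a o\<^sub>L b) \<in> A" "a \<in> A \<Longrightarrow> scaleC_op c a \<in> A"
    "a \<in> A \<Longrightarrow> b \<in> A \<Longrightarrow> a - b \<in> A"
  using assms unfolding subalg_def 
  by (auto, metis diff_conv_add_uminus scaleC_op_simps(4))

lemma subalg_hull: "S \<subseteq> M \<Longrightarrow> subalg (star_subalgebra hull S)"
  using star_subalgebra_hull[OF star_M, of S] unfolding subalg_def star_subalgebra_def by blast

text \<open>The Schwinger-Dyson equation
  \<open>\<tau>(x a) = (\<tau> \<otimes> \<tau>)(\<partial>a)\<close>: \<open>x\<close> pairs with
  the letter \<open>y\<close>, with covariance 1, and with nothing in \<open>G\<close>. A
  semicircular element takes \<open>y = x\<close>; a circular one takes \<open>y = adj x\<close> and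
  has itself in \<open>G\<close>.\<close>

definition SD :: "'h oper \<Rightarrow> 'h oper \<Rightarrow> 'h oper set \<Rightarrow> bool" where
  "SD x y G \<longleftrightarrow> (\<forall>a F. dpair G y a F \<longrightarrow> \<tau> (x o\<^sub>L a) = F id_blinfun id_blinfun)"

text \<open>\<open>\<partial>a\<close> is a finite sum of elementary tensors, recorded as the list
  \<open>p\<close> of their legs. Since the legs lie in the same algebra \<open>A\<close>, freeness
  can later be applied to each leg.\<close>

lemma dpair_rep:
  assumes A: "subalg A" and G: "G \<subseteq> A" and y: "y \<in> A" and d: "dpair G y a F"
  shows "a \<in> A \<and> (\<exists>p. set p \<subseteq> A \<times> A \<and>
    (\<forall>u\<in>M. \<forall>v\<in>M. F u v = (\<Sum>(l, r)\<leftarrow>p. \<tau> (u o\<^sub>L l) * \<tau> (r o\<^sub>L v))))"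
  using d
proof induction
  case (const b)
  then show ?case using G by (auto intro!: exI[of _ "[]"])
next
  case mark
  show ?case using y A by (auto intro!: exI[of _ "[(id_blinfun, id_blinfun)]"] simp: subalg_def)
next
  case (add a F b H)
  then obtain p q where "set p \<subseteq> A \<times> A" "set q \<subseteq> A \<times> A"
    "\<forall>u\<in>M. \<forall>v\<in>M. F u v = (\<Sum>(l, r)\<leftarrow>p. \<tau> (u o\<^sub>L l) * \<tau> (r o\<^sub>L v))"
    "\<forall>u\<in>M. \<forall>v\<in>M. H u v = (\<Sum>(l, r)\<leftarrow>q. \<tau> (u o\<^sub>L l) * \<tau> (r o\<^sub>L v))" by blast
  then show ?case using add A by (auto intro!: exI[of _ "p @ q"] subalgD)
next
  case (mult a F b H)
  then obtain p q where pq: "set p \<subseteq> A \<times> A" "set q \<subseteq> A \<times> A"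
    "\<forall>u\<in>M. \<forall>v\<in>M. F u v = (\<Sum>(l, r)\<leftarrow>p. \<tau> (u o\<^sub>L l) * \<tau> (r o\<^sub>L v))"
    "\<forall>u\<in>M. \<forall>v\<in>M. H u v = (\<Sum>(l, r)\<leftarrow>q. \<tau> (u o\<^sub>L l) * \<tau> (r o\<^sub>L v))" by blast
  have ab: "a \<in> A" "b \<in> A" "a \<in> M" "b \<in> M" using mult subalgD[OF A] by auto
  let ?p = "map (\<lambda>(l, r). (l, r o\<^sub>L b)) p @ map (\<lambda>(l, r). (a o\<^sub>L l, r)) q"
  have "set ?p \<subseteq> A \<times> A" using pq(1,2) ab by (auto intro!: subalgD(4)[OF A])
  moreover have "F u (b o\<^sub>L v) + H (u o\<^sub>L a) v = (\<Sum>(l, r)\<leftarrow>?p. \<tau> (u o\<^sub>L l) * \<tau> (r o\<^sub>L v))"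
    if "u \<in> M" "v \<in> M" for u v
    using pq(3,4) ab that by (simp add: compose_assoc o_def case_prod_unfold)
  ultimately show ?case using ab subalgD(4)[OF A] by blast
next
  case (scale a F c)
  then obtain p where p: "set p \<subseteq> A \<times> A"
    "\<forall>u\<in>M. \<forall>v\<in>M. F u v = (\<Sum>(l, r)\<leftarrow>p. \<tau> (u o\<^sub>L l) * \<tau> (r o\<^sub>L v))" by blast
  let ?p = "map (\<lambda>(l, r). (scaleC_op c l, r)) p"
  have "c * F u v = (\<Sum>(l, r)\<leftarrow>?p. \<tau> (u o\<^sub>L l) * \<tau> (r o\<^sub>L v))" if "u \<in> M" "v \<in> M" for u v
  proof -
    have "(\<Sum>(l, r)\<leftarrow>?p. \<tau> (u o\<^sub>L l) * \<tau> (r o\<^sub>L v)) = (\<Sum>(l, r)\<leftarrow>p. c * (\<tau> (u o\<^sub>L l) * \<tau> (r o\<^sub>L v)))"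
      unfolding map_map o_def case_prod_unfold
      by (rule arg_cong[of _ _ sum_list], rule map_cong[OF refl])
        (use p(1) that subalgD(1)[OF A] in \<open>auto simp: scaleC_op_compose_right M_clinear tau_scaleC subset_iff mem_Times_iff\<close>)
    then show ?thesis using p(2) that
      by (simp add: case_prod_unfold sum_list_const_mult)
  qed
  moreover have "set ?p \<subseteq> A \<times> A" using p(1) by (auto intro!: subalgD(5)[OF A])
  ultimately show ?case using scale subalgD(5)[OF A] by blast
qed

lemma dpair_M: "G \<subseteq> M \<Longrightarrow> y \<in> M \<Longrightarrow> dpair G y a F \<Longrightarrow> a \<in> M"
  using dpair_rep[of M G y a F] by (auto simp: subalg_def)

lemma dpair_linear:
  assumes "G \<subseteq> M" "y \<in> M" "dpair G y a F" "u \<in> M" "v \<in> M" "u' \<in> M" "v' \<in> M"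
  shows "F (u + u') v = F u v + F u' v" "F u (v + v') = F u v + F u v'"
    "F (scaleC_op c u) v = c * F u v" "F u (scaleC_op c v) = c * F u v" "F 0 v = 0" "F u 0 = 0"
proof -
  have M: "subalg M" by (auto simp: subalg_def)
  obtain p where p: "set p \<subseteq> M \<times> M"
    "\<And>u v. u\<in>M \<Longrightarrow> v\<in>M \<Longrightarrow> F u v = (\<Sum>(l, r)\<leftarrow>p. \<tau> (u o\<^sub>L l) * \<tau> (r o\<^sub>L v))"
    using dpair_rep[OF M assms(1-3)] by blast
  show add: "F (u + u') v = F u v + F u' v" "F u (v + v') = F u v + F u v'"
    unfolding p(2)[OF M_add[OF assms(4,6)] assms(5)] p(2)[OF assms(4,5)] p(2)[OF assms(6,5)]
      p(2)[OF assms(4) M_add[OF assms(5,7)]] p(2)[OF assms(4,7)]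
      sum_list_addf[symmetric] case_prod_unfold
    by (rule arg_cong[of _ _ sum_list], rule map_cong[OF refl],
        use p(1) assms in \<open>force simp: compose_add tau_add algebra_simps\<close>)+
  show *: "F (scaleC_op c u) v = c * F u v" "F u (scaleC_op c v) = c * F u v" for c
    unfolding p(2)[OF M_scaleC[OF assms(4)] assms(5)] p(2)[OF assms(4,5)]
      p(2)[OF assms(4) M_scaleC[OF assms(5)]] sum_list_const_mult[symmetric] case_prod_unfold
    by (rule arg_cong[of _ _ sum_list], rule map_cong[OF refl],
        use p(1) assms in \<open>force simp: scaleC_op_compose_left scaleC_op_compose_right M_clinear tau_scaleC\<close>)+
  show "F 0 v = 0" "F u 0 = 0"
    using *[of 0] by simp_all
qed

text \<open>\<open>lin S\<close> is the span of the pairs in \<open>S\<close>; functionals are only compared on \<open>M\<close>, the domain of \<open>\<tau>\<close>.\<close>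

inductive lin :: "('h oper \<times> ('h oper \<Rightarrow> 'h oper \<Rightarrow> complex)) set \<Rightarrow> 'h oper \<Rightarrow>
    ('h oper \<Rightarrow> 'h oper \<Rightarrow> complex) \<Rightarrow> bool" for S where
  base: "(a, F) \<in> S \<Longrightarrow> lin S (scaleC_op c a) (\<lambda>u v. c * F u v)"
| add: "lin S a F \<Longrightarrow> lin S b H \<Longrightarrow> lin S (a + b) (\<lambda>u v. F u v + H u v)"
| eq: "lin S a F \<Longrightarrow> (\<And>u v. u \<in> M \<Longrightarrow> v \<in> M \<Longrightarrow> F u v = H u v) \<Longrightarrow> lin S a H"

text \<open>Left linearity is what the Leibniz rule requires: the quotient of a right factor is
  evaluated at \<open>u o\<^sub>L a\<close>, where \<open>a\<close> is built from sums and scalar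
  multiples.\<close>

definition left_linear :: "('h oper \<times> ('h oper \<Rightarrow> 'h oper \<Rightarrow> complex)) set \<Rightarrow> bool" where
  "left_linear S \<longleftrightarrow> (\<forall>(a, F)\<in>S. a \<in> M \<and> (\<forall>u\<in>M. \<forall>v\<in>M. (\<forall>u'\<in>M. F (u + u') v = F u v + F u' v) \<and>
     (\<forall>c. F (scaleC_op c u) v = c * F u v)))"

lemma lin_base1: "(a, F) \<in> S \<Longrightarrow> lin S a F"
  using lin.base[of a F S 1] by simp

lemma lin_M: "lin S a F \<Longrightarrow> left_linear S \<Longrightarrow> a \<in> M"
  by (induction rule: lin.induct) (auto simp: left_linear_def)

lemma lin_left_linear:
  "lin S b H \<Longrightarrow> left_linear S \<Longrightarrow> u \<in> M \<Longrightarrow> u' \<in> M \<Longrightarrow> v \<in> M \<Longrightarrow>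
    H (u + u') v = H u v + H u' v \<and> H (scaleC_op c u) v = c * H u v"
proof (induction rule: lin.induct)
  case (base a F d)
  then show ?case by (fastforce simp: left_linear_def algebra_simps)
qed (simp_all add: algebra_simps)

lemma lin_scale: "lin S a F \<Longrightarrow> lin S (scaleC_op c a) (\<lambda>u v. c * F u v)"
proof (induction rule: lin.induct)
  case (base a F d)
  then show ?case using lin.base[of a F S "c * d"] by (simp add: scaleC_op_scaleC_op mult.assoc)
next
  case (add a F b H)
  then show ?case using lin.add[OF add.IH] by (simp add: scaleC_op_add algebra_simps)
next
  case (eq a F H)
  from lin.eq[OF eq.IH] eq(2) show ?case by simp
qed

lemma lin_mult:
  assumes S: "left_linear S" and G: "G \<subseteq> M" "y \<in> M" and g: "dpair G y g H"
    and step: "\<And>a F. (a, F) \<in> S \<Longrightarrow> lin S (g o\<^sub>L a) (\<lambda>u v. H u (a o\<^sub>L v) + F (u o\<^sub>L g) v)"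
  shows "lin S a F \<Longrightarrow> lin S (g o\<^sub>L a) (\<lambda>u v. H u (a o\<^sub>L v) + F (u o\<^sub>L g) v)"
proof (induction rule: lin.induct)
  case (base a F c)
  have M: "g \<in> M" "a \<in> M" using dpair_M[OF G g] base S by (auto simp: left_linear_def)
  show ?case
    using lin.eq[OF lin_scale[OF step[OF base], of c]] dpair_linear[OF G g _ _ M_zero M_zero] M
    by (simp add: scaleC_op_compose_right scaleC_op_compose_left M_clinear algebra_simps)
next
  case (add a F b K)
  have M: "g \<in> M" "a \<in> M" "b \<in> M" using dpair_M[OF G g] add.hyps lin_M S by blast+
  show ?case
    using lin.eq[OF lin.add[OF add.IH]] dpair_linear(2)[OF G g _ _ M_zero] M
    by (simp add: compose_add algebra_simps)
next
  case (eq a F K)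
  show ?case using lin.eq[OF eq.IH] eq(2) dpair_M[OF G g] by simp
qed

text \<open>Induction over the polynomial \<open>a\<close> as a left multiplier; \<open>step\<close>
  treats a single letter acting on a single element of \<open>S\<close>.\<close>

lemma lin_dpair:
  assumes S: "left_linear S" and G: "G \<subseteq> M" "y \<in> M"
    and step: "\<And>g a F. g \<in> G \<Longrightarrow> (a, F) \<in> S \<Longrightarrow> lin S (g o\<^sub>L a) (\<lambda>u v. F (u o\<^sub>L g) v)"
      "\<And>a F. (a, F) \<in> S \<Longrightarrow> lin S (y o\<^sub>L a) (\<lambda>u v. \<tau> u * \<tau> (a o\<^sub>L v) + F (u o\<^sub>L y) v)"
  shows "dpair G y a F \<Longrightarrow> lin S b H \<Longrightarrow> lin S (a o\<^sub>L b) (\<lambda>u v. F u (b o\<^sub>L v) + H (u o\<^sub>L a) v)"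
proof (induction arbitrary: b H rule: dpair.induct)
  case (const c)
  then show ?case
    using lin_mult[OF S G dpair.const[OF const(1)] _ const(2)] step(1)[OF const(1)] by simp
next
  case mark
  then show ?case
    using lin_mult[OF S G dpair.mark _ mark] step(2) by simp
next
  case (add a F a' F')
  have M: "a \<in> M" "a' \<in> M" "b \<in> M"
    using dpair_M[OF G] add.hyps lin_M[OF add.prems S] by auto
  have "H (u o\<^sub>L (a + a')) v = H (u o\<^sub>L a) v + H (u o\<^sub>L a') v" if "u \<in> M" "v \<in> M" for u v
    using lin_left_linear[OF add.prems S] that M by (simp add: compose_add)
  then show ?case
    using lin.eq[OF lin.add[OF add.IH(1)[OF add.prems] add.IH(2)[OF add.prems]]]
    by (simp add: compose_add algebra_simps)
next
  case (mult a F a' F')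
  show ?case
    using mult.IH(1)[OF mult.IH(2)[OF mult.prems]] by (simp add: compose_assoc add.assoc)
next
  case (scale a F c)
  have M: "a \<in> M" "b \<in> M"
    using dpair_M[OF G] scale.hyps lin_M[OF scale.prems S] by auto
  have "H (u o\<^sub>L scaleC_op c a) v = c * H (u o\<^sub>L a) v" if "u \<in> M" "v \<in> M" for u v
    using lin_left_linear[OF scale.prems S] that M by (simp add: scaleC_op_compose_right M_clinear)
  then show ?case
    using lin.eq[OF lin_scale[OF scale.IH[OF scale.prems], of c]]
    by (simp add: scaleC_op_compose_left algebra_simps)
qed

text \<open>The equation need only be checked on a family \<open>S\<close> whose span contains the
  unit and absorbs each letter from the left together with its Leibniz rule. A polynomial
  \<open>a\<close>, written as \<open>a o\<^sub>L id_blinfun\<close>, then lies in the span with its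
  own quotient, and no normal form of \<open>a\<close> has to be chosen.\<close>

lemma SD_lin:
  assumes S: "left_linear S" and G: "G \<subseteq> M" "y \<in> M" and x: "x \<in> M"
    and unit: "lin S id_blinfun (\<lambda>u v. 0)"
    and step: "\<And>g a F. g \<in> G \<Longrightarrow> (a, F) \<in> S \<Longrightarrow> lin S (g o\<^sub>L a) (\<lambda>u v. F (u o\<^sub>L g) v)"
      "\<And>a F. (a, F) \<in> S \<Longrightarrow> lin S (y o\<^sub>L a) (\<lambda>u v. \<tau> u * \<tau> (a o\<^sub>L v) + F (u o\<^sub>L y) v)"
    and sd: "\<And>a F. (a, F) \<in> S \<Longrightarrow> \<tau> (x o\<^sub>L a) = F id_blinfun id_blinfun"
  shows "SD x y G"
  unfolding SD_def
proof (intro allI impI)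
  have lin: "lin S a F \<Longrightarrow> \<tau> (x o\<^sub>L a) = F id_blinfun id_blinfun" for a F
  proof (induction rule: lin.induct)
    case (base a F c)
    then have "a \<in> M" using S by (auto simp: left_linear_def)
    then show ?case
      using sd[OF base] x by (simp add: scaleC_op_compose_right M_clinear tau_scaleC)
  next
    case (add a F b H)
    then show ?case using lin_M[OF _ S] x by (simp add: compose_add tau_add)
  qed auto
  fix a F assume d: "dpair G y a F"
  have "lin S (a o\<^sub>L id_blinfun) (\<lambda>u v. F u (id_blinfun o\<^sub>L v) + 0)"
    by (rule lin_dpair[OF S G _ _ d unit]; fact step)
  from lin[OF this] show "\<tau> (x o\<^sub>L a) = F id_blinfun id_blinfun" by simp
qed

end

text \<open>\<open>\<A> True\<close> carries the known equation for \<open>x\<close> and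
  \<open>y\<close> over \<open>G\<close>. \<open>\<A> False\<close> is the free algebra that
  \<open>SD_join\<close> adjoins to \<open>G\<close>, so its elements are constants for the
  derivation.\<close>

locale free_pair = tracial +
  fixes \<A> :: "bool \<Rightarrow> 'a oper set" and x y :: "'a oper" and G :: "'a oper set"
  assumes alg: "\<And>i. subalg (\<A> i)"
    and free: "free_subalgebras \<tau> \<A>"
    and G: "G \<subseteq> \<A> True" and idG: "id_blinfun \<in> G" and y: "y \<in> \<A> True" and x: "x \<in> \<A> True"
    and tau_x: "\<tau> x = 0" and sd: "SD x y G"
begin

definition blk :: "bool \<Rightarrow> 'a oper \<Rightarrow> ('a oper \<Rightarrow> 'a oper \<Rightarrow> complex) \<Rightarrow> bool" where
  "blk i a F = (if i then dpair G y a F else a \<in> \<A> False \<and> F = (\<lambda>u v. 0))"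

text \<open>The Leibniz rule along a word: \<open>dF ws u v\<close> is
  \<open>(\<tau> \<otimes> \<tau>)(u \<partial>(ev ws) v)\<close>, each letter supplying its own
  quotient as third component.\<close>

fun dF :: "(bool \<times> 'a oper \<times> ('a oper \<Rightarrow> 'a oper \<Rightarrow> complex)) list \<Rightarrow> 'a oper \<Rightarrow> 'a oper \<Rightarrow> complex" where
  "dF [] u v = 0"
| "dF ((i, a, F) # ws) u v = F u (op_prod (map (fst \<circ> snd) ws) o\<^sub>L v) + dF ws (u o\<^sub>L a) v"

abbreviation ev :: "(bool \<times> 'a oper \<times> ('a oper \<Rightarrow> 'a oper \<Rightarrow> complex)) list \<Rightarrow> 'a oper" where
  "ev ws \<equiv> op_prod (map (fst \<circ> snd) ws)"

definition alt :: "(bool \<times> 'a oper \<times> ('a oper \<Rightarrow> 'a oper \<Rightarrow> complex)) list \<Rightarrow> bool" where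
  "alt ws \<longleftrightarrow> distinct_adj (map fst ws) \<and> (\<forall>(i, a, F)\<in>set ws. blk i a F \<and> \<tau> a = 0)"

lemma A_M: "a \<in> \<A> i \<Longrightarrow> a \<in> M"
  using subalgD(1)[OF alg] .

lemma GM: "G \<subseteq> M" and yM: "y \<in> M" and xM: "x \<in> M"
  using G y x A_M by auto

lemma GAM: "G \<union> \<A> False \<subseteq> M"
  using GM A_M by auto

lemma blk_A: "blk i a F \<Longrightarrow> a \<in> \<A> i"
  using dpair_rep[OF alg G y] by (auto simp: blk_def split: if_splits)

lemma alt_ConsD: "alt (w # ws) \<Longrightarrow> alt ws"
  by (cases ws) (auto simp: alt_def)

lemma alt_M: "alt ws \<Longrightarrow> ev ws \<in> M"
  by (rule M_prod) (auto simp: alt_def dest!: blk_A A_M)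

lemma freeD:
  "w \<noteq> [] \<Longrightarrow> distinct_adj (map fst w) \<Longrightarrow> (\<And>i a. (i, a) \<in> set w \<Longrightarrow> a \<in> \<A> i \<and> \<tau> a = 0) \<Longrightarrow>
    \<tau> (op_prod (map snd w)) = 0"
  using free unfolding free_subalgebras_def by blast

lemma tau_alt: assumes "alt ws" "ws \<noteq> []" shows "\<tau> (ev ws) = 0"
proof -
  have "\<tau> (op_prod (map snd (map (\<lambda>(i, a, F). (i, a)) ws))) = 0"
    using assms by (intro freeD) (auto simp: alt_def case_prod_unfold o_def dest: blk_A)
  then show ?thesis by (simp add: case_prod_unfold o_def)
qed

lemma blk_linear:
  assumes "blk i a F" "u \<in> M" "v \<in> M" "u' \<in> M" "v' \<in> M"
  shows "F (u + u') v = F u v + F u' v" "F u (v + v') = F u v + F u v'"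
    "F (scaleC_op c u) v = c * F u v" "F u (scaleC_op c v) = c * F u v" "F 0 v = 0" "F u 0 = 0"
  using assms dpair_linear[OF GM yM, of a F] by (auto simp: blk_def split: if_splits)

lemma dF_linear_aux:
  assumes "alt ws" "u \<in> M" "v \<in> M" "u' \<in> M"
  shows "dF ws (u + u') v = dF ws u v + dF ws u' v \<and> dF ws (scaleC_op c u) v = c * dF ws u v"
  using assms
proof (induction ws arbitrary: u u')
  case (Cons w ws)
  obtain i a F where w: "w = (i, a, F)" by (cases w)
  have b: "blk i a F" and aM: "a \<in> M" and ws: "alt ws" "ev ws \<in> M"
    using Cons.prems w blk_A A_M alt_ConsD alt_M by (fastforce simp: alt_def)+
  show ?case
    using Cons.IH[OF ws(1)] Cons.prems ws aM blk_linear[OF b]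
    by (simp add: w compose_add scaleC_op_compose_left algebra_simps)
qed auto

lemmas dF_linear = dF_linear_aux[THEN conjunct1] dF_linear_aux[THEN conjunct2, OF _ _ _ M_zero]

definition cen :: "'a oper \<Rightarrow> 'a oper" where "cen a = a - scaleC_op (\<tau> a) id_blinfun"

lemma cen: "a \<in> \<A> i \<Longrightarrow> cen a \<in> \<A> i \<and> \<tau> (cen a) = 0" "a = cen a + scaleC_op (\<tau> a) id_blinfun"
  using A_M by (auto simp: cen_def tau_diff tau_scaleC intro!: subalgD[OF alg])

text \<open>Centring subtracts a scalar, and the derivation kills scalars because
  \<open>id_blinfun \<in> G\<close>.\<close>

lemma blk_cen: "blk i a F \<Longrightarrow> blk i (cen a) F"
proof -
  assume b: "blk i a F"
  show ?thesis
  proof (cases i)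
    case True
    then have "dpair G y (a + scaleC_op (- \<tau> a) id_blinfun) (\<lambda>u v. F u v + (- \<tau> a) * 0)"
      using b idG by (intro dpair.add dpair.scale dpair.const) (auto simp: blk_def)
    moreover have "scaleC_op (- \<tau> a) id_blinfun = - scaleC_op (\<tau> a) (id_blinfun :: 'a oper)"
      using scaleC_op_scaleC_op[of "-1" "\<tau> a" "id_blinfun :: 'a oper"] by simp
    ultimately show ?thesis using True by (simp add: blk_def cen_def)
  qed (use b cen in \<open>auto simp: blk_def\<close>)
qed

text \<open>In each nonzero Leibniz term the left trace is \<open>\<tau>(u l)\<close>, where the
  word \<open>u\<close> ends in \<open>\<A> False\<close> and \<open>l\<close> lies in
  \<open>\<A> True\<close>. Splitting \<open>l\<close> into its centred part and a scalar leaves two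
  alternating centred words, of trace 0.\<close>

lemma dF_vanish:
  assumes "alt ws" "U \<noteq> []" "distinct_adj (map fst U @ map fst ws)"
    "\<And>i a. (i, a) \<in> set U \<Longrightarrow> a \<in> \<A> i \<and> \<tau> a = 0"
  shows "dF ws (op_prod (map snd U)) id_blinfun = 0"
  using assms
proof (induction ws arbitrary: U)
  case (Cons w ws)
  obtain i a F where w: "w = (i, a, F)" by (cases w)
  have b: "blk i a F" "\<tau> a = 0" and ws: "alt ws" "ev ws \<in> M"
    using Cons.prems w alt_ConsD alt_M by (fastforce simp: alt_def)+
  let ?u = "op_prod (map snd U)"
  have uM: "?u \<in> M"
    by (rule M_prod) (use Cons.prems(4) A_M in fastforce)
  have "dF ws (op_prod (map snd (U @ [(i, a)]))) id_blinfun = 0"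
    using Cons.prems(3,4) b blk_A w by (intro Cons.IH ws) auto
  then have 1: "dF ws (?u o\<^sub>L a) id_blinfun = 0"
    by (simp add: op_prod_append)
  have "F ?u (ev ws) = 0"
  proof (cases i)
    case True
    then obtain p where p: "set p \<subseteq> \<A> True \<times> \<A> True"
      "F ?u (ev ws) = (\<Sum>(l, r)\<leftarrow>p. \<tau> (?u o\<^sub>L l) * \<tau> (r o\<^sub>L ev ws))"
      using dpair_rep[OF alg G y] b uM ws by (fastforce simp: blk_def)
    have "\<tau> (?u o\<^sub>L l) = 0" if l: "l \<in> \<A> True" for l
    proof -
      have da: "distinct_adj (map fst (U @ [(True, cen l)]))" "distinct_adj (map fst U)"
        using Cons.prems(3) True w by (auto simp: distinct_adj_append_iff)
      have "\<tau> (op_prod (map snd (U @ [(True, cen l)]))) = 0"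
        using Cons.prems(4) cen(1)[OF l] by (intro freeD da) auto
      moreover have "\<tau> ?u = 0"
        using Cons.prems(2,4) by (intro freeD da) auto
      moreover have "(?u o\<^sub>L l) = (?u o\<^sub>L cen l) + (scaleC_op (\<tau> l) ?u)"
        by (subst cen(2)[of l]) (use uM in \<open>simp add: compose_add scaleC_op_compose_right M_clinear\<close>)
      ultimately show ?thesis
        using uM A_M[of "cen l" True] cen(1)[OF l] by (simp add: op_prod_append tau_add tau_scaleC)
    qed
    then show ?thesis
      unfolding p(2) using p(1) by (intro sum_list_map_zero) auto
  qed (use b in \<open>simp add: blk_def\<close>)
  with 1 show ?case by (simp add: w)
qed auto

lemma SD_alt:
  assumes ws: "alt ws"
  shows "\<tau> (x o\<^sub>L ev ws) = dF ws id_blinfun id_blinfun"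
proof (cases ws)
  case Nil
  then show ?thesis by (simp add: tau_x)
next
  case (Cons w t)
  obtain i a F where w: "w = (i, a, F)" by (cases w)
  have b: "blk i a F" "\<tau> a = 0" and t: "alt t" "ev t \<in> M" and aA: "a \<in> \<A> i" and aM: "a \<in> M"
    using ws w Cons alt_ConsD alt_M blk_A A_M by (fastforce simp: alt_def)+
  \<comment> \<open>Every Leibniz term except the one that differentiates the first letter has a
    nonempty alternating word on its left.\<close>
  have "dF t (op_prod (map snd [(i, a)])) id_blinfun = 0"
    using ws b aA by (intro dF_vanish t) (auto simp: Cons w alt_def)
  then have R: "dF ws id_blinfun id_blinfun = F id_blinfun (ev t)"
    by (simp add: Cons w)
  show ?thesis
  proof (cases i)
    case False
    have "\<tau> (op_prod (map snd ((True, x) # map (\<lambda>(i, a, F). (i, a)) ws))) = 0"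
      using ws x tau_x False
      by (intro freeD) (auto simp: alt_def case_prod_unfold o_def Cons w dest: blk_A)
    then show ?thesis using R b False by (simp add: case_prod_unfold o_def blk_def)
  next
    case True
    obtain p where p: "set p \<subseteq> \<A> True \<times> \<A> True"
      "\<forall>u\<in>M. \<forall>v\<in>M. F u v = (\<Sum>(l, r)\<leftarrow>p. \<tau> (u o\<^sub>L l) * \<tau> (r o\<^sub>L v))"
      using dpair_rep[OF alg G y] b True by (fastforce simp: blk_def)
    have sda: "\<tau> (x o\<^sub>L a) = F id_blinfun id_blinfun"
      using sd b True by (simp add: SD_def blk_def)
    show ?thesis
    proof (cases "t = []")
      case True
      then show ?thesis using R sda by (simp add: Cons w)
    next
      case False
      \<comment> \<open>This settles both sides at once: it applies to the right legs
        \<open>r\<close> of the quotient and, with \<open>x o\<^sub>L a\<close> as \<open>l\<close>,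
        to the trace.\<close>
      have key: "\<tau> (l o\<^sub>L ev t) = 0" if l: "l \<in> \<A> True" for l
      proof -
        have "distinct_adj (True # map fst t)" using ws True by (simp add: Cons w alt_def)
        then have "\<tau> (op_prod (map snd ((True, cen l) # map (\<lambda>(i, a, F). (i, a)) t))) = 0"
          using t cen(1)[OF l]
          by (intro freeD) (auto simp: alt_def case_prod_unfold o_def dest: blk_A)
        then have "\<tau> (cen l o\<^sub>L ev t) = 0" by (simp add: case_prod_unfold o_def)
        moreover have "(l o\<^sub>L ev t) = (cen l o\<^sub>L ev t) + scaleC_op (\<tau> l) (ev t)"
          by (subst cen(2)[of l]) (simp add: compose_add scaleC_op_compose_left)
        ultimately show ?thesis
          using tau_alt[OF t(1) False] A_M[of "cen l" True] cen(1)[OF l] t(2) by (simp add: tau_add tau_scaleC)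
      qed
      have "(\<Sum>(l, r)\<leftarrow>p. \<tau> (id_blinfun o\<^sub>L l) * \<tau> (r o\<^sub>L ev t)) = 0"
        using p(1) key by (intro sum_list_map_zero) auto
      then have "F id_blinfun (ev t) = 0" using p(2) t by simp
      moreover have "\<tau> ((x o\<^sub>L a) o\<^sub>L ev t) = 0"
        using x aA True by (intro key subalgD(4)[OF alg]) auto
      ultimately show ?thesis using R by (simp add: Cons w compose_assoc)
    qed
  qed
qed

definition alts :: "('a oper \<times> ('a oper \<Rightarrow> 'a oper \<Rightarrow> complex)) set" where
  "alts = {(ev ws, dF ws) | ws. alt ws}"

abbreviation "comb \<equiv> lin alts"

lemma comb_alt: "alt ws \<Longrightarrow> comb (scaleC_op c (ev ws)) (\<lambda>u v. c * dF ws u v)"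
  by (rule lin.base) (auto simp: alts_def)

text \<open>A new factor is centred and prepended, its scalar part leaving the shorter word. If it
  comes from the same algebra as the first letter, the two are multiplied before centring, so that
  the word still alternates.\<close>

lemma comb_blk_alt:
  assumes g: "blk i g H" and ws: "alt ws"
  shows "comb (g o\<^sub>L ev ws) (\<lambda>u v. H u (ev ws o\<^sub>L v) + dF ws (u o\<^sub>L g) v)"
proof (cases "ws \<noteq> [] \<and> fst (hd ws) = i")
  case False
  have gA: "g \<in> \<A> i" and gM: "g \<in> M" using blk_A[OF g] A_M[OF blk_A[OF g]] by auto
  have "alt ((i, cen g, H) # ws)"
    using ws False blk_cen[OF g] cen(1)[OF gA]
    by (cases ws) (auto simp: alt_def)
  from lin.add[OF comb_alt[OF this, of 1] comb_alt[OF ws, of "\<tau> g"]]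
  have *: "comb ((cen g o\<^sub>L ev ws) + scaleC_op (\<tau> g) (ev ws))
      (\<lambda>u v. H u (ev ws o\<^sub>L v) + dF ws (u o\<^sub>L cen g) v + \<tau> g * dF ws u v)"
    by simp
  have "(cen g o\<^sub>L ev ws) + scaleC_op (\<tau> g) (ev ws) = (g o\<^sub>L ev ws)"
    by (subst (2) cen(2)[of g]) (simp add: compose_add scaleC_op_compose_left)
  moreover have "dF ws (u o\<^sub>L cen g) v + \<tau> g * dF ws u v = dF ws (u o\<^sub>L g) v"
    if "u \<in> M" "v \<in> M" for u v
  proof -
    have "(u o\<^sub>L g) = (u o\<^sub>L cen g) + scaleC_op (\<tau> g) u"
      by (subst cen(2)[of g]) (use that in \<open>simp add: compose_add scaleC_op_compose_right M_clinear\<close>)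
    then show ?thesis using dF_linear[OF ws] that cen(1)[OF gA] A_M[of "cen g" i] by simp
  qed
  ultimately show ?thesis
    using lin.eq[OF *] by (simp add: add.assoc)
next
  case True
  then obtain a F t where wst: "ws = (i, a, F) # t" by (cases ws) auto
  have b: "blk i a F" and t: "alt t" "ev t \<in> M" 
    using ws wst alt_ConsD alt_M by (fastforce simp: alt_def)+
  have M: "a \<in> M" "g \<in> M" and A: "a \<in> \<A> i" "g \<in> \<A> i" using A_M[OF blk_A[OF b]] A_M[OF blk_A[OF g]] blk_A[OF b] blk_A[OF g] by auto
  define L where "L u v = H u (a o\<^sub>L v) + F (u o\<^sub>L g) v" for u v
  have ga: "blk i (g o\<^sub>L a) L"
    using b g A dpair.mult[of G y g H a F] subalgD(4)[OF alg, of g i a]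
    by (auto simp: blk_def L_def[abs_def] split: if_splits)
  let ?ga = "g o\<^sub>L a"
  have gaA: "?ga \<in> \<A> i" and gaM: "?ga \<in> M" using blk_A[OF ga] A_M[OF blk_A[OF ga]] by auto
  have "alt ((i, cen ?ga, L) # t)"
    using ws blk_cen[OF ga] cen(1)[OF gaA] by (auto simp: alt_def wst)
  from lin.add[OF comb_alt[OF this, of 1] comb_alt[OF t(1), of "\<tau> ?ga"]]
  have *: "comb ((cen ?ga o\<^sub>L ev t) + scaleC_op (\<tau> ?ga) (ev t))
      (\<lambda>u v. L u (ev t o\<^sub>L v) + dF t (u o\<^sub>L cen ?ga) v + \<tau> ?ga * dF t u v)"
    by simp
  have "(cen ?ga o\<^sub>L ev t) + scaleC_op (\<tau> ?ga) (ev t) = (?ga o\<^sub>L ev t)"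
    using arg_cong[OF cen(2)[of ?ga], of "\<lambda>z. z o\<^sub>L ev t"]
    by (simp add: compose_add scaleC_op_compose_left)
  moreover have "dF t (u o\<^sub>L cen ?ga) v + \<tau> ?ga * dF t u v = dF t (u o\<^sub>L ?ga) v"
    if "u \<in> M" "v \<in> M" for u v
  proof -
    have "(u o\<^sub>L ?ga) = (u o\<^sub>L cen ?ga) + scaleC_op (\<tau> ?ga) u"
      by (subst cen(2)[of ?ga]) (use that in \<open>simp add: compose_add scaleC_op_compose_right M_clinear\<close>)
    then show ?thesis using dF_linear[OF t(1)] that cen(1)[OF gaA] A_M[of "cen ?ga" i] by simp
  qed
  ultimately show ?thesis
    using lin.eq[OF *] by (simp add: add.assoc wst L_def compose_assoc)
qed

text \<open>A Schwinger-Dyson equation in one algebra persists after adjoining a free one: on an alternating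
  product of centred elements both sides vanish unless the product has a single factor.\<close>

lemma SD_join: "SD x y (G \<union> \<A> False)"
proof (rule SD_lin[where S = alts])
  show "left_linear alts"
    unfolding left_linear_def alts_def by (auto simp: alt_M dF_linear)
  show "comb id_blinfun (\<lambda>u v. 0)"
    using comb_alt[of "[]" 1] by (simp add: alt_def)
  show "comb (g o\<^sub>L a) (\<lambda>u v. F (u o\<^sub>L g) v)" if "g \<in> G \<union> \<A> False" "(a, F) \<in> alts" for g a F
    using that comb_blk_alt[of True g "\<lambda>u v. 0"] comb_blk_alt[of False g "\<lambda>u v. 0"]
    by (auto simp: blk_def dpair.const alts_def)
  show "comb (y o\<^sub>L a) (\<lambda>u v. \<tau> u * \<tau> (a o\<^sub>L v) + F (u o\<^sub>L y) v)" if "(a, F) \<in> alts" for a F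
    using that comb_blk_alt[of True y "\<lambda>u v. \<tau> u * \<tau> v"] by (auto simp: blk_def dpair.mark alts_def)
  show "\<tau> (x o\<^sub>L a) = F id_blinfun id_blinfun" if "(a, F) \<in> alts" for a F
    using that SD_alt by (auto simp: alts_def)
qed (use GAM yM xM in auto)

end

section \<open>Moments of the semicircle law\<close>

lemma fps_const_numeral_eq: "fps_const (numeral k) = (numeral k :: 'a::comm_ring_1 fps)"
  by (rule numeral_fps_const[symmetric])

definition sc_moment :: "nat \<Rightarrow> real" where "sc_moment n = (\<integral>t. t ^ n \<partial>semicircle_measure)"

lemma sc_moment_eq: "sc_moment n = integral {-2..2} (\<lambda>t. t ^ n * (1 / (2 * pi) * sqrt (4 - t\<^sup>2)))"
proof -
  have pos: "0 \<le> 1 / (2 * pi) * sqrt (4 - t\<^sup>2) * indicator {-2..2} t" for t :: real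
    by (auto simp: indicator_def abs_le_square_iff[of t 2, simplified, symmetric])
  have cont: "continuous_on {-2..2::real} (\<lambda>t. t ^ n * (1 / (2 * pi) * sqrt (4 - t\<^sup>2)))"
    by (intro continuous_intros)
  have "sc_moment n = (\<integral>t. 1 / (2 * pi) * sqrt (4 - t\<^sup>2) * indicator {-2..2} t * t ^ n \<partial>lborel)"
    unfolding sc_moment_def semicircle_measure_def
    using pos by (subst integral_density) auto
  also have "\<dots> = (\<integral>t. indicator {-2..2} t *\<^sub>R (t ^ n * (1 / (2 * pi) * sqrt (4 - t\<^sup>2))) \<partial>lborel)"
    by (rule Bochner_Integration.integral_cong) auto
  also have "\<dots> = integral {-2..2} (\<lambda>t. t ^ n * (1 / (2 * pi) * sqrt (4 - t\<^sup>2)))"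
    using set_borel_integral_eq_integral(2)[OF borel_integrable_atLeastAtMost'[OF cont]]
    by (simp add: set_lebesgue_integral_def)
  finally show ?thesis .
qed

text \<open>Integration by parts: \<open>t ^ k * ((4 - t\<^sup>2) * w t)\<close> vanishes at both
  ends of the interval, so its derivative has integral 0. The case \<open>k = 0\<close> gives the
  first moment, \<open>k = n + 1\<close> the recursion.\<close>

lemma sc_moment_rec: "(real n + 4) * sc_moment (n + 2) = 4 * (real n + 1) * sc_moment n"
  and sc_moment_1: "sc_moment 1 = 0"
proof -
  define w where "w t = 1 / (2 * pi) * sqrt (4 - t\<^sup>2)" for t :: real
  have int: "(\<lambda>t. t ^ n * w t) integrable_on {-2..2}" for n
    unfolding w_def by (intro integrable_continuous_interval continuous_intros)
  have sc: "sc_moment n = integral {-2..2} (\<lambda>t. t ^ n * w t)" for n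
    by (simp add: sc_moment_eq w_def)
  have deriv: "((\<lambda>t. t ^ k * ((4 - t\<^sup>2) * w t)) has_real_derivative
      (real k * t ^ (k - 1) * ((4 - t\<^sup>2) * w t) - 3 * (t ^ (k + 1) * w t))) (at t)"
    if "t \<in> {-2<..<2}" for t k
  proof -
    have "t\<^sup>2 < 4" using that abs_square_less_1[of "t/2"] by (auto simp: power_divide)
    then have p: "4 - t\<^sup>2 > 0" by simp
    have s: "sqrt (4 - t\<^sup>2) * sqrt (4 - t\<^sup>2) = 4 - t\<^sup>2" using p by simp
    have D: "((\<lambda>t. t ^ k * ((4 - t\<^sup>2) * w t)) has_real_derivative
      (real k * t ^ (k - 1) * ((4 - t\<^sup>2) * w t) + t ^ k * ((- 2 * t) * w t + 
        (4 - t\<^sup>2) * (1 / (2 * pi) * (inverse (sqrt (4 - t\<^sup>2)) / 2 * (- 2 * t)))))) (at t)"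
      unfolding w_def using p
      by (auto intro!: derivative_eq_intros simp: algebra_simps divide_simps)
    have E: "(4 - t\<^sup>2) * (1 / (2 * pi) * (inverse (sqrt (4 - t\<^sup>2)) / 2 * (- 2 * t))) = - t * w t"
      using p s by (simp add: w_def field_simps)
    from D[unfolded E] show ?thesis by (simp add: algebra_simps)
  qed
  have zero: "((\<lambda>t. real k * t ^ (k - 1) * ((4 - t\<^sup>2) * w t) - 3 * (t ^ (k + 1) * w t)) has_integral 0) {-2..2}" for k
  proof -
    have "((\<lambda>t. real k * t ^ (k - 1) * ((4 - t\<^sup>2) * w t) - 3 * (t ^ (k + 1) * w t)) has_integral
      (2 ^ k * ((4 - 2\<^sup>2) * w 2) - (-2) ^ k * ((4 - (-2)\<^sup>2) * w (-2)))) {-2..2}"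
      by (rule fundamental_theorem_of_calculus_interior)
        (use deriv in \<open>auto simp: has_real_derivative_iff_has_vector_derivative w_def intro!: continuous_intros\<close>)
    then show ?thesis by simp
  qed
  show "sc_moment 1 = 0"
    using integral_unique[OF zero[of 0]] by (simp add: sc)
  have I: "((\<lambda>t. (4 * (real n + 1)) * (t ^ n * w t) - (real n + 4) * (t ^ (n + 2) * w t)) has_integral 
     (4 * (real n + 1)) * sc_moment n - (real n + 4) * sc_moment (n + 2)) {-2..2}"
    unfolding sc using int by (intro has_integral_diff has_integral_mult_right integrable_integral)
  have E: "(\<lambda>t. (4 * (real n + 1)) * (t ^ n * w t) - (real n + 4) * (t ^ (n + 2) * w t)) =
     (\<lambda>t. real (n + 1) * t ^ (n + 1 - 1) * ((4 - t\<^sup>2) * w t) - 3 * (t ^ (n + 1 + 1) * w t))"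
    by (auto simp: algebra_simps power2_eq_square)
  from has_integral_unique[OF I[unfolded E] zero[of "n + 1"]]
  show "(real n + 4) * sc_moment (n + 2) = 4 * (real n + 1) * sc_moment n"
    by simp
qed

text \<open>The generating function \<open>C\<close> of the even moments satisfies \<open>C = 1 + X C\<^sup>2\<close>, because
  \<open>G = 1 - 2 X C\<close> solves \<open>(1 - 4 X) G' = - 2 G\<close>, so that \<open>G\<^sup>2\<close> and \<open>1 - 4 X\<close> solve the same equation.\<close>

lemma fps_mult_1_minus_X_nth:
  "(F * (1 - fps_const a * fps_X)) $ n = F $ n - a * (if n = 0 then 0 else F $ (n - 1))"
  for F :: "'a::comm_ring_1 fps"
proof -
  have "F * (1 - fps_const a * fps_X) = F - fps_const a * (fps_X * F)"
    by (simp add: algebra_simps)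
  then show ?thesis by (simp only: fps_sub_nth fps_mult_left_const_nth fps_X_mult_nth)
qed

lemma fps_linear_ode_unique:
  fixes F H :: "real fps"
  assumes "fps_deriv F * (1 - fps_const a * fps_X) = fps_const b * F"
    and "fps_deriv H * (1 - fps_const a * fps_X) = fps_const b * H" and "F $ 0 = H $ 0"
  shows "F = H"
proof -
  define D where "D = F - H"
  have D: "fps_deriv D * (1 - fps_const a * fps_X) = fps_const b * D"
    using assms(1,2) by (simp add: D_def algebra_simps)
  have "D $ n = 0" for n
  proof (induction n)
    case 0
    then show ?case using assms(3) by (simp add: D_def)
  next
    case (Suc n)
    have "real (n + 1) * D $ (n + 1) - a * (real n * D $ n) = b * D $ n"
      using arg_cong[OF D, of "\<lambda>F. F $ n"] unfolding fps_mult_1_minus_X_nth by (cases n) auto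
    then show ?case using Suc by simp
  qed
  then show ?thesis by (simp add: D_def fps_eq_iff)
qed

text \<open>The normalization is a hypothesis because it will come from
  \<open>\<tau> id_blinfun = 1\<close>. Odd moments vanish, so the convolution reduces to that of
  the coefficients of \<open>C\<close>.\<close>

lemma sc_moment_conv:
  assumes "sc_moment 0 = 1"
  shows "sc_moment (Suc n) = (\<Sum>i<n. sc_moment i * sc_moment (n - 1 - i))"
proof -
  define C where "C = Abs_fps (\<lambda>k. sc_moment (2 * k))"
  have odd: "sc_moment (2 * k + 1) = 0" for k
  proof (induction k)
    case (Suc k)
    then show ?case using sc_moment_rec[of "2 * k + 1"] by simp
  qed (use sc_moment_1 in simp)
  have odd': "sc_moment m = 0" if "odd m" for m
    using odd that by (metis oddE)
  have Crec: "(real k + 2) * C $ (k + 1) = (4 * real k + 2) * C $ k" for k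
    using sc_moment_rec[of "2 * k"] by (simp add: C_def algebra_simps)
  define G where "G = 1 - 2 * (fps_X * C)"
  have Gnth: "G $ n = (if n = 0 then 1 else - 2 * C $ (n - 1))" for n
    by (simp add: G_def numeral_fps_const)
  define U where "U = 1 - fps_const 4 * (fps_X :: real fps)"
  have "fps_deriv G * U = fps_const (-2) * G"
  proof (rule fps_ext)
    fix k
    show "(fps_deriv G * U) $ k = (fps_const (-2) * G) $ k"
      unfolding U_def fps_mult_1_minus_X_nth
    proof (cases k)
      case 0
      then show "fps_deriv G $ k - 4 * (if k = 0 then 0 else fps_deriv G $ (k - 1)) = (fps_const (-2) * G) $ k"
        using Crec[of 0] assms by (simp add: Gnth C_def)
    next
      case (Suc j)
      then show "fps_deriv G $ k - 4 * (if k = 0 then 0 else fps_deriv G $ (k - 1)) = (fps_const (-2) * G) $ k"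
        using Crec[of j] by (simp add: Gnth algebra_simps)
    qed
  qed
  then have "fps_deriv (G * G) * U = G * (fps_const (-2) * G) + G * (fps_const (-2) * G)"
    by (simp add: algebra_simps flip: mult.assoc[of G "fps_deriv G" U])
  also have "\<dots> = (fps_const (-2) + fps_const (-2)) * (G * G)"
    by (simp only: distrib_right mult.assoc mult.left_commute[of G])
  finally have "fps_deriv (G * G) * U = fps_const (-4) * (G * G)"
    by simp
  then have "G * G = 1 - fps_const 4 * fps_X"
    unfolding U_def by (rule fps_linear_ode_unique) (auto simp: Gnth fps_mult_nth_0)
  then have "4 * fps_X * (1 + fps_X * (C * C) - C) = 0"
    unfolding G_def fps_const_numeral_eq by (simp add: algebra_simps)
  then have C: "C = 1 + fps_X * (C * C)"
    by simp
  have Cconv: "sc_moment (2 * Suc k) = (\<Sum>i=0..k. sc_moment (2 * i) * sc_moment (2 * (k - i)))" for k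
    using arg_cong[OF C, of "\<lambda>F. F $ Suc k"] by (simp only: fps_add_nth fps_X_mult_nth) (simp add: fps_mult_nth C_def)
  show ?thesis
  proof (cases "even n")
    case True
    then have "(\<Sum>i<n. sc_moment i * sc_moment (n - 1 - i)) = 0"
    proof (intro sum.neutral ballI)
      fix i assume "i \<in> {..<n}"
      with True have "odd i \<or> odd (n - 1 - i)" by simp
      then show "sc_moment i * sc_moment (n - 1 - i) = 0"
        using odd' by (metis mult_eq_0_iff)
    qed
    then show ?thesis using True odd' by simp
  next
    case False
    then obtain k where k: "n = 2 * k + 1" by (auto elim: oddE)
    have "(\<Sum>i<n. sc_moment i * sc_moment (n - 1 - i)) =
        (\<Sum>i\<in>(\<lambda>i. 2 * i) ` {0..k}. sc_moment i * sc_moment (n - 1 - i))"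
    proof (rule sum.mono_neutral_right)
      show "\<forall>i\<in>{..<n} - (\<lambda>i. 2 * i) ` {0..k}. sc_moment i * sc_moment (n - 1 - i) = 0"
      proof
        fix i assume i: "i \<in> {..<n} - (\<lambda>i. 2 * i) ` {0..k}"
        have "odd i"
        proof
          assume "even i"
          then obtain j where "i = 2 * j" by auto
          with i k show False by auto
        qed
        then show "sc_moment i * sc_moment (n - 1 - i) = 0" using odd' by simp
      qed
    qed (use k in auto)
    also have "\<dots> = (\<Sum>i=0..k. sc_moment (2 * i) * sc_moment (2 * (k - i)))"
      by (subst sum.reindex) (auto simp: inj_on_def k right_diff_distrib')
    finally show ?thesis using Cconv[of k] k by simp
  qed
qed

section \<open>Semicircular and circular elements\<close>

lemma free_subalgebras_swap:
  assumes "free_subalgebras \<tau> \<A>"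
  shows "free_subalgebras \<tau> (\<lambda>i::bool. \<A> (\<not> i))"
  unfolding free_subalgebras_def
proof (intro allI impI)
  fix w :: "(bool \<times> 'a oper) list"
  assume w: "w \<noteq> [] \<and> distinct_adj (map fst w) \<and> (\<forall>(i, A)\<in>set w. A \<in> \<A> (\<not> i) \<and> \<tau> A = 0)"
  let ?w = "map (\<lambda>(i, a). (\<not> i, a)) w"
  have "map fst ?w = map Not (map fst w)" by auto
  moreover have "distinct_adj (map Not (map fst w))"
    using w distinct_adj_map_iff[of Not "map fst w"] by (simp add: inj_on_def del: map_map)
  ultimately have "distinct_adj (map fst ?w)" by (simp only:)
  then have "\<tau> (op_prod (map snd ?w)) = 0"
    using assms w unfolding free_subalgebras_def by (intro mp[OF spec[OF assms[unfolded free_subalgebras_def], of ?w]]) auto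
  then show "\<tau> (op_prod (map snd w)) = 0" by (simp add: case_prod_unfold o_def)
qed

text \<open>The words of the expanded power are sorted by their first \<open>B\<close>, preceded by
  \<open>i\<close> factors \<open>A\<close>; what follows it is not expanded.\<close>

lemma op_power_add_expand:
  "op_power (A + B) k = op_power A k + (\<Sum>i<k. op_power A i o\<^sub>L (B o\<^sub>L op_power (A + B) (k - 1 - i)))"
proof (induction k)
  case (Suc k)
  have "op_power (A + B) (Suc k) = (A o\<^sub>L op_power (A + B) k) + (B o\<^sub>L op_power (A + B) k)"
    by (simp add: compose_add)
  also have "(A o\<^sub>L op_power (A + B) k) = op_power A (Suc k) +
      (\<Sum>i<k. op_power A (Suc i) o\<^sub>L (B o\<^sub>L op_power (A + B) (k - 1 - i)))"
    by (subst Suc) (simp add: compose_add compose_sum compose_assoc)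
  finally show ?case
    by (simp add: sum.lessThan_Suc_shift del: sum.lessThan_Suc)
qed simp

context tracial
begin

lemma adj_power: assumes "A \<in> M" shows "adj (op_power A n) = op_power (adj A) n"
proof (induction n)
  case (Suc n)
  have "adj (op_power A (Suc n)) = (adj A o\<^sub>L adj (op_power A n))"
    using assms by (subst op_power_Suc2) (simp add: adj_comp)
  then show ?case by (simp add: Suc)
qed simp

lemma dpair_power:
  assumes "id_blinfun \<in> G" "dpair G y a F"
  shows "dpair G y (op_power a n) (\<lambda>u v. \<Sum>i<n. F (u o\<^sub>L op_power a i) (op_power a (n - 1 - i) o\<^sub>L v))"
proof (induction n)
  case (Suc n)
  from dpair.mult[OF assms(2) Suc] show ?case
    by (simp add: sum.lessThan_Suc_shift compose_assoc del: sum.lessThan_Suc)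
qed (use dpair.const[OF assms(1)] in simp)

text \<open>On powers of \<open>X\<close> the equation is the Catalan convolution of the moments,
  and the powers span all polynomials in \<open>X\<close>.\<close>

lemma SD_semicircular:
  assumes X: "semicircular M \<tau> X"
  shows "SD X X {id_blinfun}" "\<tau> X = 0"
proof -
  have XM: "X \<in> M" and mom: "\<And>n. \<tau> (op_power X n) = complex_of_real (sc_moment n)"
    using X by (auto simp: semicircular_def has_distribution_def sc_moment_def)
  have sc0: "sc_moment 0 = 1" using mom[of 0] by simp
  show "\<tau> X = 0" using mom[of 1] sc_moment_1 by simp
  define S where "S = range (\<lambda>k. (op_power X k, 
      \<lambda>u v. \<Sum>i<k. \<tau> (u o\<^sub>L op_power X i) * \<tau> (op_power X (k - 1 - i) o\<^sub>L v)))"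
  show "SD X X {id_blinfun}"
  proof (rule SD_lin[where S = S])
    show "left_linear S"
      using XM by (auto simp: left_linear_def S_def compose_add tau_add scaleC_op_compose_left 
          tau_scaleC algebra_simps sum.distrib sum_distrib_left)
    show "lin S id_blinfun (\<lambda>u v. 0)"
      by (rule lin_base1) (auto simp: S_def image_iff intro!: exI[of _ 0])
    show "lin S (g o\<^sub>L a) (\<lambda>u v. F (u o\<^sub>L g) v)" if "g \<in> {id_blinfun}" "(a, F) \<in> S" for g a F
      using that by (simp add: lin_base1)
    show "lin S (X o\<^sub>L a) (\<lambda>u v. \<tau> u * \<tau> (a o\<^sub>L v) + F (u o\<^sub>L X) v)" if "(a, F) \<in> S" for a F
    proof (rule lin_base1)
      from that obtain k where k: "a = op_power X k" 
        "F = (\<lambda>u v. \<Sum>i<k. \<tau> (u o\<^sub>L op_power X i) * \<tau> (op_power X (k - 1 - i) o\<^sub>L v))"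
        by (auto simp: S_def)
      show "(X o\<^sub>L a, \<lambda>u v. \<tau> u * \<tau> (a o\<^sub>L v) + F (u o\<^sub>L X) v) \<in> S"
        unfolding S_def k
        by (rule image_eqI[of _ _ "Suc k"]) (simp_all add: sum.lessThan_Suc_shift compose_assoc del: sum.lessThan_Suc)
    qed
    show "\<tau> (X o\<^sub>L a) = F id_blinfun id_blinfun" if "(a, F) \<in> S" for a F
    proof -
      from that obtain k where k: "a = op_power X k" 
        "F = (\<lambda>u v. \<Sum>i<k. \<tau> (u o\<^sub>L op_power X i) * \<tau> (op_power X (k - 1 - i) o\<^sub>L v))"
        by (auto simp: S_def)
      have "\<tau> (X o\<^sub>L a) = complex_of_real (sc_moment (Suc k))"
        using mom[of "Suc k"] by (simp add: k)
      then show ?thesis by (simp add: k mom sc_moment_conv[OF sc0])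
    qed
  qed (use XM in auto)
qed

text \<open>With \<open>r = 1 / sqrt 2\<close>, the equations of \<open>X1\<close> and
  \<open>X2\<close>, each taken over the algebra of the other, are added with weights
  \<open>r\<close> and \<open>\<i> r\<close>. The combined derivation kills \<open>Y\<close>, as
  \<open>1 + \<i>\<^sup>2 = 0\<close>, and sends \<open>adj Y\<close> to
  \<open>2 r\<^sup>2 = 1\<close>.\<close>

lemma SD_circular:
  assumes Y: "circular M \<tau> Y"
  shows "SD Y (adj Y) {id_blinfun, Y}" "\<tau> Y = 0"
proof -
  obtain X1 X2 where X: "semicircular M \<tau> X1" "semicircular M \<tau> X2" and free: "star_free \<tau> X1 X2"
    and Yeq: "Y = (1 / sqrt 2) *\<^sub>R (X1 + scaleC_op \<i> X2)"
    using Y unfolding circular_def by blast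
  have XM: "X1 \<in> M" "X2 \<in> M" and adjX: "adj X1 = X1" "adj X2 = X2"
    using X by (auto simp: semicircular_def selfadj_def adj_eqI)
  define r where "r = complex_of_real (1 / sqrt 2)"
  have rr: "r * r = 1 / 2"
    by (simp add: r_def flip: of_real_mult)
  have Yeq': "Y = scaleC_op r (X1 + scaleC_op \<i> X2)"
    unfolding Yeq r_def scaleC_op_of_real ..
  have adjY: "adj Y = scaleC_op r (X1 + scaleC_op (- \<i>) X2)"
    using XM by (simp add: Yeq' adj_scaleC adj_add adjX) (simp add: r_def)
  define H where "H X = star_subalgebra hull {X}" for X :: "'h oper"
  have sub: "subalg (H X)" "X \<in> H X" if "X \<in> M" for X
    using subalg_hull[of "{X}"] that by (auto simp: H_def hull_inc)
  interpret p2: free_pair M \<tau> "\<lambda>i. H (if i then X2 else X1)" X2 X2 "{id_blinfun}"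
    using sub XM SD_semicircular[OF X(2)] free subalgD(2)[OF sub(1)[OF XM(2)]]
    by unfold_locales (auto simp: star_free_def H_def)
  interpret p1: free_pair M \<tau> "\<lambda>i. H (if \<not> i then X2 else X1)" X1 X1 "{id_blinfun}"
    using sub XM SD_semicircular[OF X(1)] free_subalgebras_swap[OF free[unfolded star_free_def]] 
      subalgD(2)[OF sub(1)[OF XM(1)]]
    by unfold_locales (auto simp: H_def)
  define G1 where "G1 = {id_blinfun} \<union> H X2"
  define G2 where "G2 = {id_blinfun} \<union> H X1"
  have sd: "SD X1 X1 G1" "SD X2 X2 G2"
    using p1.SD_join p2.SD_join by (auto simp: G1_def G2_def)
  have X1d: "dpair G1 X1 (scaleC_op r (X1 + scaleC_op c X2)) (\<lambda>u v. r * (\<tau> u * \<tau> v + c * 0))"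
    and X2d: "dpair G2 X2 (scaleC_op r (X1 + scaleC_op c X2)) (\<lambda>u v. r * (0 + c * (\<tau> u * \<tau> v)))" for c
    using sub XM by (intro dpair.scale dpair.add dpair.mark dpair.const; simp add: G1_def G2_def)+
  have split: "\<exists>F1 F2. dpair G1 X1 a F1 \<and> dpair G2 X2 a F2 \<and> F = (\<lambda>u v. r * (F1 u v + \<i> * F2 u v))"
    if "dpair {id_blinfun, Y} (adj Y) a F" for a F
    using that
  proof induction
    case (const b)
    show ?case
    proof (cases "b = Y")
      case True
      show ?thesis
        by (rule exI, rule exI, intro conjI, unfold True Yeq', rule X1d, rule X2d)
          (simp add: algebra_simps)
    next
      case False
      then have "b = id_blinfun" using const by simp
      then show ?thesis
        by (intro exI[of _ "\<lambda>u v. 0"] conjI dpair.const) (auto simp: G1_def G2_def)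
    qed
  next
    case mark
    have c: "(\<lambda>u v. \<tau> u * \<tau> v) =
      (\<lambda>u v. r * (r * (\<tau> u * \<tau> v + (- \<i>) * 0) + \<i> * (r * (0 + (- \<i>) * (\<tau> u * \<tau> v)))))"
    proof (intro ext)
      fix u v
      have "r * (r * (\<tau> u * \<tau> v + (- \<i>) * 0) + \<i> * (r * (0 + (- \<i>) * (\<tau> u * \<tau> v)))) = (r * r) * 2 * (\<tau> u * \<tau> v)"
        by (simp add: algebra_simps)
      then show "\<tau> u * \<tau> v = r * (r * (\<tau> u * \<tau> v + (- \<i>) * 0) + \<i> * (r * (0 + (- \<i>) * (\<tau> u * \<tau> v))))"
        by (simp only: rr) simp
    qed
    show ?case
      by (rule exI, rule exI, intro conjI, unfold adjY, rule X1d, rule X2d, rule c)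
  next
    case (add a F b K)
    then obtain F1 F2 K1 K2 where *: "dpair G1 X1 a F1" "dpair G2 X2 a F2" "F = (\<lambda>u v. r * (F1 u v + \<i> * F2 u v))"
      "dpair G1 X1 b K1" "dpair G2 X2 b K2" "K = (\<lambda>u v. r * (K1 u v + \<i> * K2 u v))" by blast
    show ?case
      by (rule exI, rule exI, intro conjI, rule dpair.add[OF *(1,4)], rule dpair.add[OF *(2,5)])
        (simp add: * algebra_simps)
  next
    case (mult a F b K)
    then obtain F1 F2 K1 K2 where *: "dpair G1 X1 a F1" "dpair G2 X2 a F2" "F = (\<lambda>u v. r * (F1 u v + \<i> * F2 u v))"
      "dpair G1 X1 b K1" "dpair G2 X2 b K2" "K = (\<lambda>u v. r * (K1 u v + \<i> * K2 u v))" by blast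
    show ?case
      by (rule exI, rule exI, intro conjI, rule dpair.mult[OF *(1,4)], rule dpair.mult[OF *(2,5)])
        (simp add: * algebra_simps)
  next
    case (scale a F c)
    then obtain F1 F2 where *: "dpair G1 X1 a F1" "dpair G2 X2 a F2" "F = (\<lambda>u v. r * (F1 u v + \<i> * F2 u v))" by blast
    show ?case
      by (rule exI, rule exI, intro conjI, rule dpair.scale[OF *(1)], rule dpair.scale[OF *(2)])
        (simp add: * algebra_simps)
  qed
  have YM: "Y \<in> M" using XM by (simp add: Yeq)
  show "\<tau> Y = 0"
    using XM SD_semicircular(2) X by (simp add: Yeq tau_scaleR tau_add tau_scaleC)
  show "SD Y (adj Y) {id_blinfun, Y}"
    unfolding SD_def
  proof (intro allI impI)
    fix a F assume d: "dpair {id_blinfun, Y} (adj Y) a F"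
    obtain F1 F2 where F: "dpair G1 X1 a F1" "dpair G2 X2 a F2" "F = (\<lambda>u v. r * (F1 u v + \<i> * F2 u v))"
      using split[OF d] by blast
    have aM: "a \<in> M" using dpair_M[OF _ _ d] YM by simp
    have "\<tau> (Y o\<^sub>L a) = r * (\<tau> (X1 o\<^sub>L a) + \<i> * \<tau> (X2 o\<^sub>L a))"
      using aM XM by (simp add: Yeq' scaleC_op_compose_left compose_add tau_scaleC tau_add)
    then show "\<tau> (Y o\<^sub>L a) = F id_blinfun id_blinfun"
      using sd F by (simp add: SD_def)
  qed
qed

text \<open>Split \<open>op_power Z k\<close> at its first \<open>Y\<close>. This \<open>Y\<close>
  can be paired only with an \<open>adj Y\<close> inside \<open>op_power (adj Z) l\<close>, and the
  pairing cuts the cyclic word in two: one trace keeps the remaining factors \<open>Z\<close> and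
  \<open>j\<close> factors \<open>adj Z\<close>, the other has \<open>i\<close> factors
  \<open>T\<close> and \<open>l - 1 - j\<close> factors \<open>adj Z\<close>.\<close>

lemma free_circular_moments:
  fixes s :: real and w v :: "nat \<Rightarrow> nat \<Rightarrow> complex"
  assumes T: "T \<in> M" and Y: "Y \<in> M" "circular M \<tau> Y" and free: "star_free \<tau> T Y"
  defines "Z \<equiv> T + s *\<^sub>R Y"
  defines "w \<equiv> \<lambda>k l. \<tau> (op_power Z k o\<^sub>L op_power (adj Z) l)"
    and "v \<equiv> \<lambda>k l. \<tau> (op_power T k o\<^sub>L op_power (adj T) l)"
  shows "w k l = v k l + complex_of_real s ^ 2 * (\<Sum>i<k. \<Sum>j<l. w (k - 1 - i) j * v i (l - 1 - j))"
proof -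
  define H where "H X = star_subalgebra hull {X}" for X :: "'h oper"
  have sub: "subalg (H X)" "X \<in> H X" "adj X \<in> H X" if "X \<in> M" for X
  proof -
    show "subalg (H X)" "X \<in> H X"
      using subalg_hull[of "{X}"] that by (auto simp: H_def hull_inc)
    show "adj X \<in> H X"
      using star_subalgebra_hull(1)[OF star_M, of "{X}"] \<open>X \<in> H X\<close> that adj_eqI 
      unfolding star_subalgebra_def H_def by blast
  qed
  interpret p: free_pair M \<tau> "\<lambda>i. H (if i then Y else T)" Y "adj Y" "{id_blinfun, Y}"
    using sub T Y SD_circular[OF Y(2)] free subalgD(2)[OF sub(1)[OF Y(1)]]
    by unfold_locales (auto simp: star_free_def H_def)
  define G where "G = {id_blinfun, Y} \<union> H T"
  have sd: "SD Y (adj Y) G" using p.SD_join by (simp add: G_def)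
  have idG: "id_blinfun \<in> G" and GM: "G \<subseteq> M"
    using sub(1)[OF T] Y subalgD(1) by (auto simp: G_def)
  have ZM: "Z \<in> M" using T Y by (simp add: Z_def)
  have adjZ: "adj Z = adj T + scaleC_op s (adj Y)"
    using T Y by (simp add: Z_def adj_add adj_scaleR scaleC_op_of_real)
  have dT: "dpair G (adj Y) T (\<lambda>u v. 0)" "dpair G (adj Y) (adj T) (\<lambda>u v. 0)"
    using sub T by (auto intro!: dpair.const simp: G_def)
  have "dpair G (adj Y) (T + scaleC_op s Y) (\<lambda>u v. 0 + complex_of_real s * 0)"
    by (intro dpair.add dpair.scale dpair.const dT) (simp add: G_def)
  then have dZ: "dpair G (adj Y) Z (\<lambda>u v. 0)"
    by (simp add: Z_def scaleC_op_of_real)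
  have "dpair G (adj Y) (adj T + scaleC_op s (adj Y)) (\<lambda>u v. 0 + complex_of_real s * (\<tau> u * \<tau> v))"
    by (intro dpair.add dpair.scale dpair.mark dT)
  then have dZs: "dpair G (adj Y) (adj Z) (\<lambda>u v. s * (\<tau> u * \<tau> v))"
    by (simp add: adjZ)
  note dpow = dpair_power[OF idG]
  have sdY: "\<tau> (Y o\<^sub>L (op_power Z m o\<^sub>L (op_power (adj Z) l o\<^sub>L op_power T i))) =
      s * (\<Sum>j<l. w m j * \<tau> (op_power (adj Z) (l - 1 - j) o\<^sub>L op_power T i))" for m l i
    using sd[unfolded SD_def, rule_format, OF dpair.mult[OF dpow[OF dZ, of m] dpair.mult[OF dpow[OF dZs, of l] dpow[OF dT(1), of i]]]]
    by (simp add: w_def sum_distrib_left)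
  have sdY0: "\<tau> (Y o\<^sub>L (op_power T j o\<^sub>L (op_power (adj T) i o\<^sub>L op_power Z m))) = 0" for j i m
    using sd[unfolded SD_def, rule_format, OF dpair.mult[OF dpow[OF dT(1), of j] dpair.mult[OF dpow[OF dT(2), of i] dpow[OF dZ, of m]]]]
    by simp
  \<comment> \<open>No \<open>Y\<close> is left to be paired with an \<open>adj Y\<close> of
    \<open>adj Z\<close>; the adjoints of these words are covered by \<open>sdY0\<close>.\<close>
  have x: "\<tau> (op_power T i o\<^sub>L op_power (adj Z) l) = v i l" for i l
  proof -
    have "op_power (adj Z) l = op_power (adj T) l + (\<Sum>j<l. op_power (adj T) j o\<^sub>L
        (scaleC_op s (adj Y) o\<^sub>L op_power (adj Z) (l - 1 - j)))"
      unfolding adjZ by (rule op_power_add_expand)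
    then have "\<tau> (op_power T i o\<^sub>L op_power (adj Z) l) = v i l + (\<Sum>j<l. \<tau> (op_power T i o\<^sub>L (op_power (adj T) j o\<^sub>L
        (scaleC_op s (adj Y) o\<^sub>L op_power (adj Z) (l - 1 - j)))))"
      using T Y ZM by (simp add: compose_add compose_sum tau_add tau_sum M_sum v_def)
    moreover have "\<tau> (op_power T i o\<^sub>L (op_power (adj T) j o\<^sub>L
        (scaleC_op s (adj Y) o\<^sub>L op_power (adj Z) m))) = 0" for j m
    proof -
      have "adj (op_power T i o\<^sub>L (op_power (adj T) j o\<^sub>L (adj Y o\<^sub>L op_power (adj Z) m))) =
        (op_power Z m o\<^sub>L (Y o\<^sub>L (op_power T j o\<^sub>L op_power (adj T) i)))"
        using T Y ZM by (simp add: adj_comp adj_power compose_assoc)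
      moreover have "\<tau> (op_power Z m o\<^sub>L (Y o\<^sub>L (op_power T j o\<^sub>L op_power (adj T) i))) = 0"
        using sdY0[of j i m] T Y ZM by (subst tau_comm) (simp_all add: compose_assoc)
      ultimately have "\<tau> (op_power T i o\<^sub>L (op_power (adj T) j o\<^sub>L (adj Y o\<^sub>L op_power (adj Z) m))) = 0"
        using tau_adj[of "op_power T i o\<^sub>L (op_power (adj T) j o\<^sub>L (adj Y o\<^sub>L op_power (adj Z) m))"] T Y ZM by simp
      then show ?thesis
        using T Y ZM by (simp add: scaleC_op_compose_left scaleC_op_compose_right M_clinear tau_scaleC)
    qed
    ultimately show ?thesis by simp
  qed
  have Zk: "op_power Z k = op_power T k + (\<Sum>i<k. op_power T i o\<^sub>L
        (scaleC_op s Y o\<^sub>L op_power Z (k - 1 - i)))"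
    unfolding Z_def scaleC_op_of_real by (rule op_power_add_expand)
  have "w k l = v k l + (\<Sum>i<k. \<tau> ((op_power T i o\<^sub>L (scaleC_op s Y o\<^sub>L op_power Z (k - 1 - i))) o\<^sub>L op_power (adj Z) l))"
    unfolding w_def x[symmetric] 
    by (subst Zk) (use T Y ZM in \<open>simp add: compose_add compose_sum tau_add tau_sum M_sum\<close>)
  moreover have "\<tau> ((op_power T i o\<^sub>L (scaleC_op s Y o\<^sub>L op_power Z m)) o\<^sub>L op_power (adj Z) l) =
     complex_of_real s ^ 2 * (\<Sum>j<l. w m j * v i (l - 1 - j))" for i m
  proof -
    have "\<tau> ((op_power T i o\<^sub>L (scaleC_op s Y o\<^sub>L op_power Z m)) o\<^sub>L op_power (adj Z) l) =
      s * \<tau> (Y o\<^sub>L (op_power Z m o\<^sub>L (op_power (adj Z) l o\<^sub>L op_power T i)))"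
      using T Y ZM tau_comm[of "op_power T i" "Y o\<^sub>L (op_power Z m o\<^sub>L op_power (adj Z) l)"]
      by (simp add: compose_assoc scaleC_op_compose_left scaleC_op_compose_right M_clinear tau_scaleC)
    also have "\<dots> = s * (s * (\<Sum>j<l. w m j * \<tau> (op_power T i o\<^sub>L op_power (adj Z) (l - 1 - j))))"
      unfolding sdY using T ZM by (simp add: tau_comm[of "op_power (adj Z) _"])
    finally show ?thesis by (simp add: x power2_eq_square)
  qed
  ultimately show ?thesis
    by (simp add: sum_distrib_left)
qed

end

section \<open>Bounded functional calculus\<close>

text \<open>Polarization and the parallelogram law bound \<open>cinner (A x) y\<close> by
  \<open>C * ((norm x)\<^sup>2 + (norm y)\<^sup>2)\<close>; a vector \<open>y\<close> in the
  direction of \<open>A x\<close> with the length of \<open>x\<close> gives the factor 2.\<close>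

lemma norm_le_quadratic_form:
  assumes A: "A \<in> clinear_ops" and C0: "0 \<le> C" and C: "\<And>x. cmod (cinner (blinfun_apply A x) x) \<le> C * (norm x)\<^sup>2"
  shows "norm A \<le> 2 * C"
proof -
  define q where "q z = cinner (A z) z" for z
  have pol: "4 * cinner (A x) y = q (x + y) - q (x - y) + \<i> * q (x + scaleC \<i> y) - \<i> * q (x - scaleC \<i> y)" for x y
    by (simp add: q_def comp_simps cinner_add_left cinner_add_right cinner_diff_left cinner_diff_right
        clinear_opsD[OF A] cinner_scaleC_left cinner_scaleC_right algebra_simps)
  have par: "(norm (x + y))\<^sup>2 + (norm (x - y))\<^sup>2 = 2 * ((norm x)\<^sup>2 + (norm y)\<^sup>2)" for x y :: 'a
    by (simp add: power2_norm_eq_inner inner_add_left inner_add_right inner_diff_left inner_diff_right)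
  have tri: "cmod (a - b + \<i> * c - \<i> * d) \<le> cmod a + cmod b + cmod c + cmod d" for a b c d
    using norm_triangle_ineq4[of "a - b + \<i> * c" "\<i> * d"] norm_triangle_ineq[of "a - b" "\<i> * c"]
      norm_triangle_ineq4[of a b] by (simp add: norm_mult)
  have bound: "cmod (cinner (A x) y) \<le> C * ((norm x)\<^sup>2 + (norm y)\<^sup>2)" for x y
  proof -
    have "4 * cmod (cinner (A x) y) = cmod (4 * cinner (A x) y)"
      by (simp add: norm_mult)
    also have "\<dots> \<le> cmod (q (x + y)) + cmod (q (x - y)) + cmod (q (x + scaleC \<i> y)) + cmod (q (x - scaleC \<i> y))"
      unfolding pol by (rule tri)
    also have "\<dots> \<le> C * (norm (x + y))\<^sup>2 + C * (norm (x - y))\<^sup>2 + C * (norm (x + scaleC \<i> y))\<^sup>2 + C * (norm (x - scaleC \<i> y))\<^sup>2"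
      using C unfolding q_def by (intro add_mono) auto
    also have "\<dots> = C * ((norm (x + y))\<^sup>2 + (norm (x - y))\<^sup>2) + C * ((norm (x + scaleC \<i> y))\<^sup>2 + (norm (x - scaleC \<i> y))\<^sup>2)"
      by (simp add: algebra_simps)
    also have "\<dots> = 4 * (C * ((norm x)\<^sup>2 + (norm y)\<^sup>2))"
      unfolding par by (simp add: norm_scaleC algebra_simps)
    finally show ?thesis by simp
  qed
  have "norm (A x) \<le> 2 * C * norm x" for x
  proof (cases "x = 0 \<or> A x = 0")
    case True
    then show ?thesis using C0 by auto
  next
    case False
    define y where "y = (norm x / norm (A x)) *\<^sub>R A x"
    have ny: "norm y = norm x" using False by (simp add: y_def)
    have "cinner (A x) y = of_real (norm x * norm (A x))"
      using False by (simp add: y_def cinner_scaleR_right cinner_self power2_eq_square)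
    then have "cmod (cinner (A x) y) = norm x * norm (A x)"
      by (simp add: norm_mult)
    then have "norm x * norm (A x) \<le> C * ((norm x)\<^sup>2 + (norm x)\<^sup>2)"
      using bound[of x y] ny by simp
    then have "norm x * norm (A x) \<le> norm x * (2 * C * norm x)"
      by (simp add: power2_eq_square algebra_simps)
    then show ?thesis using False by (simp add: mult_le_cancel_left_pos)
  qed
  then show ?thesis using C0 by (intro norm_blinfun_bound) auto
qed

locale spectral = tracial +
  fixes E :: "real set \<Rightarrow> 'a oper"
  assumes pvm: "projection_valued_measure M E"
begin

lemma E_M [simp, intro]: "S \<in> sets borel \<Longrightarrow> E S \<in> M"
  and E_selfadj: "S \<in> sets borel \<Longrightarrow> is_adjoint (E S) (E S)"
  and E_UNIV [simp]: "E UNIV = id_blinfun"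
  and E_Int: "S \<in> sets borel \<Longrightarrow> S' \<in> sets borel \<Longrightarrow> (E S o\<^sub>L E S') = E (S \<inter> S')"
  and E_sums: "range F \<subseteq> sets borel \<Longrightarrow> disjoint_family F \<Longrightarrow> (\<lambda>n::nat. E (F n) x) sums E (\<Union>n. F n) x"
  using pvm by (auto simp: projection_valued_measure_def selfadj_def)

lemma E_empty [simp]: "E {} = 0"
proof (rule blinfun_eqI)
  fix x
  have "(\<lambda>n::nat. E {} x) sums E {} x"
    using E_sums[of "\<lambda>_. {}" x] by (simp add: disjoint_family_on_def)
  then show "E {} x = blinfun_apply 0 x"
    using summable_LIMSEQ_zero[OF sums_summable, of "\<lambda>n::nat. E {} x"] by (simp add: LIMSEQ_const_iff)
qed

lemma E_Un:
  assumes "S \<in> sets borel" "S' \<in> sets borel" "S \<inter> S' = {}"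
  shows "E (S \<union> S') = E S + E S'"
proof (rule blinfun_eqI)
  fix x
  have "(\<lambda>n. E (binaryset S S' n) x) sums E (\<Union>n. binaryset S S' n) x"
    using assms by (intro E_sums) (auto simp: binaryset_def disjoint_family_on_def)
  moreover have "(\<lambda>n. E (binaryset S S' n) x) sums (\<Sum>n\<in>{0,1}. E (binaryset S S' n) x)"
    by (rule sums_finite) (auto simp: binaryset_def)
  ultimately show "E (S \<union> S') x = (E S + E S') x"
    using sums_unique2 by (fastforce simp: UN_binaryset_eq binaryset_def comp_simps)
qed

lemma E_cinner: "S \<in> sets borel \<Longrightarrow> cinner (E S x) x = of_real ((norm (E S x))\<^sup>2)"
proof -
  assume S: "S \<in> sets borel"
  have "cinner (E S x) x = cinner (E S (E S x)) x"
    using E_Int[OF S S] by (metis Int_absorb blinfun_apply_blinfun_compose)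
  also have "\<dots> = cinner (E S x) (E S x)"
    using E_selfadj[OF S] by (simp add: is_adjoint_def)
  finally show ?thesis by (simp add: cinner_self)
qed

abbreviation N :: "'a \<Rightarrow> real measure" where "N \<equiv> vector_measure E"

lemma sets_N [simp, measurable_cong]: "sets (N x) = sets borel"
  and space_N [simp]: "space (N x) = UNIV"
  by (simp_all add: vector_measure_def sets.sigma_sets_eq[of borel, simplified])

lemma emeasure_N: 
  assumes "S \<in> sets borel" shows "emeasure (N x) S = ennreal ((norm (E S x))\<^sup>2)"
proof -
  let ?q = "\<lambda>S. ennreal (Re (cinner (E S x) x))"
  have "countably_additive (sets borel) ?q"
  proof (rule countably_additiveI)
    fix F :: "nat \<Rightarrow> real set"
    assume F: "range F \<subseteq> sets borel" "disjoint_family F"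
    have "bounded_linear (\<lambda>y. Re (cinner y x))"
      by (simp add: inner_eq_Re_cinner[symmetric] bounded_linear_inner_left)
    from bounded_linear.sums[OF this E_sums[OF F]]
    have "(\<lambda>n. Re (cinner (E (F n) x) x)) sums Re (cinner (E (\<Union>n. F n) x) x)" .
    moreover have "0 \<le> Re (cinner (E (F n) x) x)" for n
      using F by (subst E_cinner) auto
    ultimately show "(\<Sum>i. ?q (F i)) = ?q (\<Union>i. F i)"
      by (intro suminf_ennreal_eq)
  qed
  then have "emeasure (N x) S = ?q S"
    using assms unfolding vector_measure_def
    by (intro emeasure_measure_of_sigma) (auto simp: positive_def sets.sigma_algebra_axioms[of borel, simplified])
  then show ?thesis using assms by (simp add: E_cinner)
qed

lemma finite_measure_N: "finite_measure (N x)"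
  by (rule finite_measureI) (simp add: emeasure_N)

lemma measure_N: "S \<in> sets borel \<Longrightarrow> measure (N x) S = (norm (E S x))\<^sup>2"
  by (simp add: measure_def emeasure_N)

text \<open>The functional calculus on functions that are bounded everywhere: a class closed under
  products, on which the supremum of the function controls the norm of the operator.\<close>

definition calc :: "(real \<Rightarrow> complex) \<Rightarrow> 'a oper \<Rightarrow> bool" where
  "calc f A \<longleftrightarrow> f \<in> borel_measurable borel \<and> bounded (range f) \<and> A \<in> M \<and>
     (\<forall>x. cinner (A x) x = (\<integral>t. f t \<partial>N x))"

lemma calcD: assumes "calc f A"
  shows "f \<in> borel_measurable borel" "bounded (range f)" "A \<in> M" "cinner (A x) x = (\<integral>t. f t \<partial>N x)"
  using assms by (auto simp: calc_def)

lemma integrable_bounded_N: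
  fixes f :: "real \<Rightarrow> complex"
  assumes "f \<in> borel_measurable borel" "bounded (range f)" 
  shows "integrable (N x) f"
proof -
  interpret finite_measure "N x" by (rule finite_measure_N)
  obtain B where "\<And>t. norm (f t) \<le> B" using assms(2) by (auto simp: bounded_iff)
  then show ?thesis
    using assms(1) by (intro integrable_const_bound[of _ B]) auto
qed

lemma calc_integrable: "calc f A \<Longrightarrow> integrable (N x) f"
  by (rule integrable_bounded_N) (auto simp: calc_def)

lemma calc_add:
  assumes f: "calc f A" and g: "calc g B"
  shows "calc (\<lambda>t. f t + g t) (A + B)"
  unfolding calc_def
proof (intro conjI allI)
  show "bounded (range (\<lambda>t. f t + g t))"
    using calcD(2)[OF f] calcD(2)[OF g] by (rule bounded_plus_comp)
  show "cinner ((A + B) x) x = (\<integral>t. f t + g t \<partial>N x)" for x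
    using calc_integrable[OF f] calc_integrable[OF g] calcD(4)[OF f] calcD(4)[OF g]
    by (simp add: comp_simps cinner_add_left)
qed (use calcD[OF f] calcD[OF g] in auto)

lemma calc_scale: "calc f A \<Longrightarrow> calc (\<lambda>t. c * f t) (scaleC_op c A)"
  using bounded_linear_image[OF _ bounded_linear_mult_right, of "range f" c]
  by (auto simp: calc_def scaleC_op_apply cinner_scaleC_left image_image)

lemma calc_zero: "calc (\<lambda>_. 0) 0"
  by (auto simp: calc_def)

lemma calc_sum: "(\<And>i. i \<in> I \<Longrightarrow> calc (f i) (A i)) \<Longrightarrow> calc (\<lambda>t. \<Sum>i\<in>I. f i t) (\<Sum>i\<in>I. A i)"
  by (induction I rule: infinite_finite_induct) (auto simp: calc_zero calc_add)

lemma calc_diff: "calc f A \<Longrightarrow> calc g B \<Longrightarrow> calc (\<lambda>t. f t - g t) (A - B)"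
  using calc_add[OF _ calc_scale[of g B "-1"], of f A] by simp

lemma calc_indicator:
  assumes "S \<in> sets borel"
  shows "calc (indicator S) (E S)"
proof -
  have "(\<integral>t. indicator S t \<partial>N x) = complex_of_real (measure (N x) S)" for x
  proof -
    have "(\<lambda>t. indicator S t :: complex) = (\<lambda>t. complex_of_real (indicator S t))"
      by (auto simp: indicator_def)
    then show ?thesis by (simp only: integral_complex_of_real) simp
  qed
  then show ?thesis
    using assms by (auto simp: calc_def E_cinner measure_N bounded_iff indicator_def intro!: exI[of _ 1])
qed

lemma calc_id: "calc (\<lambda>_. 1) id_blinfun"
  using calc_indicator[of UNIV] by (simp add: indicator_def[abs_def])

lemma calc_adj: assumes "calc f A" shows "calc (\<lambda>t. cnj (f t)) (adj A)"
proof -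
  have "cinner (adj A x) x = cnj (\<integral>t. f t \<partial>N x)" for x
    using calcD[OF assms] by (metis cinner_adj cinner_commute)
  moreover have "(\<lambda>t. cnj (f t)) \<in> borel_measurable borel"
    using measurable_compose[OF calcD(1)[OF assms] borel_measurable_continuous_onI[of cnj]]
    by (simp add: continuous_on_cnj)
  ultimately show ?thesis
    using calcD[OF assms] by (auto simp: calc_def bounded_iff)
qed

lemma calc_norm:
  assumes "calc f A" "\<And>t. cmod (f t) \<le> C"
  shows "norm A \<le> 2 * C"
proof (rule norm_le_quadratic_form)
  show "A \<in> clinear_ops" using calcD[OF assms(1)] M_clinear by simp
  show "0 \<le> C" using assms(2) norm_ge_zero order_trans by blast
  fix x
  interpret finite_measure "N x" by (rule finite_measure_N)
  have "cmod (\<integral>t. f t \<partial>N x) \<le> (\<integral>t. C \<partial>N x)"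
    using calc_integrable[OF assms(1)] assms(2)
    by (intro integral_norm_bound[THEN order_trans] integral_mono) auto
  then show "cmod (cinner (A x) x) \<le> C * (norm x)\<^sup>2"
    using calcD(4)[OF assms(1)] measure_N[of UNIV x] by (simp add: mult.commute)
qed

lemma calc_simple:
  assumes f: "f \<in> borel_measurable borel" "finite (range f)"
  shows "calc f (\<Sum>c\<in>range f. scaleC_op c (E (f -` {c})))"
    "f = (\<lambda>t. \<Sum>c\<in>range f. c * indicator (f -` {c}) t)"
proof -
  show *: "f = (\<lambda>t. \<Sum>c\<in>range f. c * indicator (f -` {c}) t)"
  proof
    fix t
    have "(\<Sum>c\<in>range f. c * indicator (f -` {c}) t) = (\<Sum>c\<in>range f. if c = f t then c else 0)"
      by (rule sum.cong) (auto simp: indicator_def)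
    then show "f t = (\<Sum>c\<in>range f. c * indicator (f -` {c}) t)"
      using f(2) by simp
  qed
  have "f -` {c} \<in> sets borel" for c
    using measurable_sets[OF f(1), of "{c}"] by simp
  then have "calc (\<lambda>t. \<Sum>c\<in>range f. c * indicator (f -` {c}) t) (\<Sum>c\<in>range f. scaleC_op c (E (f -` {c})))"
    by (intro calc_sum calc_scale calc_indicator)
  then show "calc f (\<Sum>c\<in>range f. scaleC_op c (E (f -` {c})))"
    by (simp only: *[symmetric])
qed

end

text \<open>Real and imaginary part are rounded down to multiples of \<open>1 / Suc n\<close>;
  boundedness leaves finitely many values.\<close>

lemma complex_simple_approx:
  fixes f :: "real \<Rightarrow> complex"
  assumes f: "f \<in> borel_measurable borel" "bounded (range f)"
  obtains g where "\<And>n. g n \<in> borel_measurable borel" "\<And>n. finite (range (g n))"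
    "\<And>n t. cmod (g n t - f t) \<le> 2 / Suc n"
proof
  define r where "r n y = of_int \<lfloor>Suc n * y\<rfloor> / real (Suc n)" for n and y :: real
  define g where "g n t = Complex (r n (Re (f t))) (r n (Im (f t)))" for n t
  have r: "\<bar>r n y - y\<bar> \<le> 1 / Suc n" for n y
  proof -
    have "\<bar>of_int \<lfloor>Suc n * y\<rfloor> - Suc n * y\<bar> \<le> 1" by linarith
    then have "\<bar>of_int \<lfloor>Suc n * y\<rfloor> - Suc n * y\<bar> / Suc n \<le> 1 / Suc n"
      by (intro divide_right_mono) auto
    also have "\<bar>of_int \<lfloor>Suc n * y\<rfloor> - Suc n * y\<bar> / Suc n = \<bar>r n y - y\<bar>"
    proof -
      have "r n y - y = (of_int \<lfloor>Suc n * y\<rfloor> - Suc n * y) / Suc n"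
        by (simp add: r_def diff_divide_distrib del: of_nat_Suc)
      then show ?thesis by (simp add: abs_divide del: of_nat_Suc)
    qed
    finally show ?thesis .
  qed
  show "cmod (g n t - f t) \<le> 2 / Suc n" for n t
    using cmod_le[of "g n t - f t"] r[of n "Re (f t)"] r[of n "Im (f t)"] 
    by (simp add: g_def del: of_nat_Suc)
  have gr: "g n t = of_real (r n (Re (f t))) + \<i> * of_real (r n (Im (f t)))" for n t
    by (simp add: g_def Complex_eq)
  show "g n \<in> borel_measurable borel" for n
    unfolding gr[abs_def] r_def using f(1) by measurable
  show "finite (range (g n))" for n
  proof -
    obtain B where B: "\<And>t. cmod (f t) \<le> B" using f(2) by (auto simp: bounded_iff)
    define I where "I = (\<lambda>k::int. of_int k / real (Suc n)) ` {\<lfloor>Suc n * (-B)\<rfloor>..\<lfloor>Suc n * B\<rfloor>}"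
    have rI: "r n y \<in> I" if "\<bar>y\<bar> \<le> B" for y
    proof -
      have "real (Suc n) * (- B) \<le> Suc n * y" "real (Suc n) * y \<le> Suc n * B"
        using that by (intro mult_left_mono; linarith)+
      then show ?thesis
        unfolding r_def I_def by (intro imageI) (simp only: atLeastAtMost_iff floor_mono)
    qed
    have "range (g n) \<subseteq> (\<lambda>(a, b). Complex a b) ` (I \<times> I)"
    proof (rule image_subsetI)
      fix t
      have "\<bar>Re (f t)\<bar> \<le> B" "\<bar>Im (f t)\<bar> \<le> B"
        using order_trans[OF abs_Re_le_cmod B] order_trans[OF abs_Im_le_cmod B] by auto
      then show "g n t \<in> (\<lambda>(a, b). Complex a b) ` (I \<times> I)"
        unfolding g_def by (intro image_eqI[of _ _ "(r n (Re (f t)), r n (Im (f t)))"]) (simp_all add: rI)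
    qed
    then show ?thesis
      by (rule finite_subset) (simp add: I_def)
  qed
qed

context spectral
begin

lemma calc_lim:
  assumes fA: "\<And>n. calc (f n) (A n)" and f: "\<And>n t. cmod (f n t - g t) \<le> e n" "e \<longlonglongrightarrow> 0"
    and A: "A \<longlonglongrightarrow> B"
  shows "calc g B"
proof -
  have lim: "(\<lambda>n. f n t) \<longlonglongrightarrow> g t" for t
    by (rule LIM_zero_cancel, rule Lim_null_comparison[OF _ f(2)]) (use f(1) in auto)
  have g: "g \<in> borel_measurable borel"
    by (rule borel_measurable_LIMSEQ_metric[OF calcD(1)[OF fA]]) (rule lim)
  obtain C where C: "\<And>t. cmod (f 0 t) \<le> C" using calcD(2)[OF fA, of 0] by (auto simp: bounded_iff)
  have "cmod (g t) \<le> C + e 0" for t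
    using f(1)[of 0 t] C[of t] norm_triangle_ineq2[of "g t" "f 0 t"] by (simp add: norm_minus_commute)
  then have gb: "bounded (range g)" by (auto simp: bounded_iff)
  have BM: "B \<in> M" using M_closed[OF calcD(3)[OF fA] A] .
  have "cinner (B x) x = (\<integral>t. g t \<partial>N x)" for x
  proof -
    interpret finite_measure "N x" by (rule finite_measure_N)
    have "(\<lambda>n. cinner (A n x) x - cinner (B x) x) \<longlonglongrightarrow> 0"
    proof (rule Lim_null_comparison)
      have "(\<lambda>n. A n x - B x) \<longlonglongrightarrow> 0"
        using blinfun.tendsto[OF A tendsto_const] by (simp add: LIM_zero)
      then show "(\<lambda>n. norm (A n x - B x) * norm x) \<longlonglongrightarrow> 0"
        by (intro tendsto_mult_left_zero tendsto_norm_zero)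
      show "\<forall>\<^sub>F n in sequentially. norm (cinner (A n x) x - cinner (B x) x) \<le> norm (A n x - B x) * norm x"
        by (simp add: cinner_diff_left[symmetric] norm_cinner_le)
    qed
    moreover have "(\<lambda>n. (\<integral>t. f n t \<partial>N x) - (\<integral>t. g t \<partial>N x)) \<longlonglongrightarrow> 0"
    proof (rule Lim_null_comparison)
      show "(\<lambda>n. e n * measure (N x) UNIV) \<longlonglongrightarrow> 0"
        using f(2) by (rule tendsto_mult_left_zero)
      have i: "integrable (N x) (f n)" "integrable (N x) g" for n
        using calc_integrable[OF fA] integrable_bounded_N[OF g gb] by auto
      have "norm ((\<integral>t. f n t \<partial>N x) - (\<integral>t. g t \<partial>N x)) \<le> e n * measure (N x) UNIV" for n
      proof -
        have "norm (\<integral>t. f n t - g t \<partial>N x) \<le> (\<integral>t. e n \<partial>N x)"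
          using i f(1) by (intro integral_norm_bound[THEN order_trans] integral_mono) auto
        then show ?thesis using i by (simp add: mult.commute)
      qed
      then show "\<forall>\<^sub>F n in sequentially. norm ((\<integral>t. f n t \<partial>N x) - (\<integral>t. g t \<partial>N x)) \<le> e n * measure (N x) UNIV"
        by simp
    qed
    ultimately show ?thesis
      using calcD(4)[OF fA] LIMSEQ_unique by (simp add: LIM_zero_iff)
  qed
  then show ?thesis using g gb BM by (auto simp: calc_def)
qed

text \<open>The functional calculus is a norm limit of simple functions, which reduces multiplicativity and
  the formula for the trace to indicator functions.\<close>

lemma calc_simple_approx:
  assumes "calc f A"
  obtains g where "\<And>n. g n \<in> borel_measurable borel" "\<And>n. finite (range (g n))"
    "\<And>n t. cmod (g n t - f t) \<le> 2 / Suc n"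
    "(\<lambda>n. \<Sum>c\<in>range (g n). scaleC_op c (E (g n -` {c}))) \<longlonglongrightarrow> A"
proof -
  obtain g where g: "\<And>n. g n \<in> borel_measurable borel" "\<And>n. finite (range (g n))"
    "\<And>n t. cmod (g n t - f t) \<le> 2 / Suc n"
    using complex_simple_approx[OF calcD(1,2)[OF assms]] by blast
  have "norm ((\<Sum>c\<in>range (g n). scaleC_op c (E (g n -` {c}))) - A) \<le> 2 * (2 / Suc n)" for n
    by (rule calc_norm[OF calc_diff[OF calc_simple(1)[OF g(1,2)] assms]]) (rule g(3))
  then have bound: "\<forall>\<^sub>F n in sequentially. norm ((\<Sum>c\<in>range (g n). scaleC_op c (E (g n -` {c}))) - A) \<le> 2 * (2 / Suc n)"
    by (rule always_eventually[OF allI])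
  have "(\<lambda>n. 2 * (2 / Suc n)) \<longlonglongrightarrow> 0"
    using tendsto_mult_right_zero[OF LIMSEQ_inverse_real_of_nat, of 4] by (simp add: divide_inverse)
  from Lim_null_comparison[OF bound this]
  have "(\<lambda>n. (\<Sum>c\<in>range (g n). scaleC_op c (E (g n -` {c}))) - A) \<longlonglongrightarrow> 0" .
  from LIM_zero_cancel[OF this] show ?thesis by (rule that[OF g])
qed

lemma calc_mult:
  assumes f: "calc f A" and h: "calc h B"
  shows "calc (\<lambda>t. f t * h t) (A o\<^sub>L B)"
proof -
  let ?A = "\<lambda>g::nat \<Rightarrow> real \<Rightarrow> complex. \<lambda>n. \<Sum>c\<in>range (g n). scaleC_op c (E (g n -` {c}))"
  obtain g where g: "\<And>n. g n \<in> borel_measurable borel" "\<And>n. finite (range (g n))"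
    "\<And>n t. cmod (g n t - f t) \<le> 2 / Suc n" "?A g \<longlonglongrightarrow> A"
    using calc_simple_approx[OF f] by blast
  obtain k where k: "\<And>n. k n \<in> borel_measurable borel" "\<And>n. finite (range (k n))"
    "\<And>n t. cmod (k n t - h t) \<le> 2 / Suc n" "?A k \<longlonglongrightarrow> B"
    using calc_simple_approx[OF h] by blast
  obtain C where C: "\<And>t. cmod (f t) \<le> C" using calcD(2)[OF f] by (auto simp: bounded_iff)
  obtain C' where C': "\<And>t. cmod (h t) \<le> C'" using calcD(2)[OF h] by (auto simp: bounded_iff)
  show ?thesis
  proof (rule calc_lim)
    show "(\<lambda>n. ?A g n o\<^sub>L ?A k n) \<longlonglongrightarrow> (A o\<^sub>L B)"
      using g(4) k(4) by (rule bounded_bilinear.tendsto[OF bounded_bilinear_blinfun_compose])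
    show "calc (\<lambda>t. g n t * k n t) (?A g n o\<^sub>L ?A k n)" for n
    proof -
      have S: "g n -` {c} \<in> sets borel" "k n -` {c} \<in> sets borel" for c
        using measurable_sets[OF g(1), of "{c}"] measurable_sets[OF k(1), of "{c}"] by auto
      \<comment> \<open>The product is expanded over the common refinement of the level sets, where
        \<open>E_Int\<close> applies.\<close>
      have "calc (\<lambda>t. \<Sum>c\<in>range (g n). \<Sum>d\<in>range (k n). c * (d * indicator (g n -` {c} \<inter> k n -` {d}) t))
         (\<Sum>c\<in>range (g n). \<Sum>d\<in>range (k n). scaleC_op c (scaleC_op d (E (g n -` {c} \<inter> k n -` {d}))))"
        using S by (intro calc_sum calc_scale calc_indicator) auto
      also have "(\<Sum>c\<in>range (g n). \<Sum>d\<in>range (k n). scaleC_op c (scaleC_op d (E (g n -` {c} \<inter> k n -` {d}))))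
          = (?A g n o\<^sub>L ?A k n)"
        using S by (simp add: compose_sum scaleC_op_compose_left scaleC_op_compose_right M_clinear E_Int)
            (rule sum.swap)
      also have "(\<lambda>t. \<Sum>c\<in>range (g n). \<Sum>d\<in>range (k n). c * (d * indicator (g n -` {c} \<inter> k n -` {d}) t))
          = (\<lambda>t. (\<Sum>c\<in>range (g n). c * indicator (g n -` {c}) t) * (\<Sum>d\<in>range (k n). d * indicator (k n -` {d}) t))"
        by (simp add: sum_product indicator_inter_arith algebra_simps)
      also have "\<dots> = (\<lambda>t. g n t * k n t)"
        by (simp only: calc_simple(2)[OF g(1,2), of n, symmetric, THEN fun_cong] 
            calc_simple(2)[OF k(1,2), of n, symmetric, THEN fun_cong])
      finally show ?thesis .
    qed
    show "cmod (g n t * k n t - f t * h t) \<le> (C + 2 / Suc n) * (2 / Suc n) + (2 / Suc n) * C'" for n t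
    proof -
      have "g n t * k n t - f t * h t = g n t * (k n t - h t) + (g n t - f t) * h t"
        by (simp add: algebra_simps)
      also have "cmod \<dots> \<le> cmod (g n t) * cmod (k n t - h t) + cmod (g n t - f t) * cmod (h t)"
        by (metis norm_triangle_ineq norm_mult)
      also have "\<dots> \<le> (C + 2 / Suc n) * (2 / Suc n) + (2 / Suc n) * C'"
      proof (intro add_mono mult_mono)
        show "cmod (g n t) \<le> C + 2 / Suc n"
          using g(3)[of n t] C[of t] norm_triangle_ineq2[of "g n t" "f t"] by linarith
        show "0 \<le> C + 2 / Suc n"
          using order_trans[OF norm_ge_zero C[of t]] by simp
      qed (use g(3) k(3) C' in auto)
      finally show ?thesis .
    qed
    have z: "(\<lambda>n. 2 / real (Suc n)) \<longlonglongrightarrow> 0"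
      using tendsto_mult_right_zero[OF LIMSEQ_inverse_real_of_nat, of 2] by (simp add: divide_inverse)
    show "(\<lambda>n. (C + 2 / Suc n) * (2 / Suc n) + (2 / Suc n) * C') \<longlonglongrightarrow> 0"
      using tendsto_add[OF tendsto_mult[OF tendsto_add[OF tendsto_const[of C] z] z] 
          tendsto_mult[OF z tendsto_const[of C']]] by simp
  qed
qed

end

section \<open>The trace on the spectral measure\<close>

text \<open>On a bounded support the exponential series is dominated by
  \<open>(\<bar>s\<bar> R)\<^sup>n / n!\<close> and may be integrated term by term. Hence the
  moments determine the characteristic function, and with it the measure.\<close>

lemma char_sums_moments:
  assumes M: "real_distribution M" and R: "AE t in M. \<bar>t\<bar> \<le> R"
  shows "(\<lambda>n. (\<i> * complex_of_real s) ^ n / fact n * complex_of_real (\<integral>t. t ^ n \<partial>M)) sums char M s"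
proof -
  interpret real_distribution M by (rule M)
  let ?f = "\<lambda>n t. (\<i> * complex_of_real s) ^ n / fact n * complex_of_real (t ^ n)"
  have int: "integrable M (\<lambda>t. t ^ n)" for n
    by (rule integrable_const_bound[of _ "R ^ n"]) (use R in \<open>auto simp: power_abs intro!: power_mono\<close>)
  have "\<bar>s * t\<bar> ^ n \<le> (\<bar>s\<bar> * R) ^ n" if "\<bar>t\<bar> \<le> R" for t n
    using that by (intro power_mono) (auto simp: abs_mult intro!: mult_left_mono)
  have le: "norm (\<integral>t. norm (?f n t) \<partial>M) \<le> (\<bar>s\<bar> * R) ^ n / fact n" for n
  proof -
    have "(\<integral>t. norm (?f n t) \<partial>M) \<le> (\<integral>t. (\<bar>s\<bar> * R) ^ n / fact n \<partial>M)"
    proof (rule integral_mono_AE)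
      show "integrable M (\<lambda>t. norm (?f n t))"
        using int[of n] by (intro integrable_norm integrable_mult_right integrable_of_real)
      show "AE t in M. norm (?f n t) \<le> (\<bar>s\<bar> * R) ^ n / fact n"
        using R
      proof eventually_elim
        case (elim t)
        then show ?case
          using mult_left_mono[OF power_mono[OF elim, of n], of "\<bar>s\<bar> ^ n"]
          by (simp add: norm_mult norm_divide norm_power power_mult_distrib divide_right_mono)
      qed
    qed simp
    then show ?thesis using prob_space by simp
  qed
  have "(\<lambda>n. integral\<^sup>L M (?f n)) sums (\<integral>t. (\<Sum>n. ?f n t) \<partial>M)"
  proof (rule sums_integral)
    show "integrable M (?f n)" for n
      using int[of n] by (intro integrable_mult_right integrable_of_real)
    show "AE t in M. summable (\<lambda>n. norm (?f n t))"
    proof (rule AE_I2)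
      fix t
      have "summable (\<lambda>n. \<bar>s * t\<bar> ^ n / fact n)"
        using summable_exp_generic[of "\<bar>s * t\<bar>"] by (simp add: divide_inverse mult.commute)
      then show "summable (\<lambda>n. norm (?f n t))"
        by (simp add: norm_mult norm_divide norm_power power_mult_distrib abs_mult power_abs)
    qed
    show "summable (\<lambda>n. \<integral>t. norm (?f n t) \<partial>M)"
    proof (rule summable_comparison_test')
      show "summable (\<lambda>n. (\<bar>s\<bar> * R) ^ n / fact n)"
        using summable_exp_generic[of "\<bar>s\<bar> * R"] by (simp add: divide_inverse mult.commute)
      show "norm (\<integral>t. norm (?f n t) \<partial>M) \<le> (\<bar>s\<bar> * R) ^ n / fact n" if "0 \<le> n" for n
        by (rule le)
    qed
  qed
  moreover have "(\<Sum>n. ?f n t) = iexp (s * t)" for t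
  proof -
    have "(\<lambda>n. (\<i> * (s * t)) ^ n /\<^sub>R fact n) sums iexp (s * t)"
      by (rule exp_converges)
    moreover have "(\<i> * (s * t)) ^ n /\<^sub>R fact n = ?f n t" for n
      by (simp add: power_mult_distrib scaleR_conv_of_real divide_inverse)
    ultimately show ?thesis by (simp add: sums_iff)
  qed
  moreover have "integral\<^sup>L M (?f n) = (\<i> * complex_of_real s) ^ n / fact n * complex_of_real (\<integral>t. t ^ n \<partial>M)" for n
    by (simp only: integral_mult_right_zero integral_complex_of_real)
  ultimately show ?thesis by (simp only: char_def)
qed

lemma real_distribution_eqI_moments:
  assumes "real_distribution M1" "AE t in M1. \<bar>t\<bar> \<le> R1" "real_distribution M2" "AE t in M2. \<bar>t\<bar> \<le> R2"
    and "\<And>n. (\<integral>t. t ^ n \<partial>M1) = (\<integral>t. t ^ n \<partial>M2)"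
  shows "M1 = M2"
proof (rule Levy_uniqueness[OF assms(1,3)], rule ext)
  fix s
  show "char M1 s = char M2 s"
    using char_sums_moments[OF assms(1,2), of s] char_sums_moments[OF assms(3,4), of s] assms(5)
      sums_unique2 by fastforce
qed

lemma real_distribution_uniform01: "real_distribution uniform01"
  unfolding real_distribution_def real_distribution_axioms_def
  by (auto intro!: prob_space_uniform_measure)

lemma AE_uniform01: "AE t in uniform01. t \<in> {0..1}"
  by (rule AE_uniform_measureI) auto

context spectral
begin

lemma E_diff: "S \<in> sets borel \<Longrightarrow> S' \<in> sets borel \<Longrightarrow> S \<subseteq> S' \<Longrightarrow> E S' - E S = E (S' - S)"
  using E_Un[of S "S' - S"] by (simp add: Un_absorb1)

lemma positive_E: "S \<in> sets borel \<Longrightarrow> positive_op (E S)"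
  unfolding positive_op_def by (simp add: E_cinner complex_nonneg_Reals_iff)

lemma op_le_E: "S \<in> sets borel \<Longrightarrow> S' \<in> sets borel \<Longrightarrow> S \<subseteq> S' \<Longrightarrow> op_le (E S) (E S')"
  unfolding op_le_def by (simp add: E_diff positive_E)

lemma tau_E: "S \<in> sets borel \<Longrightarrow> \<tau> (E S) = of_real (Re (\<tau> (E S))) \<and> 0 \<le> Re (\<tau> (E S))"
  using tau_pos_Re[OF E_M positive_E, of S] by (simp add: complex_eq_iff)

lemma tau_E_mono: "S \<in> sets borel \<Longrightarrow> S' \<in> sets borel \<Longrightarrow> S \<subseteq> S' \<Longrightarrow> Re (\<tau> (E S)) \<le> Re (\<tau> (E S'))"
  using tau_E[of "S' - S"] tau_diff[of "E S'" "E S"] by (simp add: E_diff)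

text \<open>This is where normality of the trace enters: the partial unions give an increasing
  sequence of projections with supremum \<open>E (\<Union>n. F n)\<close>.\<close>

lemma tau_E_sums:
  assumes F: "range F \<subseteq> sets borel" "disjoint_family F"
  shows "(\<lambda>n::nat. Re (\<tau> (E (F n)))) sums Re (\<tau> (E (\<Union>n. F n)))"
proof -
  define U where "U n = (\<Union>i<n. F i)" for n
  have Fb: "F n \<in> sets borel" for n using F by auto
  have Ub: "U n \<in> sets borel" for n unfolding U_def using Fb by auto
  have UNb: "(\<Union>n. F n) \<in> sets borel" using Fb by auto
  have Umono: "m \<le> n \<Longrightarrow> U m \<subseteq> U n" for m n unfolding U_def by (intro UN_mono) auto
  have EU: "E (U n) = (\<Sum>i<n. E (F i))" for n
  proof (induction n)
    case (Suc n)
    have "F i \<inter> F n = {}" if "i < n" for i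
      using F(2) that unfolding disjoint_family_on_def by (metis UNIV_I less_irrefl)
    then have "U (Suc n) = U n \<union> F n" "U n \<inter> F n = {}"
      by (auto simp: U_def less_Suc_eq)
    then show ?case using Suc E_Un[OF Ub Fb] by simp
  qed (simp add: U_def)
  let ?B = "range (\<lambda>n. E (U n))"
  have "Re (\<tau> (E (\<Union>n. F n))) = (SUP B\<in>?B. Re (\<tau> B))"
  proof -
    have normal: "normal_on M \<tau>" using space by (simp add: tracial_wstar_space_def)
    show ?thesis
    proof (rule normal[unfolded normal_on_def, rule_format], intro conjI ballI impI)
      show "?B \<subseteq> {B \<in> M. positive_op B}" using Ub positive_E by auto
      show "E (\<Union>n. F n) \<in> M" using UNb by simp
      fix B C assume "B \<in> ?B" "C \<in> ?B"
      then obtain m n where "B = E (U m)" "C = E (U n)" by auto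
      moreover have "U m \<subseteq> U (max m n)" "U n \<subseteq> U (max m n)"
        by (intro Umono; simp)+
      ultimately show "\<exists>D\<in>?B. op_le B D \<and> op_le C D"
        using Ub by (intro bexI[of _ "E (U (max m n))"]) (auto intro!: op_le_E)
    next
      fix B assume "B \<in> ?B"
      then show "op_le B (E (\<Union>n. F n))" using Ub UNb by (auto simp: U_def intro!: op_le_E)
    next
      \<comment> \<open>The quadratic forms of \<open>A' - E (U n)\<close> are nonnegative and
        converge pointwise, so the limit is nonnegative too.\<close>
      fix A' assume A': "A' \<in> M" "\<forall>B\<in>?B. op_le B A'"
      show "op_le (E (\<Union>n. F n)) A'"
        unfolding op_le_def positive_op_def
      proof
        fix x
        have "(\<lambda>n. E (U n) x) \<longlonglongrightarrow> E (\<Union>n. F n) x"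
          using E_sums[OF F, of x] by (simp add: sums_def EU comp_simps)
        then have "(\<lambda>n. inner (A' x - E (U n) x) x) \<longlonglongrightarrow> inner (A' x - E (\<Union>n. F n) x) x"
          "(\<lambda>n. inner (A' x - E (U n) x) (scaleC \<i> x)) \<longlonglongrightarrow> inner (A' x - E (\<Union>n. F n) x) (scaleC \<i> x)"
          by (auto intro!: tendsto_intros)
        then have L: "(\<lambda>n. Complex (inner (A' x - E (U n) x) x) (inner (A' x - E (U n) x) (scaleC \<i> x)))
            \<longlonglongrightarrow> Complex (inner (A' x - E (\<Union>n. F n) x) x) (inner (A' x - E (\<Union>n. F n) x) (scaleC \<i> x))"
          by (rule tendsto_Complex)
        have lim: "(\<lambda>n. cinner ((A' - E (U n)) x) x) \<longlonglongrightarrow> cinner ((A' - E (\<Union>n. F n)) x) x"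
        proof -
          have "Complex (inner y x) (inner y (scaleC \<i> x)) = cinner y x" for y
            by (simp add: complex_eq_iff Im_cinner) (simp add: inner_eq_Re_cinner)
          then show ?thesis using L by (simp add: comp_simps)
        qed
        show "cinner ((A' - E (\<Union>n. F n)) x) x \<in> \<real>\<^sub>\<ge>\<^sub>0"
          by (rule closed_sequentially[OF closed_nonneg_Reals_complex _ lim])
            (use A'(2) in \<open>auto simp: op_le_def positive_op_def\<close>)
      qed
    qed auto
  qed
  moreover have "(\<lambda>n. Re (\<tau> (E (U n)))) \<longlonglongrightarrow> (SUP n. Re (\<tau> (E (U n))))"
  proof (rule LIMSEQ_incseq_SUP)
    show "bdd_above (range (\<lambda>n. Re (\<tau> (E (U n)))))"
      using tau_E_mono[of "U _" UNIV] Ub by (intro bdd_aboveI[of _ 1]) auto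
    show "incseq (\<lambda>n. Re (\<tau> (E (U n))))"
      by (intro monoI tau_E_mono Ub Umono)
  qed
  moreover have "Re (\<tau> (E (U n))) = (\<Sum>i<n. Re (\<tau> (E (F i))))" for n
    using Fb by (simp add: EU tau_sum)
  ultimately show ?thesis by (simp add: sums_def image_image)
qed

text \<open>The composition of \<open>\<tau>\<close> with \<open>E\<close>; it is the distribution
  of \<open>D0\<close> once \<open>E\<close> is the spectral measure of \<open>D0\<close>.\<close>

definition nu :: "real measure" where
  "nu = measure_of UNIV (sets borel) (\<lambda>S. ennreal (Re (\<tau> (E S))))"

lemma sets_nu [simp, measurable_cong]: "sets nu = sets borel"
  and space_nu [simp]: "space nu = UNIV"
  by (simp_all add: nu_def sets.sigma_sets_eq[of borel, simplified])

lemma emeasure_nu: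
  assumes "S \<in> sets borel" shows "emeasure nu S = ennreal (Re (\<tau> (E S)))"
proof -
  have "countably_additive (sets borel) (\<lambda>S. ennreal (Re (\<tau> (E S))))"
  proof (rule countably_additiveI)
    fix F :: "nat \<Rightarrow> real set"
    assume F: "range F \<subseteq> sets borel" "disjoint_family F"
    show "(\<Sum>i. ennreal (Re (\<tau> (E (F i))))) = ennreal (Re (\<tau> (E (\<Union>i. F i))))"
      using tau_E_sums[OF F] by (intro suminf_ennreal_eq) (use F tau_E in auto)
  qed
  then show ?thesis
    using assms unfolding nu_def
    by (intro emeasure_measure_of_sigma) (auto simp: positive_def sets.sigma_algebra_axioms[of borel, simplified])
qed

lemma measure_nu: "S \<in> sets borel \<Longrightarrow> measure nu S = Re (\<tau> (E S))"
  using tau_E by (simp add: measure_def emeasure_nu)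

lemma prob_nu: "prob_space nu"
  by (rule prob_spaceI) (simp add: emeasure_nu)

lemma calc_tau_nu:
  assumes f: "calc f A"
  shows "\<tau> A = (\<integral>t. f t \<partial>nu)"
proof -
  interpret nu: prob_space nu by (rule prob_nu)
  obtain g where g: "\<And>n. g n \<in> borel_measurable borel" "\<And>n. finite (range (g n))"
    "\<And>n t. cmod (g n t - f t) \<le> 2 / Suc n"
    "(\<lambda>n. \<Sum>c\<in>range (g n). scaleC_op c (E (g n -` {c}))) \<longlonglongrightarrow> A"
    using calc_simple_approx[OF f] by blast
  let ?A = "\<lambda>n. \<Sum>c\<in>range (g n). scaleC_op c (E (g n -` {c}))"
  have int: "integrable nu h" if h: "h \<in> borel_measurable borel" "bounded (range h)" for h :: "real \<Rightarrow> complex"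
  proof -
    obtain B where "\<And>t. norm (h t) \<le> B" using h(2) by (auto simp: bounded_iff)
    then show ?thesis using h(1) by (intro nu.integrable_const_bound[of _ B]) auto
  qed
  have S: "g n -` {c} \<in> sets borel" for n c
    using measurable_sets[OF g(1), of "{c}"] by simp
  have intg: "integrable nu (g n)" for n
    using int[OF g(1)] finite_imp_bounded[OF g(2)] by blast
  have "\<tau> (?A n) = (\<integral>t. g n t \<partial>nu)" for n
  proof -
    have ind: "has_bochner_integral nu (\<lambda>t. c * complex_of_real (indicator (g n -` {c}) t)) (c * \<tau> (E (g n -` {c})))" for c
    proof -
      have "has_bochner_integral nu (indicator (g n -` {c})) (Re (\<tau> (E (g n -` {c}))))"
        using has_bochner_integral_real_indicator[of "g n -` {c}" nu] S measure_nu[OF S]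
        by (simp add: less_top[symmetric])
      from has_bochner_integral_of_real[OF this, where ?'a = complex] tau_E[OF S, of n c]
      have "has_bochner_integral nu (\<lambda>t. complex_of_real (indicator (g n -` {c}) t)) (\<tau> (E (g n -` {c})))"
        by simp
      then show ?thesis by (rule has_bochner_integral_mult_right)
    qed
    have "has_bochner_integral nu (\<lambda>t. \<Sum>c\<in>range (g n). c * complex_of_real (indicator (g n -` {c}) t))
        (\<Sum>c\<in>range (g n). c * \<tau> (E (g n -` {c})))"
      by (intro has_bochner_integral_sum ind)
    moreover have "(\<lambda>t. \<Sum>c\<in>range (g n). c * complex_of_real (indicator (g n -` {c}) t)) = g n"
      by (rule trans[OF _ calc_simple(2)[OF g(1,2), of n, symmetric]], intro ext sum.cong refl)
        (simp add: indicator_def)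
    ultimately show ?thesis
      using S by (simp add: has_bochner_integral_iff tau_sum tau_scaleC)
  qed
  then have lim: "(\<lambda>n. \<integral>t. g n t \<partial>nu) \<longlonglongrightarrow> \<tau> A"
    using tau_tendsto[OF _ g(4)] S by (simp add: M_sum)
  have lim': "(\<lambda>n. (\<integral>t. g n t \<partial>nu) - (\<integral>t. f t \<partial>nu)) \<longlonglongrightarrow> 0"
  proof (rule Lim_null_comparison)
    show "(\<lambda>n. 2 / real (Suc n)) \<longlonglongrightarrow> 0"
      using tendsto_mult_right_zero[OF LIMSEQ_inverse_real_of_nat, of 2] by (simp add: divide_inverse)
    have "norm ((\<integral>t. g n t \<partial>nu) - (\<integral>t. f t \<partial>nu)) \<le> 2 / Suc n" for n
    proof -
      have i: "integrable nu f" using int calcD[OF f] by blast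
      have "norm (\<integral>t. g n t - f t \<partial>nu) \<le> (\<integral>t. 2 / Suc n \<partial>nu)"
        using intg i g(3) by (intro integral_norm_bound[THEN order_trans] integral_mono) auto
      then show ?thesis using i intg nu.prob_space by simp
    qed
    then show "\<forall>\<^sub>F n in sequentially. norm ((\<integral>t. g n t \<partial>nu) - (\<integral>t. f t \<partial>nu)) \<le> 2 / Suc n"
      by simp
  qed
  show ?thesis
    by (rule LIMSEQ_unique[OF lim LIM_zero_cancel[OF lim']])
qed

lemma AE_N_notin: "S \<in> sets borel \<Longrightarrow> E S = 0 \<Longrightarrow> AE t in N x. t \<notin> S"
  by (rule AE_not_in) (simp add: null_sets_def emeasure_N)

lemma AE_nu_notin: "S \<in> sets borel \<Longrightarrow> E S = 0 \<Longrightarrow> AE t in nu. t \<notin> S"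
  by (rule AE_not_in) (simp add: null_sets_def emeasure_nu)

lemma calc_power: "calc f A \<Longrightarrow> calc (\<lambda>t. f t ^ n) (op_power A n)"
  by (induction n) (auto simp: calc_id intro: calc_mult)

end

section \<open>The spectral measure of an element with uniform distribution\<close>

locale uniform_spectral = spectral +
  fixes D0 :: "'a oper"
  assumes D0_M: "D0 \<in> M" and D0_dist: "has_distribution \<tau> D0 uniform01"
    and D0_calc: "fun_calculus M E complex_of_real D0"
begin

lemma N_scaled:
  assumes "S \<in> sets borel"
  shows "AE t in N (E S x). t \<in> S"
proof (rule AE_I[of _ _ "- S"])
  have "E (- S) (E S x) = 0"
    using E_Int[of "- S" S] assms by (metis blinfun_apply_blinfun_compose E_empty Compl_disjoint2 borel_comp zero_blinfun.rep_eq)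
  then show "emeasure (N (E S x)) (- S) = 0"
    using assms by (simp add: emeasure_N)
qed (use assms in auto)

text \<open>On a nonzero vector in the range of this projection the form of
  \<open>\<sigma> D0\<close> would exceed \<open>R\<close> times the square of the norm, against
  \<open>norm D0 \<le> R\<close>. The sign \<open>\<sigma>\<close> treats both ends of the
  spectrum.\<close>

lemma E_outside:
  fixes \<sigma> :: real
  assumes \<sigma>: "\<sigma> = 1 \<or> \<sigma> = -1" and R: "norm D0 \<le> R"
  shows "E {t. R < \<sigma> * t} = 0"
proof (rule blinfun_eqI)
  fix x
  let ?S = "{t. R < \<sigma> * t}"
  have S: "?S \<in> sets borel" by measurable
  define y where "y = E ?S x"
  interpret finite_measure "N y" by (rule finite_measure_N)
  have "AE t in N (E ?S x). t \<in> ?S" by (rule N_scaled[OF S])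
  then have AE: "AE t in N y. R < \<sigma> * t" unfolding y_def by simp
  have "integrable (N y) complex_of_real" and D0y: "cinner (D0 y) y = (\<integral>t. complex_of_real t \<partial>N y)"
    using D0_calc unfolding fun_calculus_def by auto
  then have int: "integrable (N y) (\<lambda>t. t)"
    using complex_of_real_integrable_eq[of "N y" "\<lambda>t. t"] by simp
  have "(\<integral>t. \<sigma> * t - R \<partial>N y) = \<sigma> * (\<integral>t. t \<partial>N y) - R * (norm y)\<^sup>2"
    using int measure_N[of UNIV y] by simp
  also have "\<sigma> * (\<integral>t. t \<partial>N y) \<le> cmod (cinner (D0 y) y)"
    using \<sigma> unfolding D0y by auto
  also have "\<dots> \<le> norm D0 * norm y * norm y"
    by (rule order_trans[OF norm_cinner_le]) (intro mult_right_mono norm_blinfun norm_ge_zero)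
  also have "\<dots> \<le> R * norm y * norm y"
    using R by (intro mult_right_mono) auto
  finally have le: "(\<integral>t. \<sigma> * t - R \<partial>N y) \<le> 0"
    by (simp add: power2_eq_square)
  have int': "integrable (N y) (\<lambda>t. \<sigma> * t - R)" using int by simp
  have AE': "AE t in N y. 0 \<le> \<sigma> * t - R" using AE by auto
  have "(\<integral>t. \<sigma> * t - R \<partial>N y) = 0"
    using le integral_nonneg_AE[OF AE'] by simp
  then have "AE t in N y. \<sigma> * t - R = 0"
    using integral_nonneg_eq_0_iff_AE[OF int' AE'] by simp
  with AE have "AE t in N y. False"
    by eventually_elim simp
  then have "emeasure (N y) UNIV = 0"
    using AE_iff_measurable[of UNIV "N y" "\<lambda>_. False"] by simp
  then have "y = 0"
    by (simp add: emeasure_N)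
  then show "E ?S x = blinfun_apply 0 x" by (simp add: y_def)
qed

text \<open>At least 1, so that \<open>cl\<close> is the identity on the unit interval as well as on
  the spectrum of \<open>D0\<close>.\<close>

definition R :: real where "R = max 1 (norm D0)"

text \<open>Clipping replaces the unbounded identity function, which \<open>calc\<close> excludes,
  by a bounded one that agrees with it outside an \<open>E\<close>-null set.\<close>

definition cl :: "real \<Rightarrow> real" where "cl t = max (- R) (min R t)"

lemma cl_bound: "\<bar>cl t\<bar> \<le> R" and cl_id: "\<bar>t\<bar> \<le> R \<Longrightarrow> cl t = t"
  by (auto simp: cl_def R_def)

lemma cl_measurable [measurable]: "cl \<in> borel_measurable borel"
  unfolding cl_def by measurable

lemma E_R: "E {t. R < t} = 0" "E {t. t < - R} = 0"
proof -
  have R: "norm D0 \<le> R" by (simp add: R_def)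
  show "E {t. R < t} = 0" using E_outside[of 1 R] R by simp
  have "{t. R < -1 * t} = {t. t < - R}" by auto
  then show "E {t. t < - R} = 0" using E_outside[of "-1" R] R by metis
qed

lemma calc_D0: "calc (\<lambda>t. complex_of_real (cl t)) D0"
  unfolding calc_def
proof (intro conjI allI)
  show "bounded (range (\<lambda>t. complex_of_real (cl t)))"
    using cl_bound by (auto simp: bounded_iff)
  show "cinner (D0 x) x = (\<integral>t. complex_of_real (cl t) \<partial>N x)" for x
  proof -
    have "AE t in N x. \<not> R < t" "AE t in N x. \<not> t < - R"
      using AE_N_notin[OF _ E_R(1), of x] AE_N_notin[OF _ E_R(2), of x] by auto
    then have "AE t in N x. complex_of_real t = complex_of_real (cl t)"
      by eventually_elim (simp add: cl_id)
    then have "(\<integral>t. complex_of_real t \<partial>N x) = (\<integral>t. complex_of_real (cl t) \<partial>N x)"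
      by (intro integral_cong_AE) auto
    moreover have "cinner (D0 x) x = (\<integral>t. complex_of_real t \<partial>N x)"
      using D0_calc unfolding fun_calculus_def by auto
    ultimately show ?thesis
      by simp
  qed
qed (use D0_M in auto)

text \<open>Both measures have bounded support, and the moments of both are those of
  \<open>D0\<close>.\<close>

lemma nu_uniform: "nu = uniform01"
proof -
  interpret nu: prob_space nu by (rule prob_nu)
  have AEnu: "AE t in nu. \<bar>t\<bar> \<le> R"
  proof -
    have "AE t in nu. \<not> R < t" "AE t in nu. \<not> t < - R"
      using AE_nu_notin[OF _ E_R(1)] AE_nu_notin[OF _ E_R(2)] by auto
    then show ?thesis by eventually_elim auto
  qed
  show ?thesis
  proof (rule real_distribution_eqI_moments[OF _ AEnu real_distribution_uniform01])
    show "real_distribution nu"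
      by (simp add: real_distribution_def real_distribution_axioms_def prob_nu)
    show "AE t in uniform01. \<bar>t\<bar> \<le> 1"
      using AE_uniform01 by eventually_elim auto
    fix n
    have "complex_of_real (\<integral>t. t ^ n \<partial>uniform01) = \<tau> (op_power D0 n)"
      using D0_dist by (simp add: has_distribution_def)
    also have "\<dots> = (\<integral>t. complex_of_real (cl t) ^ n \<partial>nu)"
      by (rule calc_tau_nu[OF calc_power[OF calc_D0]])
    also have "\<dots> = complex_of_real (\<integral>t. cl t ^ n \<partial>nu)"
      by (simp flip: of_real_power)
    also have "(\<integral>t. cl t ^ n \<partial>nu) = (\<integral>t. t ^ n \<partial>nu)"
      by (rule integral_cong_AE) (use AEnu in \<open>auto elim!: eventually_mono simp: cl_id\<close>)
    finally show "(\<integral>t. t ^ n \<partial>nu) = (\<integral>t. t ^ n \<partial>uniform01)" by simp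
  qed
qed

lemma calc_tau: "calc f A \<Longrightarrow> \<tau> A = (\<integral>t. f t \<partial>uniform01)"
  using calc_tau_nu nu_uniform by simp

text \<open>Faithfulness turns trace zero into a null set of \<open>E\<close>, so a function may be
  altered on a \<open>uniform01\<close>-null set without changing the operator.\<close>

lemma E_null:
  assumes "S \<in> sets borel" "emeasure uniform01 S = 0"
  shows "E S = 0"
proof (rule tau_faithful[OF E_M[OF assms(1)] positive_E[OF assms(1)]])
  show "\<tau> (E S) = 0"
    using tau_E[OF assms(1)] emeasure_nu[OF assms(1)] assms(2) 
    by (simp add: nu_uniform del: emeasure_uniform_measure)
qed

text \<open>\<open>f\<close> is reset to 0 where it exceeds its essential bound; this set is
  \<open>E\<close>-null, so the operator is still \<open>D\<close>.\<close>

lemma calc_of_ess_bounded: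
  assumes f: "f \<in> borel_measurable borel" and b: "AE t in uniform01. norm (f t) \<le> b"
    and D: "fun_calculus M E f D"
  obtains g where "calc g D" "AE t in uniform01. f t = g t"
proof
  define g where "g t = (if norm (f t) \<le> b then f t else 0)" for t
  have S: "{t. \<not> norm (f t) \<le> b} \<in> sets borel" using f by measurable
  have "emeasure uniform01 {t. \<not> norm (f t) \<le> b} = 0"
    using AE_iff_measurable[of "{t. \<not> norm (f t) \<le> b}" uniform01 "\<lambda>t. norm (f t) \<le> b"] S b by simp
  then have E0: "E {t. \<not> norm (f t) \<le> b} = 0" using E_null[OF S] by simp
  show "AE t in uniform01. f t = g t"
    using b by eventually_elim (simp add: g_def)
  have g: "g \<in> borel_measurable borel" unfolding g_def using f by measurable
  show "calc g D"
    unfolding calc_def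
  proof (intro conjI allI)
    have "norm (g t) \<le> \<bar>b\<bar>" for t
      by (cases "norm (f t) \<le> b") (auto simp: g_def)
    then show "bounded (range g)" by (auto simp: bounded_iff)
    show "D \<in> M" using D by (simp add: fun_calculus_def)
    show "cinner (D x) x = (\<integral>t. g t \<partial>N x)" for x
    proof -
      have "AE t in N x. norm (f t) \<le> b"
        using AE_N_notin[OF S E0, of x] by auto
      then have "AE t in N x. f t = g t"
        by eventually_elim (simp add: g_def)
      then have "(\<integral>t. f t \<partial>N x) = (\<integral>t. g t \<partial>N x)"
        using f g by (intro integral_cong_AE) auto
      then show ?thesis using D by (simp add: fun_calculus_def)
    qed
  qed (rule g)
qed

end

section \<open>Closure of free subalgebras in the 2-norm\<close>

context tracial
begin

text \<open>Convergence in the 2-norm along norm-bounded sequences; the norm bound makes products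
  converge.\<close>

definition conv :: "(nat \<Rightarrow> 'h oper) \<Rightarrow> 'h oper \<Rightarrow> bool" where
  "conv s b \<longleftrightarrow> (\<forall>n. s n \<in> M) \<and> b \<in> M \<and> (\<exists>C. \<forall>n. norm (s n) \<le> C) \<and> (\<lambda>n. n2 (s n - b)) \<longlonglongrightarrow> 0"

text \<open>Applied to the algebra generated by \<open>D0\<close>, this closure adds all bounded
  Borel functions of \<open>D0\<close>, spectral projections included.\<close>

definition l2cl :: "'h oper set \<Rightarrow> 'h oper set" where
  "l2cl A = {b. \<exists>s. conv s b \<and> (\<forall>n. s n \<in> A)}"

lemma convD: assumes "conv s b"
  shows "s n \<in> M" "b \<in> M" "\<exists>C. \<forall>n. norm (s n) \<le> C" "(\<lambda>n. n2 (s n - b)) \<longlonglongrightarrow> 0"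
  using assms by (auto simp: conv_def)

lemma conv_const: "a \<in> M \<Longrightarrow> conv (\<lambda>_. a) a"
  by (auto simp: conv_def n2_zero)

lemma conv_add:
  assumes s: "conv s b" and t: "conv t c"
  shows "conv (\<lambda>n. s n + t n) (b + c)"
proof -
  obtain C C' where C: "\<And>n. norm (s n) \<le> C" "\<And>n. norm (t n) \<le> C'"
    using convD(3)[OF s] convD(3)[OF t] by blast
  have "norm (s n + t n) \<le> C + C'" for n
    using norm_triangle_ineq[of "s n" "t n"] C[of n] by linarith
  moreover have "(\<lambda>n. n2 (s n + t n - (b + c))) \<longlonglongrightarrow> 0"
  proof (rule Lim_null_comparison[OF always_eventually[OF allI]])
    show "norm (n2 (s n + t n - (b + c))) \<le> n2 (s n - b) + n2 (t n - c)" for n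
      using n2_triangle[of "s n - b" "t n - c"] n2_nonneg[of "s n + t n - (b + c)"] 
        convD(1,2)[OF s] convD(1,2)[OF t] by (simp add: algebra_simps)
    show "(\<lambda>n. n2 (s n - b) + n2 (t n - c)) \<longlonglongrightarrow> 0"
      using tendsto_add[OF convD(4)[OF s] convD(4)[OF t]] by simp
  qed
  ultimately show ?thesis
    using convD(1,2)[OF s] convD(1,2)[OF t] by (auto simp: conv_def)
qed

lemma conv_mult:
  assumes s: "conv s b" and t: "conv t c"
  shows "conv (\<lambda>n. s n o\<^sub>L t n) (b o\<^sub>L c)"
proof -
  obtain C C' where C: "\<And>n. norm (s n) \<le> C" "\<And>n. norm (t n) \<le> C'"
    using convD(3)[OF s] convD(3)[OF t] by blast
  have M: "s n \<in> M" "t n \<in> M" "b \<in> M" "c \<in> M" for n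
    using convD(1,2)[OF s] convD(1,2)[OF t] by auto
  have "norm (s n o\<^sub>L t n) \<le> C * C'" for n
    using C by (intro order_trans[OF norm_blinfun_compose] mult_mono order_trans[OF norm_ge_zero]) auto
  moreover have "(\<lambda>n. n2 ((s n o\<^sub>L t n) - (b o\<^sub>L c))) \<longlonglongrightarrow> 0"
  proof (rule Lim_null_comparison[OF always_eventually[OF allI]])
    show "norm (n2 ((s n o\<^sub>L t n) - (b o\<^sub>L c))) \<le> n2 (s n - b) * norm c + C * n2 (t n - c)" for n
    proof -
      have "(s n o\<^sub>L t n) - (b o\<^sub>L c) = ((s n - b) o\<^sub>L c) + (s n o\<^sub>L (t n - c))"
        by (simp add: compose_diff)
      then have "n2 ((s n o\<^sub>L t n) - (b o\<^sub>L c)) \<le> n2 ((s n - b) o\<^sub>L c) + n2 (s n o\<^sub>L (t n - c))"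
        using n2_triangle[of "(s n - b) o\<^sub>L c" "s n o\<^sub>L (t n - c)"] M by simp
      also have "\<dots> \<le> n2 (s n - b) * norm c + norm (s n) * n2 (t n - c)"
        using M by (intro add_mono n2_comp_left n2_comp_right) auto
      also have "\<dots> \<le> n2 (s n - b) * norm c + C * n2 (t n - c)"
        using M C by (intro add_left_mono mult_right_mono) auto
      finally show ?thesis using M by simp
    qed
    show "(\<lambda>n. n2 (s n - b) * norm c + C * n2 (t n - c)) \<longlonglongrightarrow> 0"
      using tendsto_add[OF tendsto_mult_left_zero[OF convD(4)[OF s], of "norm c"] 
          tendsto_mult_right_zero[OF convD(4)[OF t], of C]] by simp
  qed
  ultimately show ?thesis using M by (auto simp: conv_def)
qed

lemma conv_tau: assumes "conv s b" shows "(\<lambda>n. \<tau> (s n)) \<longlonglongrightarrow> \<tau> b"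
proof (rule LIM_zero_cancel, rule Lim_null_comparison[OF always_eventually[OF allI] convD(4)[OF assms]])
  show "norm (\<tau> (s n) - \<tau> b) \<le> n2 (s n - b)" for n
    using tau_le_n2[of "s n - b"] convD(1,2)[OF assms] by (simp add: tau_diff)
qed

lemma conv_scalar:
  assumes "a \<longlonglongrightarrow> (0::complex)"
  shows "conv (\<lambda>n. scaleC_op (a n) id_blinfun) 0"
proof -
  obtain C where C: "\<And>n. norm (a n) \<le> C"
    using convergent_imp_Bseq[OF convergentI[OF assms]] by (auto simp: Bseq_def)
  have bound: "norm (scaleC_op (a n) (id_blinfun :: 'h oper)) \<le> C * norm (id_blinfun :: 'h oper)" for n
    by (rule order_trans[OF norm_scaleC_op]) (intro mult_right_mono C norm_ge_zero)
  have lim: "(\<lambda>n. n2 (scaleC_op (a n) id_blinfun - 0)) \<longlonglongrightarrow> 0"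
    using tendsto_norm_zero[OF assms] by (simp add: n2_scaleC n2_id)
  show ?thesis
    unfolding conv_def
    by (intro conjI allI exI[of _ "C * norm (id_blinfun :: 'h oper)"] lim bound) auto
qed

lemma l2cl_mono:
  assumes "A \<subseteq> M"
  shows "A \<subseteq> l2cl A"
proof
  fix a assume a: "a \<in> A"
  then have "conv (\<lambda>_. a) a" using assms by (intro conv_const) auto
  with a show "a \<in> l2cl A" unfolding l2cl_def by auto
qed

lemma subalg_l2cl:
  assumes A: "subalg A" shows "subalg (l2cl A)"
  unfolding subalg_def
proof (intro conjI ballI allI)
  show "l2cl A \<subseteq> M" using convD(2) by (auto simp: l2cl_def)
  show "id_blinfun \<in> l2cl A"
    using l2cl_mono[of A] subalgD(1,2)[OF A] by blast
  fix a assume "a \<in> l2cl A"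
  then obtain s where s: "conv s a" "\<And>n. s n \<in> A" by (auto simp: l2cl_def)
  {
    fix b assume "b \<in> l2cl A"
    then obtain t where t: "conv t b" "\<And>n. t n \<in> A" by (auto simp: l2cl_def)
    show "a + b \<in> l2cl A" "(a o\<^sub>L b) \<in> l2cl A"
      unfolding l2cl_def using conv_add[OF s(1) t(1)] conv_mult[OF s(1) t(1)] s(2) t(2) subalgD(3,4)[OF A]
      by blast+
  }
  fix c
  have "conv (\<lambda>n. scaleC_op c id_blinfun o\<^sub>L s n) (scaleC_op c id_blinfun o\<^sub>L a)"
    by (intro conv_mult conv_const s) auto
  then show "scaleC_op c a \<in> l2cl A"
    unfolding l2cl_def using s(2) subalgD(5)[OF A] by (auto simp: scaleC_op_compose_left)
qed

text \<open>Each letter is approximated inside its own algebra, so alternation survives, and the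
  trace is continuous for this convergence.\<close>

lemma free_l2cl:
  assumes free: "free_subalgebras \<tau> \<A>" and A: "\<And>i. subalg (\<A> i)"
  shows "free_subalgebras \<tau> (\<lambda>i. l2cl (\<A> i))"
proof -
  have approx: "\<exists>S. conv (\<lambda>n. op_prod (map snd (S n))) (op_prod (map snd w)) \<and>
      (\<forall>n. map fst (S n) = map fst w \<and> (\<forall>(i, a)\<in>set (S n). a \<in> \<A> i \<and> \<tau> a = 0))"
    if "\<forall>(i, b)\<in>set w. b \<in> l2cl (\<A> i) \<and> \<tau> b = 0" for w
    using that
  proof (induction w)
    case Nil
    show ?case by (intro exI[of _ "\<lambda>_. []"]) (simp add: conv_const)
  next
    case (Cons ib w)
    obtain i b where ib: "ib = (i, b)" by (cases ib)
    from Cons obtain S where S: "conv (\<lambda>n. op_prod (map snd (S n))) (op_prod (map snd w))"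
      "\<And>n. map fst (S n) = map fst w" "\<And>n. \<forall>(i, a)\<in>set (S n). a \<in> \<A> i \<and> \<tau> a = 0" by auto
    from Cons.prems ib obtain s where s: "conv s b" "\<And>n. s n \<in> \<A> i" and b: "\<tau> b = 0"
      by (auto simp: l2cl_def)
    \<comment> \<open>The approximants are recentred by scalars, which tend to 0 because
      \<open>\<tau> b = 0\<close>.\<close>
    define s' where "s' n = s n + scaleC_op (- \<tau> (s n)) id_blinfun" for n
    have "(\<lambda>n. - \<tau> (s n)) \<longlonglongrightarrow> 0"
      using tendsto_minus[OF conv_tau[OF s(1)]] b by simp
    from conv_add[OF s(1) conv_scalar[OF this]] have s': "conv s' b"
      by (simp add: s'_def[abs_def])
    have "s' n \<in> \<A> i \<and> \<tau> (s' n) = 0" for n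
      using s(2)[of n] subalgD[OF A[of i]] by (auto simp: s'_def tau_add tau_scaleC)
    then show ?case
      using conv_mult[OF s' S(1)] S(2,3) ib by (intro exI[of _ "\<lambda>n. (i, s' n) # S n"]) auto
  qed
  show ?thesis
    unfolding free_subalgebras_def
  proof (intro allI impI)
    fix w assume w: "w \<noteq> [] \<and> distinct_adj (map fst w) \<and> (\<forall>(i, a)\<in>set w. a \<in> l2cl (\<A> i) \<and> \<tau> a = 0)"
    have "\<forall>(i, b)\<in>set w. b \<in> l2cl (\<A> i) \<and> \<tau> b = 0" using w by blast
    from approx[OF this] obtain S where S: "conv (\<lambda>n. op_prod (map snd (S n))) (op_prod (map snd w))"
      "\<And>n. map fst (S n) = map fst w" "\<And>n. \<forall>(i, a)\<in>set (S n). a \<in> \<A> i \<and> \<tau> a = 0"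
      by blast
    have ne: "S n \<noteq> []" for n
      using w S(2)[of n] by auto
    have "\<tau> (op_prod (map snd (S n))) = 0" for n
      using ne[of n] free[unfolded free_subalgebras_def, rule_format, of "S n"] w S(2,3)[of n] by auto
    with conv_tau[OF S(1)] show "\<tau> (op_prod (map snd w)) = 0"
      by (simp add: LIMSEQ_const_iff)
  qed
qed

end

context uniform_spectral
begin

definition H :: "'a oper set" where "H = star_subalgebra hull {D0}"

lemma subalg_H: "subalg H" and D0_H: "D0 \<in> H"
  using subalg_hull[of "{D0}"] D0_M by (auto simp: H_def hull_inc)

lemma calc_poly:
  "real_polynomial_function p \<Longrightarrow> \<exists>A\<in>H. calc (\<lambda>t. complex_of_real (p (cl t))) A"
proof (induction rule: real_polynomial_function.induct)
  case (linear f)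
  have "f x = f 1 * x" for x
    using linear_scale[OF bounded_linear.linear[OF linear], of x 1] by simp
  then have "(\<lambda>t. complex_of_real (f (cl t))) = (\<lambda>t. complex_of_real (f 1) * complex_of_real (cl t))"
    by (metis of_real_mult)
  then show ?case
    using calc_scale[OF calc_D0, of "complex_of_real (f 1)"] subalgD(5)[OF subalg_H D0_H] by auto
next
  case (const c)
  then show ?case
    using calc_scale[OF calc_id, of "complex_of_real c"] subalgD(5)[OF subalg_H subalgD(2)[OF subalg_H]] by auto
next
  case (add f g)
  then obtain A B where "A \<in> H" "calc (\<lambda>t. complex_of_real (f (cl t))) A"
    "B \<in> H" "calc (\<lambda>t. complex_of_real (g (cl t))) B" by blast
  then show ?case
    using calc_add subalgD(3)[OF subalg_H] by (intro bexI[of _ "A + B"]) (auto dest: calc_add)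
next
  case (mult f g)
  then obtain A B where "A \<in> H" "calc (\<lambda>t. complex_of_real (f (cl t))) A"
    "B \<in> H" "calc (\<lambda>t. complex_of_real (g (cl t))) B" by blast
  then show ?case
    using subalgD(4)[OF subalg_H] by (intro bexI[of _ "A o\<^sub>L B"]) (auto dest: calc_mult)
qed

lemma n2_calc: assumes "calc f A" shows "(n2 A)\<^sup>2 = (\<integral>t. (cmod (f t))\<^sup>2 \<partial>uniform01)"
proof -
  have "complex_of_real ((n2 A)\<^sup>2) = (\<integral>t. cnj (f t) * f t \<partial>uniform01)"
    using n2_sq[OF calcD(3)[OF assms]] calc_tau[OF calc_mult[OF calc_adj[OF assms] assms]] by simp
  also have "(\<lambda>t. cnj (f t) * f t) = (\<lambda>t. complex_of_real ((cmod (f t))\<^sup>2))"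
    by (simp only: complex_norm_square mult.commute)
  finally show ?thesis by (simp only: integral_complex_of_real of_real_eq_iff)
qed

text \<open>A Borel function is almost everywhere a limit of continuous ones. These are cut off at
  \<open>C\<close> and then approximated uniformly by polynomials on the range of
  \<open>cl\<close>.\<close>

lemma real_poly_approx:
  fixes f :: "real \<Rightarrow> real"
  assumes f: "f \<in> borel_measurable borel" and C: "\<And>t. \<bar>f t\<bar> \<le> C"
  obtains p where "\<And>n. real_polynomial_function (p n)" "\<And>n t. \<bar>p n (cl t)\<bar> \<le> C + 1"
    "AE t in uniform01. (\<lambda>n. p n (cl t)) \<longlonglongrightarrow> f t"
proof -
  have "f measurable_on UNIV"
    using f by (intro lebesgue_measurable_imp_measurable_on) (auto intro: measurable_completion)
  then obtain N g where N: "negligible N" and g: "\<And>n. continuous_on UNIV (g n)"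
    "\<And>t. t \<notin> N \<Longrightarrow> (\<lambda>n. g n t) \<longlonglongrightarrow> f t"
    by (auto simp: measurable_on_def)
  define k where "k n t = max (- C) (min C (g n t))" for n :: nat and t
  have k: "\<bar>k n t\<bar> \<le> C" for n t
    using order_trans[OF abs_ge_zero C[of t]] by (auto simp: k_def)
  have "\<exists>p. real_polynomial_function p \<and> (\<forall>t\<in>{-R..R}. \<bar>k n t - p t\<bar> < 1 / Suc n)" for n
  proof (rule Stone_Weierstrass_real_polynomial_function[of "{-R..R}" "k n" "1 / Suc n"])
    show "continuous_on {-R..R} (k n)"
      unfolding k_def by (intro continuous_intros continuous_on_subset[OF g(1)]) auto
  qed auto
  then obtain p where p: "\<And>n. real_polynomial_function (p n)" "\<And>n t. t \<in> {-R..R} \<Longrightarrow> \<bar>k n t - p n t\<bar> < 1 / Suc n"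
    by metis
  have cl: "cl t \<in> {-R..R}" for t using cl_bound[of t] by auto
  have one: "1 / real (Suc n) \<le> 1" for n by simp
  show ?thesis
  proof (rule that[OF p(1)])
    show "\<bar>p n (cl t)\<bar> \<le> C + 1" for n t
      using p(2)[OF cl, of n t] k[of n "cl t"] one[of n] by linarith
    have "AE t in lebesgue. t \<notin> N"
      using N by (intro AE_not_in) (simp only: negligible_iff_null_sets)
    then have "AE t in lborel. t \<notin> N"
      by (simp only: AE_completion_iff)
    then have "AE t in uniform01. t \<notin> N"
      by (intro AE_uniform_measureI) auto
    then show "AE t in uniform01. (\<lambda>n. p n (cl t)) \<longlonglongrightarrow> f t"
      using AE_uniform01
    proof eventually_elim
      case (elim t)
      have ct: "cl t = t" using elim by (intro cl_id) (auto simp: R_def)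
      have "(\<lambda>n. max (- C) (min C (g n t))) \<longlonglongrightarrow> max (- C) (min C (f t))"
        by (intro tendsto_intros g(2) elim)
      then have kt: "(\<lambda>n. k n t) \<longlonglongrightarrow> f t"
        using C[of t] by (simp add: k_def)
      have "(\<lambda>n. k n t - p n t) \<longlonglongrightarrow> 0"
      proof (rule Lim_null_comparison[OF always_eventually[OF allI]])
        show "norm (k n t - p n t) \<le> 1 / Suc n" for n
          using p(2)[OF cl, of n t] ct by simp
        show "(\<lambda>n. 1 / real (Suc n)) \<longlonglongrightarrow> 0"
          using LIMSEQ_inverse_real_of_nat by (simp add: divide_inverse)
      qed
      from tendsto_diff[OF kt this] show ?case by (simp add: ct)
    qed
  qed
qed

text \<open>The 2-norm of an operator in the calculus is the \<open>L\<^sup>2\<close> norm of its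
  function, so dominated convergence turns the almost everywhere approximation by bounded
  polynomials into \<open>conv\<close>.\<close>

lemma calc_l2cl:
  assumes f: "calc f A"
  shows "A \<in> l2cl H"
proof -
  obtain C where C: "\<And>t. cmod (f t) \<le> C" using calcD(2)[OF f] by (auto simp: bounded_iff)
  have re: "\<bar>Re (f t)\<bar> \<le> C" "\<bar>Im (f t)\<bar> \<le> C" for t
    using order_trans[OF abs_Re_le_cmod C] order_trans[OF abs_Im_le_cmod C] by auto
  have meas: "(\<lambda>t. Re (f t)) \<in> borel_measurable borel" "(\<lambda>t. Im (f t)) \<in> borel_measurable borel"
    using calcD(1)[OF f] by auto
  obtain p where p: "\<And>n. real_polynomial_function (p n)" "\<And>n t. \<bar>p n (cl t)\<bar> \<le> C + 1"
    "AE t in uniform01. (\<lambda>n. p n (cl t)) \<longlonglongrightarrow> Re (f t)"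
    using real_poly_approx[OF meas(1) re(1)] by blast
  obtain q where q: "\<And>n. real_polynomial_function (q n)" "\<And>n t. \<bar>q n (cl t)\<bar> \<le> C + 1"
    "AE t in uniform01. (\<lambda>n. q n (cl t)) \<longlonglongrightarrow> Im (f t)"
    using real_poly_approx[OF meas(2) re(2)] by blast
  obtain P where P: "\<And>n. P n \<in> H" "\<And>n. calc (\<lambda>t. complex_of_real (p n (cl t))) (P n)"
    using calc_poly[OF p(1)] by metis
  obtain Q where Q: "\<And>n. Q n \<in> H" "\<And>n. calc (\<lambda>t. complex_of_real (q n (cl t))) (Q n)"
    using calc_poly[OF q(1)] by metis
  define s where "s n = P n + scaleC_op \<i> (Q n)" for n
  define h where "h n t = complex_of_real (p n (cl t)) + \<i> * complex_of_real (q n (cl t))" for n t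
  have calc_s: "calc (h n) (s n)" for n
    using calc_add[OF P(2) calc_scale[OF Q(2)]] by (simp add: s_def h_def[abs_def])
  have hb: "cmod (h n t) \<le> 2 * (C + 1)" for n t
    using norm_triangle_ineq[of "complex_of_real (p n (cl t))" "\<i> * complex_of_real (q n (cl t))"]
      p(2)[of n t] q(2)[of n t] by (simp add: h_def norm_mult)
  have "(\<lambda>n. \<integral>t. (cmod (h n t - f t))\<^sup>2 \<partial>uniform01) \<longlonglongrightarrow> (\<integral>t. 0 \<partial>uniform01)"
  proof (rule integral_dominated_convergence[where w = "\<lambda>_. (2 * (C + 1) + C)\<^sup>2"])
    interpret u: prob_space uniform01 using real_distribution_uniform01 by (simp add: real_distribution_def)
    show "integrable uniform01 (\<lambda>_. (2 * (C + 1) + C)\<^sup>2)" by simp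
    show "(\<lambda>t. (cmod (h n t - f t))\<^sup>2) \<in> borel_measurable uniform01" for n
      using calcD(1)[OF calc_s] calcD(1)[OF f] by measurable
    show "AE t in uniform01. (\<lambda>n. (cmod (h n t - f t))\<^sup>2) \<longlonglongrightarrow> 0"
      using p(3) q(3)
    proof eventually_elim
      case (elim t)
      have "(\<lambda>n. h n t) \<longlonglongrightarrow> complex_of_real (Re (f t)) + \<i> * complex_of_real (Im (f t))"
        unfolding h_def by (intro tendsto_intros elim)
      then have "(\<lambda>n. h n t) \<longlonglongrightarrow> f t" by (simp add: complex_eq[symmetric])
      then have "(\<lambda>n. (cmod (h n t - f t))\<^sup>2) \<longlonglongrightarrow> (cmod (f t - f t))\<^sup>2"
        by (intro tendsto_intros)
      then show ?case by simp
    qed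
    show "AE t in uniform01. norm ((cmod (h n t - f t))\<^sup>2) \<le> (2 * (C + 1) + C)\<^sup>2" for n
    proof (rule AE_I2)
      fix t
      have "cmod (h n t - f t) \<le> 2 * (C + 1) + C"
        using norm_triangle_ineq4[of "h n t" "f t"] hb[of n t] C[of t] by linarith
      then show "norm ((cmod (h n t - f t))\<^sup>2) \<le> (2 * (C + 1) + C)\<^sup>2"
        by (simp add: power_mono)
    qed
  qed auto
  then have "(\<lambda>n. (n2 (s n - A))\<^sup>2) \<longlonglongrightarrow> 0"
    using n2_calc[OF calc_diff[OF calc_s f]] by simp
  then have "(\<lambda>n. sqrt ((n2 (s n - A))\<^sup>2)) \<longlonglongrightarrow> 0"
    using tendsto_real_sqrt by fastforce
  then have "(\<lambda>n. n2 (s n - A)) \<longlonglongrightarrow> 0"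
    using calcD(3)[OF calc_s] calcD(3)[OF f] by simp
  moreover have "norm (s n) \<le> 2 * (2 * (C + 1))" for n
    by (rule calc_norm[OF calc_s hb])
  ultimately have "conv s A"
    using calcD(3)[OF calc_s] calcD(3)[OF f] by (auto simp: conv_def)
  moreover have "s n \<in> H" for n
    using P(1) Q(1) subalgD[OF subalg_H] by (simp add: s_def)
  ultimately show ?thesis by (auto simp: l2cl_def)
qed

lemma calc_unique: assumes "calc f A" "calc f B" shows "A = B"
proof -
  have "norm (A - B) \<le> 2 * 0"
    using calc_diff[OF assms] by (rule calc_norm) simp
  then show ?thesis by simp
qed

lemma calc_commute: assumes "calc f A" "calc g B" shows "(A o\<^sub>L B) = (B o\<^sub>L A)"
  using calc_unique[OF calc_mult[OF assms]] calc_mult[OF assms(2,1)] by (simp add: mult.commute)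

end

section \<open>Moments of the triangular approximants\<close>

lemma (in tracial) dpair_sum:
  assumes "id_blinfun \<in> G" "\<And>i. i \<in> I \<Longrightarrow> dpair G y (a i) (F i)"
  shows "dpair G y (\<Sum>i\<in>I. a i) (\<lambda>u v. \<Sum>i\<in>I. F i u v)"
proof -
  have z: "dpair G y 0 (\<lambda>u v. 0)"
    using dpair.scale[OF dpair.const[OF assms(1)], of y 0] by simp
  show ?thesis
    using assms(2) by (induction I rule: infinite_finite_induct) (auto intro: z dpair.add)
qed

locale dt_model = uniform_spectral +
  fixes X :: "'a oper"
  assumes X: "semicircular M \<tau> X" and free: "star_free \<tau> D0 X"
begin

lemma X_M: "X \<in> M" and adj_X: "adj X = X"
  using X by (auto simp: semicircular_def selfadj_def adj_eqI)

definition B :: "'a oper set" where "B = l2cl H"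

lemma calc_B: "calc f A \<Longrightarrow> A \<in> B"
  unfolding B_def by (rule calc_l2cl)

lemma subalg_B: "subalg B"
  unfolding B_def by (rule subalg_l2cl[OF subalg_H])

text \<open>The whole diagonal algebra consists of constants for the derivation of \<open>X\<close>;
  freeness from \<open>D0\<close> is first extended to the closure \<open>B\<close>.\<close>

lemma SD_B: "SD X X B"
proof -
  let ?A = "\<lambda>i. l2cl (star_subalgebra hull {if i then X else D0})"
  have sub: "subalg (star_subalgebra hull {if i then X else D0})" for i
    using subalg_hull[of "{if i then X else D0}"] X_M D0_M by auto
  have "X \<in> star_subalgebra hull {X}" by (simp add: hull_inc)
  moreover have "star_subalgebra hull {X} \<subseteq> M"
    using star_subalgebra_hull(2)[OF star_M] X_M by simp
  ultimately have XA: "X \<in> ?A True" using l2cl_mono by auto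
  have freeA: "free_subalgebras \<tau> ?A"
    by (rule free_l2cl[OF _ sub]) (use free in \<open>simp add: star_free_def\<close>)
  interpret p: free_pair M \<tau> ?A X X "{id_blinfun}"
  proof unfold_locales
    show "subalg (?A i)" for i by (rule subalg_l2cl[OF sub])
    show "{id_blinfun} \<subseteq> ?A True" using subalgD(2)[OF subalg_l2cl[OF sub[of True]]] by simp
  qed (use freeA XA SD_semicircular[OF X] in auto)
  have "SD X X ({id_blinfun} \<union> B)"
    using p.SD_join by (simp add: B_def H_def)
  then show ?thesis
    using subalgD(2)[OF subalg_B] by (simp add: insert_absorb)
qed

text \<open>The uniform distribution has no atoms, so the common endpoints of the closed dyadic
  intervals carry no mass.\<close>

lemma E_point: "S \<in> sets borel \<Longrightarrow> S \<subseteq> {s} \<Longrightarrow> E S = 0"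
proof (rule E_null)
  assume S: "S \<in> sets borel" "S \<subseteq> {s}"
  have "emeasure lborel ({0..1} \<inter> S) \<le> emeasure lborel {s}"
    using S by (intro emeasure_mono) auto
  then show "emeasure uniform01 S = 0" using S by simp
qed

end

section \<open>Dyadic approximants at a fixed level\<close>

locale dt_level = dt_model +
  fixes N :: nat and f :: "real \<Rightarrow> complex" and D :: "'a oper" and c :: real
  assumes D: "calc f D"
begin

definition p :: "nat \<Rightarrow> 'a oper" where "p j = E {(real j - 1) / 2 ^ N .. real j / 2 ^ N}"
definition q :: "nat \<Rightarrow> 'a oper" where "q j = E {real j / 2 ^ N .. 1}"
definition T' :: "'a oper" where "T' = (\<Sum>j = 1..2 ^ N. (p j o\<^sub>L X) o\<^sub>L q j)"
definition Z :: "'a oper" where "Z = D + c *\<^sub>R T'"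

lemma T'_eq: "T' = T_approx E X N"
  by (simp add: T'_def T_approx_def p_def q_def)

lemma pq_calc: "calc (indicator {(real j - 1) / 2 ^ N .. real j / 2 ^ N}) (p j)"
    "calc (indicator {real j / 2 ^ N .. 1}) (q j)"
  by (simp_all add: p_def q_def calc_indicator)

lemma pq_M [simp, intro]: "p j \<in> M" "q j \<in> M"
  using pq_calc calcD(3) by blast+

lemma D_M [simp, intro]: "D \<in> M"
  using calcD(3)[OF D] .

lemma pq_adj: "adj (p j) = p j" "adj (q j) = q j"
  by (simp_all add: p_def q_def E_selfadj adj_eqI)

lemma qq: "(q j o\<^sub>L q j) = q j"
  by (simp add: q_def E_Int)

lemma pp: "(p j o\<^sub>L p j) = p j"
  by (simp add: p_def E_Int)

lemma pq_zero: "j' \<le> j \<Longrightarrow> (p j' o\<^sub>L q j) = 0" and qp_zero: "j' \<le> j \<Longrightarrow> (q j o\<^sub>L p j') = 0"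
proof -
  assume "j' \<le> j"
  then have "real j' / 2 ^ N \<le> real j / 2 ^ N" by (intro divide_right_mono) auto
  then have "{(real j' - 1) / 2 ^ N .. real j' / 2 ^ N} \<inter> {real j / 2 ^ N .. 1} \<subseteq> {real j / 2 ^ N}"
    by auto
  then have "E ({(real j' - 1) / 2 ^ N .. real j' / 2 ^ N} \<inter> {real j / 2 ^ N .. 1}) = 0"
    by (intro E_point) auto
  then show "(p j' o\<^sub>L q j) = 0" "(q j o\<^sub>L p j') = 0"
    unfolding p_def q_def by (simp_all add: E_Int Int_commute)
qed

lemma pp_zero: assumes "j \<noteq> j'" shows "(p j o\<^sub>L p j') = 0"
proof -
  have *: "E ({(real i - 1) / 2 ^ N .. real i / 2 ^ N} \<inter> {(real k - 1) / 2 ^ N .. real k / 2 ^ N}) = 0"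
    if "i < k" for i k
  proof -
    have "real i \<le> real k - 1" using that by linarith
    then have "real i / 2 ^ N \<le> (real k - 1) / 2 ^ N" by (intro divide_right_mono) auto
    then show ?thesis by (intro E_point[of _ "real i / 2 ^ N"]) auto
  qed
  show ?thesis
    using *[of j j'] *[of j' j] assms unfolding p_def
    by (cases "j < j'") (simp_all add: E_Int Int_commute)
qed

lemma T'_M [simp, intro]: "T' \<in> M"
  unfolding T'_def using X_M by (intro M_sum) auto

lemma Z_M [simp, intro]: "Z \<in> M"
  unfolding Z_def by auto

lemma adj_T': "adj T' = (\<Sum>j = 1..2 ^ N. (q j o\<^sub>L X) o\<^sub>L p j)"
proof (rule adj_eqI)
  have "is_adjoint ((p j o\<^sub>L X) o\<^sub>L q j) (q j o\<^sub>L (X o\<^sub>L p j))" for j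
    using adj_M(2)[of "p j"] adj_M(2)[of "q j"] adj_M(2)[of X] X_M pq_adj adj_X
    by (intro is_adjoint_compose) auto
  then show "is_adjoint T' (\<Sum>j = 1..2 ^ N. (q j o\<^sub>L X) o\<^sub>L p j)"
    unfolding T'_def by (intro is_adjoint_sum) (simp add: compose_assoc)
qed

lemma adj_Z: "adj Z = adj D + c *\<^sub>R adj T'"
  by (simp add: Z_def adj_add adj_scaleR)

lemma idB: "id_blinfun \<in> B"
  by (rule subalgD(2)[OF subalg_B])

lemma dpair_pXq: "a \<in> B \<Longrightarrow> b \<in> B \<Longrightarrow> dpair B X ((a o\<^sub>L X) o\<^sub>L b) (\<lambda>u v. \<tau> (u o\<^sub>L a) * \<tau> (b o\<^sub>L v))"
  using dpair.mult[OF dpair.mult[OF dpair.const dpair.mark] dpair.const, of a B b X] by simp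

lemma dpair_Z: "dpair B X Z (\<lambda>u v. \<Sum>j = 1..2 ^ N. c * (\<tau> (u o\<^sub>L p j) * \<tau> (q j o\<^sub>L v)))"
proof -
  have "dpair B X (D + scaleC_op c T') (\<lambda>u v. 0 + complex_of_real c * (\<Sum>j = 1..2 ^ N. \<tau> (u o\<^sub>L p j) * \<tau> (q j o\<^sub>L v)))"
    unfolding T'_def using calc_B[OF D] calc_B[OF pq_calc(1)] calc_B[OF pq_calc(2)] idB
    by (intro dpair.add dpair.const dpair.scale dpair_sum dpair_pXq)
  then show ?thesis
    by (simp add: Z_def scaleC_op_of_real sum_distrib_left)
qed

lemma dpair_Zs: "dpair B X (adj Z) (\<lambda>u v. \<Sum>j = 1..2 ^ N. c * (\<tau> (u o\<^sub>L q j) * \<tau> (p j o\<^sub>L v)))"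
proof -
  have "dpair B X (adj D + scaleC_op c (adj T')) (\<lambda>u v. 0 + complex_of_real c * (\<Sum>j = 1..2 ^ N. \<tau> (u o\<^sub>L q j) * \<tau> (p j o\<^sub>L v)))"
    unfolding adj_T' using calc_B[OF calc_adj[OF D]] calc_B[OF pq_calc(1)] calc_B[OF pq_calc(2)] idB
    by (intro dpair.add dpair.const dpair.scale dpair_sum dpair_pXq)
  then show ?thesis
    by (simp add: adj_Z scaleC_op_of_real sum_distrib_left)
qed

lemma tau_null_left: "a \<in> M \<Longrightarrow> b \<in> M \<Longrightarrow> w \<in> M \<Longrightarrow> (b o\<^sub>L a) = 0 \<Longrightarrow> \<tau> (a o\<^sub>L (w o\<^sub>L b)) = 0"
  using tau_comm[of "a o\<^sub>L w" b] by (simp add: compose_assoc flip: compose_assoc[of b])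

text \<open>In the Schwinger-Dyson sum all terms vanish except those pairing the two \<open>X\<close> between the same
  projections: \<open>Z\<close> is upper triangular with respect to the \<open>p j\<close>.\<close>

lemma diag_Zs:
  "calc \<delta> d \<Longrightarrow> \<tau> (d o\<^sub>L op_power (adj Z) n) = \<tau> (d o\<^sub>L op_power (adj D) n)"
proof (induction n arbitrary: \<delta> d)
  case (Suc n)
  have dM: "d \<in> M" using calcD(3)[OF Suc.prems] .
  let ?Zs = "adj Z"
  have zero: "\<tau> (d o\<^sub>L (((q j o\<^sub>L X) o\<^sub>L p j) o\<^sub>L op_power ?Zs n)) = 0" for j
  proof -
    have dq: "(d o\<^sub>L q j) \<in> B" using subalgD(4)[OF subalg_B calc_B[OF Suc.prems] calc_B[OF pq_calc(2)]] .
    have "\<tau> (d o\<^sub>L (((q j o\<^sub>L X) o\<^sub>L p j) o\<^sub>L op_power ?Zs n)) =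
        \<tau> (X o\<^sub>L (p j o\<^sub>L (op_power ?Zs n o\<^sub>L (d o\<^sub>L q j))))"
      using tau_comm[of "d o\<^sub>L q j" "X o\<^sub>L (p j o\<^sub>L op_power ?Zs n)"] dM X_M by (simp add: compose_assoc)
    also have "\<dots> = (\<Sum>i<n. \<Sum>j' = 1..2 ^ N. c * (\<tau> (p j o\<^sub>L (op_power ?Zs i o\<^sub>L q j')) *
        \<tau> (p j' o\<^sub>L (op_power ?Zs (n - 1 - i) o\<^sub>L (d o\<^sub>L q j)))))"
      using SD_B[unfolded SD_def, rule_format, OF dpair.mult[OF dpair.const[OF calc_B[OF pq_calc(1)]] 
          dpair.mult[OF dpair_power[OF idB dpair_Zs] dpair.const[OF dq]], of j n]]
      by (simp add: compose_assoc)
    also have "\<dots> = 0"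
    proof (intro sum.neutral ballI)
      fix i j' assume "j' \<in> {1..(2::nat) ^ N}"
      show "c * (\<tau> (p j o\<^sub>L (op_power ?Zs i o\<^sub>L q j')) *
        \<tau> (p j' o\<^sub>L (op_power ?Zs (n - 1 - i) o\<^sub>L (d o\<^sub>L q j)))) = 0"
      \<comment> \<open>One of the two traces vanishes after a cyclic rotation: \<open>q j'\<close>
        kills \<open>p j\<close> if \<open>j \<le> j'\<close>, and \<open>q j\<close> kills
        \<open>p j'\<close> otherwise.\<close>
      proof (cases "j \<le> j'")
        case True
        then show ?thesis using tau_null_left[of "p j" "q j'" "op_power ?Zs i"] qp_zero by simp
      next
        case False
        have "\<tau> (p j' o\<^sub>L ((op_power ?Zs (n - 1 - i) o\<^sub>L d) o\<^sub>L q j)) = 0"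
          using False dM by (intro tau_null_left qp_zero) auto
        then show ?thesis by (simp add: compose_assoc)
      qed
    qed
    finally show ?thesis .
  qed
  have "\<tau> (d o\<^sub>L op_power ?Zs (Suc n)) = \<tau> ((d o\<^sub>L adj D) o\<^sub>L op_power ?Zs n) +
      c * (\<Sum>j = 1..2 ^ N. \<tau> (d o\<^sub>L (((q j o\<^sub>L X) o\<^sub>L p j) o\<^sub>L op_power ?Zs n)))"
    using dM X_M
    by (simp add: adj_Z adj_T' compose_add compose_scaleR compose_sum tau_add tau_scaleR tau_sum M_sum compose_assoc)
  also have "\<dots> = \<tau> ((d o\<^sub>L adj D) o\<^sub>L op_power ?Zs n)"
    by (simp add: zero)
  also have "\<dots> = \<tau> ((d o\<^sub>L adj D) o\<^sub>L op_power (adj D) n)"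
    by (rule Suc.IH[OF calc_mult[OF Suc.prems calc_adj[OF D]]])
  finally show ?case by (simp add: compose_assoc)
qed simp

text \<open>The first \<open>Z\<close> is split as \<open>D + c T'\<close> and its \<open>X\<close>
  is paired. Pairings with another \<open>Z\<close> vanish by triangularity. A pairing with an
  \<open>adj Z\<close> survives only within the same cell \<open>j\<close>; it leaves a power of
  \<open>adj Z\<close> traced against a diagonal operator, where \<open>diag_Zs\<close> replaces
  \<open>adj Z\<close> by \<open>adj D\<close>.\<close>

lemma level_recursion:
  assumes d: "calc \<delta> d"
  shows "\<tau> (d o\<^sub>L (op_power Z (Suc k) o\<^sub>L op_power (adj Z) l)) =
    \<tau> ((d o\<^sub>L D) o\<^sub>L (op_power Z k o\<^sub>L op_power (adj Z) l)) +
    complex_of_real c ^ 2 * (\<Sum>i<l. \<Sum>j = 1..2 ^ N. \<tau> (q j o\<^sub>L (op_power Z k o\<^sub>L op_power (adj Z) i)) *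
       \<tau> (p j o\<^sub>L (d o\<^sub>L op_power (adj D) (l - 1 - i))))"
proof -
  let ?Zs = "adj Z"
  have dM: "d \<in> M" using calcD(3)[OF d] .
  have trm: "\<tau> (d o\<^sub>L (((p j o\<^sub>L X) o\<^sub>L q j) o\<^sub>L (op_power Z k o\<^sub>L op_power ?Zs l))) =
      c * (\<Sum>i<l. \<tau> (q j o\<^sub>L (op_power Z k o\<^sub>L op_power ?Zs i)) * \<tau> (p j o\<^sub>L (d o\<^sub>L op_power (adj D) (l - 1 - i))))"
    if j: "j \<in> {1..2 ^ N}" for j
  proof -
    have dp: "(d o\<^sub>L p j) \<in> B" using subalgD(4)[OF subalg_B calc_B[OF d] calc_B[OF pq_calc(1)]] .
    have "\<tau> (d o\<^sub>L (((p j o\<^sub>L X) o\<^sub>L q j) o\<^sub>L (op_power Z k o\<^sub>L op_power ?Zs l))) =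
        \<tau> (X o\<^sub>L (q j o\<^sub>L (op_power Z k o\<^sub>L (op_power ?Zs l o\<^sub>L (d o\<^sub>L p j)))))"
      using tau_comm[of "d o\<^sub>L p j" "X o\<^sub>L (q j o\<^sub>L (op_power Z k o\<^sub>L op_power ?Zs l))"] dM X_M
      by (simp add: compose_assoc)
    also have "\<dots> = (\<Sum>i<k. \<Sum>j' = 1..2 ^ N. c * (\<tau> (q j o\<^sub>L (op_power Z i o\<^sub>L p j')) *
          \<tau> (q j' o\<^sub>L (op_power Z (k - 1 - i) o\<^sub>L (op_power ?Zs l o\<^sub>L (d o\<^sub>L p j)))))) +
        (\<Sum>i<l. \<Sum>j' = 1..2 ^ N. c * (\<tau> (q j o\<^sub>L (op_power Z k o\<^sub>L (op_power ?Zs i o\<^sub>L q j'))) *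
          \<tau> (p j' o\<^sub>L (op_power ?Zs (l - 1 - i) o\<^sub>L (d o\<^sub>L p j)))))"
      using SD_B[unfolded SD_def, rule_format, OF dpair.mult[OF dpair.const[OF calc_B[OF pq_calc(2)]] 
          dpair.mult[OF dpair_power[OF idB dpair_Z] dpair.mult[OF dpair_power[OF idB dpair_Zs] dpair.const[OF dp]]], of j k l]]
      by (simp add: compose_assoc)
    also have "(\<Sum>i<k. \<Sum>j' = 1..2 ^ N. c * (\<tau> (q j o\<^sub>L (op_power Z i o\<^sub>L p j')) *
          \<tau> (q j' o\<^sub>L (op_power Z (k - 1 - i) o\<^sub>L (op_power ?Zs l o\<^sub>L (d o\<^sub>L p j)))))) = 0"
    proof (intro sum.neutral ballI)
      fix i j' assume "j' \<in> {1..(2::nat) ^ N}"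
      show "c * (\<tau> (q j o\<^sub>L (op_power Z i o\<^sub>L p j')) *
          \<tau> (q j' o\<^sub>L (op_power Z (k - 1 - i) o\<^sub>L (op_power ?Zs l o\<^sub>L (d o\<^sub>L p j))))) = 0"
      proof (cases "j' \<le> j")
        case True
        then show ?thesis using tau_null_left[of "q j" "p j'" "op_power Z i"] pq_zero by simp
      next
        case False
        have "\<tau> (q j' o\<^sub>L ((op_power Z (k - 1 - i) o\<^sub>L (op_power ?Zs l o\<^sub>L d)) o\<^sub>L p j)) = 0"
          using False dM by (intro tau_null_left pq_zero) auto
        then show ?thesis by (simp add: compose_assoc)
      qed
    qed
    also have "(\<Sum>i<l. \<Sum>j' = 1..2 ^ N. c * (\<tau> (q j o\<^sub>L (op_power Z k o\<^sub>L (op_power ?Zs i o\<^sub>L q j'))) *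
          \<tau> (p j' o\<^sub>L (op_power ?Zs (l - 1 - i) o\<^sub>L (d o\<^sub>L p j))))) =
      (\<Sum>i<l. c * (\<tau> (q j o\<^sub>L (op_power Z k o\<^sub>L op_power ?Zs i)) * \<tau> (p j o\<^sub>L (d o\<^sub>L op_power (adj D) (l - 1 - i)))))"
    proof (rule sum.cong[OF refl])
      fix i
      have "\<tau> (p j' o\<^sub>L (op_power ?Zs m o\<^sub>L (d o\<^sub>L p j))) =
        (if j' = j then \<tau> (p j o\<^sub>L (d o\<^sub>L op_power (adj D) m)) else 0)" for j' m
      proof (cases "j' = j")
        case False
        have "\<tau> (p j' o\<^sub>L ((op_power ?Zs m o\<^sub>L d) o\<^sub>L p j)) = 0"
          using False dM by (intro tau_null_left pp_zero) auto
        then show ?thesis using False by (simp add: compose_assoc)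
      next
        case True
        have "\<tau> (p j o\<^sub>L (op_power ?Zs m o\<^sub>L (d o\<^sub>L p j))) = \<tau> (((d o\<^sub>L p j) o\<^sub>L p j) o\<^sub>L op_power ?Zs m)"
          using tau_comm[of "p j o\<^sub>L op_power ?Zs m" "d o\<^sub>L p j"] dM by (simp add: compose_assoc)
        also have "((d o\<^sub>L p j) o\<^sub>L p j) = (p j o\<^sub>L d)"
          unfolding compose_assoc pp by (rule calc_commute[OF d pq_calc(1)])
        also have "\<tau> ((p j o\<^sub>L d) o\<^sub>L op_power ?Zs m) = \<tau> ((p j o\<^sub>L d) o\<^sub>L op_power (adj D) m)"
          by (rule diag_Zs[OF calc_mult[OF pq_calc(1) d]])
        finally show ?thesis using True by (simp add: compose_assoc)
      qed
      moreover have "\<tau> (q j o\<^sub>L (op_power Z k o\<^sub>L (op_power ?Zs i o\<^sub>L q j))) = \<tau> (q j o\<^sub>L (op_power Z k o\<^sub>L op_power ?Zs i))"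
        using tau_comm[of "q j o\<^sub>L (op_power Z k o\<^sub>L op_power ?Zs i)" "q j"] 
        by (simp add: compose_assoc qq flip: compose_assoc[of "q j" "q j"])
      ultimately show "(\<Sum>j' = 1..2 ^ N. c * (\<tau> (q j o\<^sub>L (op_power Z k o\<^sub>L (op_power ?Zs i o\<^sub>L q j'))) *
          \<tau> (p j' o\<^sub>L (op_power ?Zs (l - 1 - i) o\<^sub>L (d o\<^sub>L p j))))) =
        c * (\<tau> (q j o\<^sub>L (op_power Z k o\<^sub>L op_power ?Zs i)) * \<tau> (p j o\<^sub>L (d o\<^sub>L op_power (adj D) (l - 1 - i))))"
        using j by (simp add: if_distrib[of "\<lambda>x. _ * x"] sum.delta cong: if_cong)
    qed
    finally show ?thesis by (simp add: sum_distrib_left)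
  qed
  have "\<tau> (d o\<^sub>L (op_power Z (Suc k) o\<^sub>L op_power ?Zs l)) = \<tau> ((d o\<^sub>L D) o\<^sub>L (op_power Z k o\<^sub>L op_power ?Zs l)) +
      c * (\<Sum>j = 1..2 ^ N. \<tau> (d o\<^sub>L (((p j o\<^sub>L X) o\<^sub>L q j) o\<^sub>L (op_power Z k o\<^sub>L op_power ?Zs l))))"
  proof -
    have "op_power Z (Suc k) = (D o\<^sub>L op_power Z k) + c *\<^sub>R (\<Sum>j = 1..2 ^ N. ((p j o\<^sub>L X) o\<^sub>L q j) o\<^sub>L op_power Z k)"
    proof -
      have "op_power Z (Suc k) = ((D + c *\<^sub>R T') o\<^sub>L op_power Z k)" by (simp add: Z_def)
      then show ?thesis by (simp add: compose_add compose_scaleR compose_sum T'_def)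
    qed
    then show ?thesis
      using dM X_M
      by (simp add: compose_add compose_scaleR compose_sum tau_add tau_scaleR tau_sum M_sum compose_assoc
          del: op_power_simps)
  qed
  also have "(\<Sum>j = 1..2 ^ N. \<tau> (d o\<^sub>L (((p j o\<^sub>L X) o\<^sub>L q j) o\<^sub>L (op_power Z k o\<^sub>L op_power ?Zs l)))) = 
     (\<Sum>j = 1..2 ^ N. c * (\<Sum>i<l. \<tau> (q j o\<^sub>L (op_power Z k o\<^sub>L op_power ?Zs i)) * \<tau> (p j o\<^sub>L (d o\<^sub>L op_power (adj D) (l - 1 - i)))))"
    by (rule sum.cong[OF refl trm])
  also have "\<dots> = c * (\<Sum>i<l. \<Sum>j = 1..2 ^ N. \<tau> (q j o\<^sub>L (op_power Z k o\<^sub>L op_power ?Zs i)) * \<tau> (p j o\<^sub>L (d o\<^sub>L op_power (adj D) (l - 1 - i))))"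
    by (subst sum.swap) (simp add: sum_distrib_left)
  finally show ?thesis by (simp add: power2_eq_square)
qed

end

section \<open>Moments of DT-operators\<close>

definition bdd_borel :: "(real \<Rightarrow> complex) \<Rightarrow> bool" where
  "bdd_borel g \<longleftrightarrow> g \<in> borel_measurable borel \<and> bounded (range g)"

text \<open>The Volterra operator of integration from \<open>t\<close> to 1. It is the limit of
  pairing \<open>p j\<close> with \<open>q j\<close>, as \<open>q j\<close> covers what lies to the
  right of cell \<open>j\<close>.\<close>

definition Iop :: "(real \<Rightarrow> complex) \<Rightarrow> real \<Rightarrow> complex" where
  "Iop g t = (\<integral>s. (if t \<le> s \<and> s \<le> 1 then g s else 0) \<partial>uniform01)"

text \<open>\<open>gk f (c\<^sup>2) k l\<close> is the conditional expectation of \<open>Z\<^sup>k (Z\<^sup>*)\<^sup>l\<close> onto the diagonal, where \<open>Z = f(D0) + c T\<close>.\<close>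

primrec gk :: "(real \<Rightarrow> complex) \<Rightarrow> complex \<Rightarrow> nat \<Rightarrow> nat \<Rightarrow> real \<Rightarrow> complex" where
  "gk f C 0 = (\<lambda>l t. cnj (f t) ^ l)"
| "gk f C (Suc k) = (\<lambda>l t. f t * gk f C k l t + C * (\<Sum>i<l. cnj (f t) ^ (l - 1 - i) * Iop (gk f C k i) t))"

interpretation u01: prob_space uniform01
  using real_distribution_uniform01 by (simp add: real_distribution_def)

lemma bdd_borel_bound: assumes "bdd_borel g" shows "\<exists>K\<ge>0. \<forall>t. cmod (g t) \<le> K"
proof -
  obtain K where "\<And>t. cmod (g t) \<le> K" using assms by (auto simp: bdd_borel_def bounded_iff)
  then show ?thesis using order_trans[OF norm_ge_zero] by blast
qed

lemma bdd_borel_measurable: "bdd_borel g \<Longrightarrow> g \<in> borel_measurable uniform01"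
  using measurable_cong_sets[of uniform01 borel borel "borel :: complex measure"] by (simp add: bdd_borel_def)

lemma bdd_borelI: "g \<in> borel_measurable borel \<Longrightarrow> (\<And>t. cmod (g t) \<le> K) \<Longrightarrow> bdd_borel g"
  by (auto simp: bdd_borel_def bounded_iff)

lemma bdd_borel_integrable:
  assumes "bdd_borel g" shows "integrable uniform01 g"
proof -
  obtain K where "\<And>t. cmod (g t) \<le> K" using bdd_borel_bound[OF assms] by blast
  then show ?thesis
    using assms by (intro u01.integrable_const_bound[of _ K]) (auto simp: bdd_borel_def)
qed

lemma bdd_borel_const: "bdd_borel (\<lambda>_. c)"
  by (rule bdd_borelI[of _ "cmod c"]) auto

lemma bdd_borel_mult: assumes "bdd_borel f" "bdd_borel g" shows "bdd_borel (\<lambda>t. f t * g t)"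
proof -
  obtain K L where "\<And>t. cmod (f t) \<le> K" "\<And>t. cmod (g t) \<le> L" "0 \<le> K"
    using bdd_borel_bound[OF assms(1)] bdd_borel_bound[OF assms(2)] by blast
  then show ?thesis
    using assms by (intro bdd_borelI[of _ "K * L"]) (auto simp: bdd_borel_def norm_mult intro!: mult_mono)
qed

lemma bdd_borel_add: assumes "bdd_borel f" "bdd_borel g" shows "bdd_borel (\<lambda>t. f t + g t)"
  using assms bounded_plus_comp[of f UNIV g] by (auto simp: bdd_borel_def)

lemma bdd_borel_sum: "(\<And>i. i \<in> I \<Longrightarrow> bdd_borel (f i)) \<Longrightarrow> bdd_borel (\<lambda>t. \<Sum>i\<in>I. f i t)"
  by (induction I rule: infinite_finite_induct) (auto intro: bdd_borel_add bdd_borel_const)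

lemma bdd_borel_power: "bdd_borel f \<Longrightarrow> bdd_borel (\<lambda>t. f t ^ n)"
  by (induction n) (auto intro: bdd_borel_mult bdd_borel_const)

lemma bdd_borel_cnj: "bdd_borel f \<Longrightarrow> bdd_borel (\<lambda>t. cnj (f t))"
  using measurable_compose[of f borel borel cnj borel] borel_measurable_continuous_onI[of cnj]
  by (auto simp: bdd_borel_def bounded_iff continuous_on_cnj)

lemma bdd_borel_restrict:
  assumes "bdd_borel g" shows "bdd_borel (\<lambda>s. if t \<le> s \<and> s \<le> r then g s else 0)"
proof -
  obtain K where "\<And>t. cmod (g t) \<le> K" "0 \<le> K" using bdd_borel_bound[OF assms] by blast
  then show ?thesis
    using assms by (intro bdd_borelI[of _ K]) (auto simp: bdd_borel_def)
qed

lemma bdd_borel_Iop: assumes "bdd_borel g" shows "bdd_borel (Iop g)"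
proof -
  obtain K where K: "\<And>t. cmod (g t) \<le> K" "0 \<le> K" using bdd_borel_bound[OF assms] by blast
  have g: "g \<in> borel_measurable borel" using assms by (simp add: bdd_borel_def)
  show ?thesis
  proof (rule bdd_borelI)
    show "Iop g \<in> borel_measurable borel"
      unfolding Iop_def[abs_def] using g by measurable
    show "cmod (Iop g t) \<le> K" for t
    proof -
      have "cmod (Iop g t) \<le> (\<integral>s. K \<partial>uniform01)"
        unfolding Iop_def using bdd_borel_integrable[OF bdd_borel_restrict[OF assms]] K
        by (intro integral_norm_bound[THEN order_trans] integral_mono) auto
      then show ?thesis using u01.prob_space by simp
    qed
  qed
qed

lemma bdd_borel_gk: "bdd_borel f \<Longrightarrow> bdd_borel (gk f C k l)"
proof (induction k arbitrary: l)
  case (Suc k)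
  then show ?case
    by (auto intro!: bdd_borel_add bdd_borel_mult bdd_borel_const bdd_borel_sum bdd_borel_power bdd_borel_cnj bdd_borel_Iop)
qed (auto intro: bdd_borel_power bdd_borel_cnj)

lemma measure_uniform01_le: "a \<le> b \<Longrightarrow> measure uniform01 {a..b} \<le> b - a"
proof -
  assume ab: "a \<le> b"
  have "measure lborel ({0..1} \<inter> {a..b}) \<le> measure lborel {a..b}"
    using ab by (intro measure_mono_fmeasurable) (auto simp: fmeasurable_def emeasure_lborel_Icc)
  then show ?thesis using ab by simp
qed

lemma integral_interval_bound:
  assumes g: "bdd_borel g" and K: "\<And>t. cmod (g t) \<le> K" and ab: "a \<le> b"
    and S: "\<And>t. S t \<Longrightarrow> a \<le> t \<and> t \<le> b" "Measurable.pred borel S"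
  shows "cmod (\<integral>t. (if S t then g t else 0) \<partial>uniform01) \<le> K * (b - a)"
proof -
  have K0: "0 \<le> K" using order_trans[OF norm_ge_zero K] .
  have "bdd_borel (\<lambda>t. if S t then g t else 0)"
    using g S(2) K K0 by (intro bdd_borelI[of _ K]) (auto simp: bdd_borel_def)
  then have "cmod (\<integral>t. (if S t then g t else 0) \<partial>uniform01) \<le> (\<integral>t. K * indicator {a..b} t \<partial>uniform01)"
  proof (intro integral_norm_bound[THEN order_trans] integral_mono integrable_norm bdd_borel_integrable)
    show "integrable uniform01 (\<lambda>t. K * indicator {a..b} t)"
      using K0 by (intro u01.integrable_const_bound[of _ K]) (auto simp: indicator_def)
  qed (use K K0 S(1) in \<open>auto simp: indicator_def\<close>)
  also have "\<dots> = K * measure uniform01 {a..b}" by simp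
  also have "\<dots> \<le> K * (b - a)"
    by (intro mult_left_mono measure_uniform01_le ab K0)
  finally show ?thesis .
qed

lemma tendsto_op_power: "(A \<longlonglongrightarrow> a) \<Longrightarrow> (\<lambda>n. op_power (A n) k) \<longlonglongrightarrow> op_power a k"
  by (induction k) (auto intro!: bounded_bilinear.tendsto[OF bounded_bilinear_blinfun_compose])

text \<open>For \<open>t\<close> in the unit interval and off the dyadic grid, the index of the one
  closed cell that contains \<open>t\<close>.\<close>

definition dyadic_cell :: "nat \<Rightarrow> real \<Rightarrow> nat" where "dyadic_cell N t = nat \<lceil>t * 2 ^ N\<rceil>"

lemma dyadic_cell:
  assumes t: "t \<in> {0..1}" "\<And>a. t * 2 ^ N \<noteq> real a"
  shows "dyadic_cell N t \<in> {1..2 ^ N}"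
    "\<And>j. t \<in> {(real j - 1) / 2 ^ N .. real j / 2 ^ N} \<longleftrightarrow> j = dyadic_cell N t"
proof -
  define x where "x = t * 2 ^ N"
  have "t \<noteq> 0" using t(2)[of 0] by auto
  then have "0 < t" using t(1) by simp
  then have x: "0 < x" "x \<le> 2 ^ N" using t(1) by (simp_all add: x_def)
  have x': "x \<noteq> real a" for a unfolding x_def by (rule t(2))
  have "0 < \<lceil>x\<rceil>" using x(1) by simp
  then have j0: "int (dyadic_cell N t) = \<lceil>x\<rceil>"
    by (simp add: dyadic_cell_def x_def)
  have "\<lceil>x\<rceil> \<le> 2 ^ N" using x(2) by (simp add: ceiling_le_iff)
  then have "int (dyadic_cell N t) \<le> int (2 ^ N)" using j0 by simp
  moreover have "int 1 \<le> int (dyadic_cell N t)" using j0 \<open>0 < \<lceil>x\<rceil>\<close> by simp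
  ultimately show "dyadic_cell N t \<in> {1..2 ^ N}"
    unfolding of_nat_le_iff by simp
  fix j
  have "t \<in> {(real j - 1) / 2 ^ N .. real j / 2 ^ N} \<longleftrightarrow> real j - 1 \<le> x \<and> x \<le> real j"
    unfolding x_def atLeastAtMost_iff by (simp add: pos_divide_le_eq pos_le_divide_eq)
  also have "\<dots> \<longleftrightarrow> int j = \<lceil>x\<rceil>"
  proof
    assume "real j - 1 \<le> x \<and> x \<le> real j"
    moreover from this x(1) have "j \<noteq> 0" by (intro notI) simp
    then have "x \<noteq> real j - 1" using x'[of "j - 1"] by (simp add: of_nat_diff)
    ultimately have "\<lceil>x\<rceil> = int j" by (intro ceiling_unique) auto
    then show "int j = \<lceil>x\<rceil>" by simp
  next
    assume "int j = \<lceil>x\<rceil>"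
    then have "real j = of_int \<lceil>x\<rceil>" by (metis of_int_of_nat_eq)
    then show "real j - 1 \<le> x \<and> x \<le> real j" using ceiling_correct[of x] by simp
  qed
  also have "\<dots> \<longleftrightarrow> j = dyadic_cell N t" using j0 by auto
  finally show "t \<in> {(real j - 1) / 2 ^ N .. real j / 2 ^ N} \<longleftrightarrow> j = dyadic_cell N t" .
qed

section \<open>Passage to the limit of the approximants\<close>

locale dt_limit = dt_model +
  fixes T :: "'a oper" and f :: "real \<Rightarrow> complex" and D :: "'a oper" and c :: real
  assumes T: "T_approx E X \<longlonglongrightarrow> T" and D: "calc f D"
begin

sublocale L: dt_level M \<tau> E D0 X N f D c for N
  using D by unfold_locales

definition Z :: "'a oper" where "Z = D + c *\<^sub>R T"

lemma T_M: "T \<in> M"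
proof (rule M_closed[OF _ T])
  show "T_approx E X N \<in> M" for N using L.T'_M[of N] by (simp add: L.T'_eq)
qed

lemma Z_M [simp, intro]: "Z \<in> M"
  using T_M by (simp add: Z_def)

lemma Z_lim: "L.Z \<longlonglongrightarrow> Z"
  unfolding L.Z_def[abs_def] Z_def L.T'_eq by (intro tendsto_intros T)

lemma adj_Z_lim: "(\<lambda>N. adj (L.Z N)) \<longlonglongrightarrow> adj Z"
proof (rule LIM_zero_cancel, rule Lim_null_comparison[OF always_eventually[OF allI]])
  show "norm (adj (L.Z N) - adj Z) \<le> norm (L.Z N - Z)" for N
    using norm_adj[of "L.Z N - Z"] by (simp add: adj_diff)
  show "(\<lambda>N. norm (L.Z N - Z)) \<longlonglongrightarrow> 0"
    using Z_lim by (simp add: LIM_zero tendsto_norm_zero)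
qed

lemma word_lim: "(\<lambda>N. op_power (L.Z N) k o\<^sub>L op_power (adj (L.Z N)) l) \<longlonglongrightarrow> (op_power Z k o\<^sub>L op_power (adj Z) l)"
  by (intro bounded_bilinear.tendsto[OF bounded_bilinear_blinfun_compose] tendsto_op_power Z_lim adj_Z_lim)

lemma tau_word_lim: "d \<in> M \<Longrightarrow> (\<lambda>N. \<tau> (d o\<^sub>L (op_power (L.Z N) k o\<^sub>L op_power (adj (L.Z N)) l)))
    \<longlonglongrightarrow> \<tau> (d o\<^sub>L (op_power Z k o\<^sub>L op_power (adj Z) l))"
  by (rule tau_tendsto) (auto intro!: bounded_bilinear.tendsto[OF bounded_bilinear_blinfun_compose] word_lim)

lemma calc_bdd_borel: "calc \<delta> d \<Longrightarrow> bdd_borel \<delta>"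
  by (auto simp: calc_def bdd_borel_def)

text \<open>A Riemann sum: for \<open>t\<close> in cell \<open>j\<close>, the trace of
  \<open>L.q N j o\<^sub>L W'\<close> is the integral of \<open>h\<close> from the right end of the
  cell to 1, which differs from \<open>Iop h t\<close> by at most \<open>L / 2 ^ N\<close>.\<close>

lemma pair_sum_lim:
  assumes eta: "calc \<eta> e" and h: "bdd_borel h" and W: "\<And>N. W N \<in> M" "W \<longlonglongrightarrow> W'"
    and tauW: "\<And>\<delta> d. calc \<delta> d \<Longrightarrow> \<tau> (d o\<^sub>L W') = (\<integral>t. \<delta> t * h t \<partial>uniform01)"
  shows "(\<lambda>N. \<Sum>j = 1..2 ^ N. \<tau> (L.q N j o\<^sub>L W N) * \<tau> (L.p N j o\<^sub>L e)) \<longlonglongrightarrow> (\<integral>t. \<eta> t * Iop h t \<partial>uniform01)"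
proof -
  obtain K where K: "\<And>t. cmod (\<eta> t) \<le> K" "0 \<le> K" using bdd_borel_bound[OF calc_bdd_borel[OF eta]] by blast
  obtain L where L: "\<And>t. cmod (h t) \<le> L" "0 \<le> L" using bdd_borel_bound[OF h] by blast
  have W'M: "W' \<in> M" by (rule M_closed[OF W])
  have eM: "e \<in> M" using calcD(3)[OF eta] .
  have taup: "\<tau> (L.p N j o\<^sub>L e) = (\<integral>t. indicator {(real j - 1) / 2 ^ N .. real j / 2 ^ N} t * \<eta> t \<partial>uniform01)" for N j
    by (rule calc_tau[OF calc_mult[OF L.pq_calc(1) eta]])
  \<comment> \<open>Small enough for the sum over all \<open>2 ^ N\<close> cells to stay bounded, so
    that \<open>W N\<close> may be replaced by its norm limit \<open>W'\<close>.\<close>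
  have taup_le: "cmod (\<tau> (L.p N j o\<^sub>L e)) \<le> K * (1 / 2 ^ N)" for N j
  proof -
    have "cmod (\<integral>t. (if (real j - 1) / 2 ^ N \<le> t \<and> t \<le> real j / 2 ^ N then \<eta> t else 0) \<partial>uniform01)
        \<le> K * (real j / 2 ^ N - (real j - 1) / 2 ^ N)"
      by (rule integral_interval_bound[OF calc_bdd_borel[OF eta] K(1)]) (auto intro: divide_right_mono)
    moreover have "real j / 2 ^ N - (real j - 1) / 2 ^ N = 1 / 2 ^ N"
      by (simp add: diff_divide_distrib)
    moreover have "(\<lambda>t. if (real j - 1) / 2 ^ N \<le> t \<and> t \<le> real j / 2 ^ N then \<eta> t else 0) = 
      (\<lambda>t. indicator {(real j - 1) / 2 ^ N .. real j / 2 ^ N} t * \<eta> t)"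
      by (auto simp: indicator_def)
    ultimately show ?thesis unfolding taup by simp
  qed
  define A where "A N = (\<Sum>j = 1..2 ^ N. \<tau> (L.q N j o\<^sub>L W') * \<tau> (L.p N j o\<^sub>L e))" for N
  have diff: "(\<lambda>N. (\<Sum>j = 1..2 ^ N. \<tau> (L.q N j o\<^sub>L W N) * \<tau> (L.p N j o\<^sub>L e)) - A N) \<longlonglongrightarrow> 0"
  proof (rule Lim_null_comparison[OF always_eventually[OF allI]])
    fix N
    have qn: "norm (L.q N j) \<le> 2" for j
      using calc_norm[OF L.pq_calc(2)[where N = N and j = j], of 1] by (simp add: indicator_def)
    have "cmod ((\<Sum>j = 1..2 ^ N. \<tau> (L.q N j o\<^sub>L W N) * \<tau> (L.p N j o\<^sub>L e)) - A N)
       = cmod (\<Sum>j = 1..2 ^ N. \<tau> (L.q N j o\<^sub>L (W N - W')) * \<tau> (L.p N j o\<^sub>L e))"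
      using W(1) W'M by (simp add: A_def sum_subtractf[symmetric] compose_diff tau_diff left_diff_distrib)
    also have "\<dots> \<le> (\<Sum>j = 1..(2::nat) ^ N. (2 * norm (W N - W')) * (K * (1 / 2 ^ N)))"
    proof (rule sum_norm_le)
      fix j
      have "cmod (\<tau> (L.q N j o\<^sub>L (W N - W'))) \<le> norm (L.q N j) * norm (W N - W')"
        using W(1) W'M by (intro order_trans[OF tau_le_norm norm_blinfun_compose]) auto
      also have "\<dots> \<le> 2 * norm (W N - W')"
        by (intro mult_right_mono qn) auto
      finally show "cmod (\<tau> (L.q N j o\<^sub>L (W N - W')) * \<tau> (L.p N j o\<^sub>L e)) \<le> (2 * norm (W N - W')) * (K * (1 / 2 ^ N))"
        unfolding norm_mult by (intro mult_mono taup_le) auto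
    qed
    also have "\<dots> = 2 * K * norm (W N - W')" by simp
    finally show "norm ((\<Sum>j = 1..2 ^ N. \<tau> (L.q N j o\<^sub>L W N) * \<tau> (L.p N j o\<^sub>L e)) - A N) \<le> 2 * K * norm (W N - W')" .
  next
    show "(\<lambda>N. 2 * K * norm (W N - W')) \<longlonglongrightarrow> 0"
      using W(2) by (intro tendsto_mult_right_zero tendsto_norm_zero) (simp add: LIM_zero)
  qed
  define J where "J N j = (\<integral>t. indicator {real j / 2 ^ N .. 1} t * h t \<partial>uniform01)" for N :: nat and j :: nat
  define s where "s N t = (\<Sum>j = 1..(2::nat) ^ N. J N j * (indicator {(real j - 1) / 2 ^ N .. real j / 2 ^ N} t * \<eta> t))" for N t
  have As: "A N = (\<integral>t. s N t \<partial>uniform01)" for N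
  proof -
    have "integrable uniform01 (\<lambda>t. indicator {(real j - 1) / 2 ^ N .. real j / 2 ^ N} t * \<eta> t)" for j
      by (rule bdd_borel_integrable[OF calc_bdd_borel[OF calc_mult[OF L.pq_calc(1) eta]]])
    then have "(\<integral>t. s N t \<partial>uniform01) = (\<Sum>j = 1..(2::nat) ^ N. J N j * 
       (\<integral>t. indicator {(real j - 1) / 2 ^ N .. real j / 2 ^ N} t * \<eta> t \<partial>uniform01))"
      unfolding s_def by (subst Bochner_Integration.integral_sum) auto
    then show ?thesis
      by (simp add: A_def taup tauW[OF L.pq_calc(2)] J_def)
  qed
  have J_le: "cmod (J N j) \<le> L" for N j
  proof -
    have "cmod (J N j) \<le> (\<integral>t. L \<partial>uniform01)"
      unfolding J_def using bdd_borel_integrable[OF bdd_borel_mult[OF calc_bdd_borel[OF L.pq_calc(2)[where N = N and j = j]] h]] L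
      by (intro integral_norm_bound[THEN order_trans] integral_mono) (auto simp: indicator_def)
    then show ?thesis using u01.prob_space by simp
  qed
  \<comment> \<open>Dyadic points, where the closed cells overlap, are discarded.\<close>
  have AEd: "AE t in uniform01. \<forall>N a. t * 2 ^ N \<noteq> real a"
  proof -
    have "countable ((\<lambda>(a, N). real a / 2 ^ N) ` (UNIV :: (nat \<times> nat) set))" by simp
    then have "AE t in lborel. t \<notin> (\<lambda>(a, N). real a / 2 ^ N) ` (UNIV :: (nat \<times> nat) set)"
      by (intro AE_not_in countable_imp_null_set_lborel)
    then have "AE t in uniform01. t \<notin> (\<lambda>(a, N). real a / 2 ^ N) ` (UNIV :: (nat \<times> nat) set)"
      by (intro AE_uniform_measureI) auto
    then show ?thesis
    proof eventually_elim
      case (elim t)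
      show ?case
      proof (intro allI notI)
        fix N a assume "t * 2 ^ N = real a"
        then have "t = real a / 2 ^ N" by (simp add: field_simps)
        then show False using elim by (auto simp: image_iff)
      qed
    qed
  qed
  have s_eq: "s N t = J N (dyadic_cell N t) * \<eta> t" if "t \<in> {0..1}" "\<And>N a. t * 2 ^ N \<noteq> real a" for N t
  proof -
    have "s N t = (\<Sum>j = 1..(2::nat) ^ N. if j = dyadic_cell N t then J N j * \<eta> t else 0)"
      unfolding s_def using dyadic_cell(2)[OF that] by (intro sum.cong) (auto simp: indicator_def)
    then show ?thesis using dyadic_cell(1)[OF that] by simp
  qed
  have "(\<lambda>N. \<integral>t. s N t \<partial>uniform01) \<longlonglongrightarrow> (\<integral>t. \<eta> t * Iop h t \<partial>uniform01)"
  proof (rule integral_dominated_convergence[where w = "\<lambda>_. L * K"])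
    have bbs: "bdd_borel (s N)" for N
      unfolding s_def[abs_def] by (intro bdd_borel_sum bdd_borel_mult bdd_borel_const calc_bdd_borel[OF L.pq_calc(1)] calc_bdd_borel[OF eta])
    show "s N \<in> borel_measurable uniform01" for N
      by (rule bdd_borel_measurable[OF bbs])
    show "(\<lambda>t. \<eta> t * Iop h t) \<in> borel_measurable uniform01"
      by (rule bdd_borel_measurable[OF bdd_borel_mult[OF calc_bdd_borel[OF eta] bdd_borel_Iop[OF h]]])
    show "AE t in uniform01. norm (s N t) \<le> L * K" for N
      using AE_uniform01 AEd
      by eventually_elim (auto simp: s_eq norm_mult intro!: mult_mono J_le K L)
    show "AE t in uniform01. (\<lambda>N. s N t) \<longlonglongrightarrow> \<eta> t * Iop h t"
      using AE_uniform01 AEd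
    proof eventually_elim
      case (elim t)
      have "(\<lambda>N. J N (dyadic_cell N t) - Iop h t) \<longlonglongrightarrow> 0"
      proof (rule Lim_null_comparison[OF always_eventually[OF allI]])
        fix N
        let ?b = "real (dyadic_cell N t) / 2 ^ N"
        have cell: "(real (dyadic_cell N t) - 1) / 2 ^ N \<le> t" "t \<le> ?b"
          using dyadic_cell(2)[OF elim(1), of N "dyadic_cell N t"] elim(2) by auto
        have gen: "(\<lambda>s. (if t \<le> s \<and> s \<le> 1 then h s else 0) - indicator {b .. 1} s * h s) =
          (\<lambda>s. if t \<le> s \<and> s < b then h s else 0)" if "t \<le> b" "b \<le> 1" for b
          using that by (auto simp: indicator_def)
        have "dyadic_cell N t \<in> {1..2 ^ N}"
          by (rule dyadic_cell(1)[OF elim(1)]) (use elim(2) in auto)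
        then have "real (dyadic_cell N t) \<le> real (2 ^ N)"
          by (intro of_nat_mono) simp
        then have b1: "?b \<le> 1"
          by simp
        have "Iop h t - J N (dyadic_cell N t) = 
          (\<integral>s. (if t \<le> s \<and> s \<le> 1 then h s else 0) - indicator {?b .. 1} s * h s \<partial>uniform01)"
          unfolding Iop_def J_def
          by (intro Bochner_Integration.integral_diff[symmetric] bdd_borel_integrable bdd_borel_restrict bdd_borel_mult calc_bdd_borel[OF L.pq_calc(2)] h)
        also have "(\<lambda>s. (if t \<le> s \<and> s \<le> 1 then h s else 0) - indicator {?b .. 1} s * h s) =
          (\<lambda>s. if t \<le> s \<and> s < ?b then h s else 0)"
          by (rule gen[OF cell(2) b1])
        also have "cmod (\<integral>s. (if t \<le> s \<and> s < ?b then h s else 0) \<partial>uniform01) \<le> L * (?b - t)"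
          by (rule integral_interval_bound[OF h L(1) cell(2)]) auto
        also have "\<dots> \<le> L * (1 / 2 ^ N)"
          using cell by (intro mult_left_mono L) (simp add: diff_divide_distrib)
        finally show "norm (J N (dyadic_cell N t) - Iop h t) \<le> L * (1 / 2) ^ N"
          by (simp add: norm_minus_commute power_one_over)
      next
        show "(\<lambda>N. L * (1 / 2) ^ N) \<longlonglongrightarrow> 0"
          by (intro tendsto_mult_right_zero LIMSEQ_power_zero) simp
      qed
      then have "(\<lambda>N. J N (dyadic_cell N t) * \<eta> t) \<longlonglongrightarrow> Iop h t * \<eta> t"
        by (intro tendsto_mult tendsto_const) (rule LIM_zero_cancel)
      then show ?case using elim by (simp add: s_eq mult.commute)
    qed
  qed simp
  then have "A \<longlonglongrightarrow> (\<integral>t. \<eta> t * Iop h t \<partial>uniform01)"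
    unfolding As[abs_def] .
  from tendsto_add[OF diff this] show ?thesis by simp
qed

text \<open>The test operator \<open>d\<close> is kept arbitrary because the recursion multiplies it
  by \<open>D\<close> and, through \<open>pair_sum_lim\<close>, evaluates shorter words against the
  projections \<open>q j\<close>.\<close>

theorem dt_moments:
  "calc \<delta> d \<Longrightarrow> \<tau> (d o\<^sub>L (op_power Z k o\<^sub>L op_power (adj Z) l)) =
     (\<integral>t. \<delta> t * gk f (complex_of_real c ^ 2) k l t \<partial>uniform01)"
proof (induction k arbitrary: \<delta> d l)
  case 0
  have dM: "d \<in> M" using calcD(3)[OF 0] .
  have "\<tau> (d o\<^sub>L (op_power (L.Z N) 0 o\<^sub>L op_power (adj (L.Z N)) l)) = (\<integral>t. \<delta> t * cnj (f t) ^ l \<partial>uniform01)" for N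
    using L.diag_Zs[OF 0, of N l] calc_tau[OF calc_mult[OF 0 calc_power[OF calc_adj[OF D]]]] by simp
  with tau_word_lim[OF dM, of 0 l] show ?case
    by (simp add: LIMSEQ_const_iff)
next
  case (Suc k)
  note d = Suc.prems
  let ?C = "complex_of_real c ^ 2"
  have dM: "d \<in> M" using calcD(3)[OF d] .
  have bf: "bdd_borel f" using calc_bdd_borel[OF D] .
  have first: "(\<lambda>N. \<tau> ((d o\<^sub>L D) o\<^sub>L (op_power (L.Z N) k o\<^sub>L op_power (adj (L.Z N)) l)))
      \<longlonglongrightarrow> (\<integral>t. \<delta> t * f t * gk f ?C k l t \<partial>uniform01)"
    using tau_word_lim[of "d o\<^sub>L D" k l] dM unfolding Suc.IH[OF calc_mult[OF d D]] by simp
  have second: "(\<lambda>N. \<Sum>j = 1..2 ^ N. \<tau> (L.q N j o\<^sub>L (op_power (L.Z N) k o\<^sub>L op_power (adj (L.Z N)) i)) *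
       \<tau> (L.p N j o\<^sub>L (d o\<^sub>L op_power (adj D) m))) \<longlonglongrightarrow>
       (\<integral>t. \<delta> t * cnj (f t) ^ m * Iop (gk f ?C k i) t \<partial>uniform01)" for i m
  proof (rule pair_sum_lim[OF calc_mult[OF d calc_power[OF calc_adj[OF D]]] bdd_borel_gk[OF bf] _ word_lim])
    show "\<tau> (d' o\<^sub>L (op_power Z k o\<^sub>L op_power (adj Z) i)) = (\<integral>t. \<delta>' t * gk f ?C k i t \<partial>uniform01)"
      if "calc \<delta>' d'" for \<delta>' d' by (rule Suc.IH[OF that])
  qed auto
  have "(\<lambda>N. \<tau> (d o\<^sub>L (op_power (L.Z N) (Suc k) o\<^sub>L op_power (adj (L.Z N)) l))) \<longlonglongrightarrow>
    (\<integral>t. \<delta> t * f t * gk f ?C k l t \<partial>uniform01) + 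
    ?C * (\<Sum>i<l. (\<integral>t. \<delta> t * cnj (f t) ^ (l - 1 - i) * Iop (gk f ?C k i) t \<partial>uniform01))"
    unfolding L.level_recursion[OF d]
    by (intro tendsto_add first tendsto_mult tendsto_const tendsto_sum second)
  from LIMSEQ_unique[OF tau_word_lim[OF dM] this]
  have "\<tau> (d o\<^sub>L (op_power Z (Suc k) o\<^sub>L op_power (adj Z) l)) = 
    (\<integral>t. \<delta> t * f t * gk f ?C k l t \<partial>uniform01) + 
    ?C * (\<Sum>i<l. (\<integral>t. \<delta> t * cnj (f t) ^ (l - 1 - i) * Iop (gk f ?C k i) t \<partial>uniform01))" .
  also have "\<dots> = (\<integral>t. \<delta> t * f t * gk f ?C k l t + 
      (\<Sum>i<l. ?C * (\<delta> t * cnj (f t) ^ (l - 1 - i) * Iop (gk f ?C k i) t)) \<partial>uniform01)"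
  proof -
    have i1: "integrable uniform01 (\<lambda>t. \<delta> t * f t * gk f ?C k l t)"
      by (intro bdd_borel_integrable bdd_borel_mult bdd_borel_gk bf calc_bdd_borel[OF d])
    have i2: "integrable uniform01 (\<lambda>t. \<delta> t * cnj (f t) ^ (l - 1 - i) * Iop (gk f ?C k i) t)" for i
      by (intro bdd_borel_integrable bdd_borel_mult bdd_borel_gk bf calc_bdd_borel[OF d] bdd_borel_power bdd_borel_cnj bdd_borel_Iop)
    show ?thesis
      using i1 i2 by (simp add: sum_distrib_left)
  qed
  also have "\<dots> = (\<integral>t. \<delta> t * gk f ?C (Suc k) l t \<partial>uniform01)"
    by (simp add: sum_distrib_left algebra_simps)
  finally show ?case .
qed

end

section \<open>The generating function of the moments\<close>

lemma Iop_add: "bdd_borel p \<Longrightarrow> bdd_borel q \<Longrightarrow> Iop (\<lambda>s. p s + q s) t = Iop p t + Iop q t"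
proof -
  assume "bdd_borel p" "bdd_borel q"
  have "(\<lambda>s. if t \<le> s \<and> s \<le> 1 then p s + q s else 0) =
      (\<lambda>s. (if t \<le> s \<and> s \<le> 1 then p s else 0) + (if t \<le> s \<and> s \<le> 1 then q s else 0))" by auto
  then show ?thesis
    unfolding Iop_def using bdd_borel_integrable[OF bdd_borel_restrict[OF \<open>bdd_borel p\<close>]] bdd_borel_integrable[OF bdd_borel_restrict[OF \<open>bdd_borel q\<close>]] by simp
qed

lemma Iop_mult: "Iop (\<lambda>s. c * p s) t = c * Iop p t"
proof -
  have "(\<lambda>s. if t \<le> s \<and> s \<le> 1 then c * p s else 0) = (\<lambda>s. c * (if t \<le> s \<and> s \<le> 1 then p s else 0))" by auto
  then show ?thesis unfolding Iop_def by simp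
qed

lemma Iop_zero [simp]: "Iop (\<lambda>_. 0) t = 0"
  by (simp add: Iop_def)

lemma Iop_sum: "(\<And>i. i \<in> J \<Longrightarrow> bdd_borel (p i)) \<Longrightarrow> Iop (\<lambda>s. \<Sum>i\<in>J. p i s) t = (\<Sum>i\<in>J. Iop (p i) t)"
  by (induction J rule: infinite_finite_induct) (auto simp: Iop_add bdd_borel_sum)

lemma Iop_0: "bdd_borel p \<Longrightarrow> Iop p 0 = (\<integral>t. p t \<partial>uniform01)"
  unfolding Iop_def
proof (rule integral_cong_AE)
  assume p: "bdd_borel p"
  show "(\<lambda>s. if 0 \<le> s \<and> s \<le> 1 then p s else 0) \<in> borel_measurable uniform01"
    by (rule bdd_borel_measurable[OF bdd_borel_restrict[OF p]])
  show "p \<in> borel_measurable uniform01" by (rule bdd_borel_measurable[OF p])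
  show "AE t in uniform01. (if 0 \<le> t \<and> t \<le> 1 then p t else 0) = p t"
    using AE_uniform01 by eventually_elim auto
qed

text \<open>Integration by parts: Fubini on the square over \<open>[t, 1]\<close>, cut along its
  diagonal, which is a null set.\<close>

lemma Iop_product:
  assumes p: "bdd_borel p" and q: "bdd_borel q"
  shows "Iop p t * Iop q t = Iop (\<lambda>s. p s * Iop q s) t + Iop (\<lambda>s. Iop p s * q s) t"
proof -
  interpret pair_sigma_finite uniform01 uniform01 ..
  define P where "P s = (if t \<le> s \<and> s \<le> 1 then p s else 0)" for s
  define Q where "Q s = (if t \<le> s \<and> s \<le> 1 then q s else 0)" for s
  have P: "bdd_borel P" and Q: "bdd_borel Q" unfolding P_def Q_def by (intro bdd_borel_restrict p q)+
  have Pm: "P \<in> borel_measurable borel" "Q \<in> borel_measurable borel" using P Q by (auto simp: bdd_borel_def)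
  obtain K where K: "\<And>t. cmod (P t) \<le> K" "0 \<le> K" using bdd_borel_bound[OF P] by blast
  obtain L where L: "\<And>t. cmod (Q t) \<le> L" "0 \<le> L" using bdd_borel_bound[OF Q] by blast
  interpret u2: prob_space "uniform01 \<Otimes>\<^sub>M uniform01"
    by (intro prob_space_pair u01.prob_space_axioms)
  have int: "integrable (uniform01 \<Otimes>\<^sub>M uniform01) (\<lambda>(s, r). if r < s then P s * Q r else 0)"
  proof (rule u2.integrable_const_bound[of _ "K * L"])
    show "AE x in uniform01 \<Otimes>\<^sub>M uniform01. norm (case x of (s, r) \<Rightarrow> if r < s then P s * Q r else 0) \<le> K * L"
      using K L by (intro AE_I2) (auto simp: norm_mult intro!: mult_mono)
    show "(\<lambda>(s, r). if r < s then P s * Q r else 0) \<in> borel_measurable (uniform01 \<Otimes>\<^sub>M uniform01)"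
      using Pm by measurable
  qed
  have ne: "AE s in uniform01. s \<noteq> r" for r
    by (rule AE_uniform_measureI) (use AE_lborel_singleton[of r] in \<open>auto elim: eventually_mono\<close>)
  have inner: "(\<integral>r. P s * Q r \<partial>uniform01) = P s * Iop q s + (\<integral>r. (if r < s then P s * Q r else 0) \<partial>uniform01)" for s
  proof (cases "t \<le> s \<and> s \<le> 1")
    case True
    have e1: "(\<lambda>r. P s * Q r) = (\<lambda>r. P s * (if s \<le> r \<and> r \<le> 1 then q r else 0) + (if r < s then P s * Q r else 0))"
      using True by (auto simp: Q_def)
    have i1: "integrable uniform01 (\<lambda>r. P s * (if s \<le> r \<and> r \<le> 1 then q r else 0))"
      by (intro bdd_borel_integrable bdd_borel_mult bdd_borel_const bdd_borel_restrict q)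
    have "bdd_borel (\<lambda>r. if r < s then P s * Q r else 0)"
      using Pm K L by (intro bdd_borelI[of _ "K * L"]) (auto simp: norm_mult intro!: mult_mono)
    then have i2: "integrable uniform01 (\<lambda>r. if r < s then P s * Q r else 0)"
      by (rule bdd_borel_integrable)
    show ?thesis
      by (subst e1) (simp add: Bochner_Integration.integral_add[OF i1 i2] Iop_def)
  next
    case False
    then have "P s = 0" by (auto simp: P_def)
    moreover from this have "(\<lambda>r. if r < s then P s * Q r else 0) = (\<lambda>_. 0)" by auto
    ultimately show ?thesis by simp
  qed
  have bint: "bdd_borel (\<lambda>s. \<integral>r. (if r < s then P s * Q r else 0) \<partial>uniform01)"
  proof (rule bdd_borelI)
    show "(\<lambda>s. \<integral>r. (if r < s then P s * Q r else 0) \<partial>uniform01) \<in> borel_measurable borel"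
      using Pm by measurable
    fix s
    have "bdd_borel (\<lambda>r. if r < s then P s * Q r else 0)"
      using Pm K L by (intro bdd_borelI[of _ "K * L"]) (auto simp: norm_mult intro!: mult_mono)
    then have "cmod (\<integral>r. (if r < s then P s * Q r else 0) \<partial>uniform01) \<le> (\<integral>r. K * L \<partial>uniform01)"
      using K L by (intro integral_norm_bound[THEN order_trans] integral_mono integrable_norm bdd_borel_integrable)
        (auto simp: norm_mult intro!: mult_mono)
    then show "cmod (\<integral>r. (if r < s then P s * Q r else 0) \<partial>uniform01) \<le> K * L"
      using u01.prob_space by simp
  qed
  have "Iop p t * Iop q t = (\<integral>s. P s \<partial>uniform01) * (\<integral>r. Q r \<partial>uniform01)"
    by (simp add: Iop_def P_def[abs_def] Q_def[abs_def])
  also have "\<dots> = (\<integral>s. (\<integral>r. P s * Q r \<partial>uniform01) \<partial>uniform01)"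
    by simp
  also have "\<dots> = (\<integral>s. P s * Iop q s \<partial>uniform01) + (\<integral>s. (\<integral>r. (if r < s then P s * Q r else 0) \<partial>uniform01) \<partial>uniform01)"
    unfolding inner by (intro Bochner_Integration.integral_add bdd_borel_integrable bint bdd_borel_mult P bdd_borel_Iop q)
  also have "(\<integral>s. P s * Iop q s \<partial>uniform01) = Iop (\<lambda>s. p s * Iop q s) t"
    unfolding Iop_def[of _ t] by (intro Bochner_Integration.integral_cong) (auto simp: P_def)
  also have "(\<integral>s. (\<integral>r. (if r < s then P s * Q r else 0) \<partial>uniform01) \<partial>uniform01) =
      (\<integral>r. (\<integral>s. (if r < s then P s * Q r else 0) \<partial>uniform01) \<partial>uniform01)"
    by (rule Fubini_integral[symmetric, OF int])
  also have "(\<lambda>r. \<integral>s. (if r < s then P s * Q r else 0) \<partial>uniform01) = 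
      (\<lambda>r. if t \<le> r \<and> r \<le> 1 then Iop p r * q r else 0)"
  proof
    fix r
    show "(\<integral>s. (if r < s then P s * Q r else 0) \<partial>uniform01) = (if t \<le> r \<and> r \<le> 1 then Iop p r * q r else 0)"
    proof (cases "t \<le> r \<and> r \<le> 1")
      case True
      have "(\<integral>s. (if r < s then P s * Q r else 0) \<partial>uniform01) = 
          (\<integral>s. (if r \<le> s \<and> s \<le> 1 then p s else 0) * q r \<partial>uniform01)"
      proof (rule integral_cong_AE)
        show "(\<lambda>s. if r < s then P s * Q r else 0) \<in> borel_measurable uniform01"
          using Pm by measurable
        have "bdd_borel (\<lambda>s. (if r \<le> s \<and> s \<le> 1 then p s else 0) * q r)"
          by (intro bdd_borel_mult bdd_borel_restrict p bdd_borel_const)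
        then show "(\<lambda>s. (if r \<le> s \<and> s \<le> 1 then p s else 0) * q r) \<in> borel_measurable uniform01"
          by (rule bdd_borel_measurable)
        show "AE s in uniform01. (if r < s then P s * Q r else 0) = (if r \<le> s \<and> s \<le> 1 then p s else 0) * q r"
          using ne[of r] by eventually_elim (use True in \<open>auto simp: P_def Q_def\<close>)
      qed
      then show ?thesis using True by (simp add: Iop_def)
    next
      case False
      then have "Q r = 0" by (auto simp: Q_def)
      then have "(\<lambda>s. if r < s then P s * Q r else 0) = (\<lambda>_. 0)" by auto
      then show ?thesis unfolding if_not_P[OF False] by simp
    qed
  qed
  finally show ?thesis by (simp add: Iop_def[of "\<lambda>s. Iop p s * q s"])
qed

text \<open>A power series in two variables, iterated: the outer variable marks powers of
  \<open>Z\<close>, the inner one powers of \<open>adj Z\<close>.\<close>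

definition cf :: "(nat \<Rightarrow> nat \<Rightarrow> complex) \<Rightarrow> complex fps fps" where
  "cf a = Abs_fps (\<lambda>k. Abs_fps (\<lambda>l. a k l))"

lemma cf_nth [simp]: "cf a $ k $ l = a k l"
  by (simp add: cf_def)

lemma cf_eqI: "(\<And>k l. P $ k $ l = Q $ k $ l) \<Longrightarrow> P = (Q :: complex fps fps)"
  by (simp add: fps_eq_iff)

definition good :: "(real \<Rightarrow> complex fps fps) \<Rightarrow> bool" where
  "good P \<longleftrightarrow> (\<forall>k l. bdd_borel (\<lambda>t. P t $ k $ l))"

definition II :: "(real \<Rightarrow> complex fps fps) \<Rightarrow> real \<Rightarrow> complex fps fps" where
  "II P t = cf (\<lambda>k l. Iop (\<lambda>s. P s $ k $ l) t)"

lemma mult_nth2: "(P * Q) $ k $ l = (\<Sum>i=0..k. \<Sum>j=0..l. P $ i $ j * Q $ (k - i) $ (l - j))"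
  for P Q :: "complex fps fps"
  by (simp add: fps_mult_nth fps_sum_nth)

lemma good_const: "good (\<lambda>_. c)"
  by (simp add: good_def bdd_borel_const)

lemma good_add: "good P \<Longrightarrow> good Q \<Longrightarrow> good (\<lambda>t. P t + Q t)"
  by (simp add: good_def bdd_borel_add)

lemma good_mult: "good P \<Longrightarrow> good Q \<Longrightarrow> good (\<lambda>t. P t * Q t)"
  unfolding good_def mult_nth2 by (intro allI bdd_borel_sum bdd_borel_mult) auto

lemma good_II: "good P \<Longrightarrow> good (II P)"
  by (simp add: good_def II_def bdd_borel_Iop)

lemma good_diff: assumes "good P" "good Q" shows "good (\<lambda>t. P t - Q t)"
  using good_add[OF assms(1) good_mult[OF good_const[of "-1"] assms(2)]] by simp

lemma II_add: "good P \<Longrightarrow> good Q \<Longrightarrow> II (\<lambda>t. P t + Q t) t = II P t + II Q t"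
  by (rule cf_eqI) (simp add: II_def good_def Iop_add)

lemma II_mult:
  assumes P: "good P" shows "II (\<lambda>t. c * P t) t = c * II P t"
proof (rule cf_eqI)
  fix k l
  have "Iop (\<lambda>s. \<Sum>i=0..k. \<Sum>j=0..l. c $ i $ j * P s $ (k - i) $ (l - j)) t = 
     (\<Sum>i=0..k. \<Sum>j=0..l. c $ i $ j * Iop (\<lambda>s. P s $ (k - i) $ (l - j)) t)"
    using P by (subst Iop_sum, auto simp: good_def intro!: bdd_borel_sum bdd_borel_mult bdd_borel_const sum.cong)
      (subst Iop_sum, auto simp: Iop_mult intro!: bdd_borel_mult bdd_borel_const)
  then show "II (\<lambda>t. c * P t) t $ k $ l = (c * II P t) $ k $ l"
    by (simp add: II_def mult_nth2)
qed

lemma II_diff: assumes "good P" "good Q" shows "II (\<lambda>t. P t - Q t) t = II P t - II Q t"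
  using II_add[OF assms(1) good_mult[OF good_const[of "-1"] assms(2)]] II_mult[OF assms(2), of "-1"] by simp

lemma II_product:
  assumes P: "good P" and Q: "good Q"
  shows "II P t * II Q t = II (\<lambda>s. P s * II Q s + II P s * Q s) t"
proof (rule cf_eqI)
  fix k l
  let ?P = "\<lambda>i j s. P s $ i $ j" and ?Q = "\<lambda>i j s. Q s $ (k - i) $ (l - j)"
  have b: "bdd_borel (?P i j)" "bdd_borel (?Q i j)" for i j using P Q by (auto simp: good_def)
  have "(II P t * II Q t) $ k $ l = (\<Sum>i=0..k. \<Sum>j=0..l. 
      Iop (\<lambda>s. ?P i j s * Iop (?Q i j) s + Iop (?P i j) s * ?Q i j s) t)"
    unfolding mult_nth2 II_def cf_nth
    by (intro sum.cong refl) (simp add: Iop_product[OF b] Iop_add b bdd_borel_mult bdd_borel_Iop)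
  also have "\<dots> = Iop (\<lambda>s. \<Sum>i=0..k. \<Sum>j=0..l. ?P i j s * Iop (?Q i j) s + Iop (?P i j) s * ?Q i j s) t"
    by (subst Iop_sum, intro bdd_borel_sum bdd_borel_add bdd_borel_mult bdd_borel_Iop b, intro sum.cong refl,
        subst Iop_sum, intro bdd_borel_add bdd_borel_mult bdd_borel_Iop b, rule refl)
  also have "\<dots> = II (\<lambda>s. P s * II Q s + II P s * Q s) t $ k $ l"
    by (simp add: II_def mult_nth2 sum.distrib)
  finally show "(II P t * II Q t) $ k $ l = II (\<lambda>s. P s * II Q s + II P s * Q s) t $ k $ l" .
qed

text \<open>The Euler operator of the outer variable: a derivation that does not shift degrees and
  therefore commutes with the coefficientwise \<open>II\<close>.\<close>

definition \<delta> :: "complex fps fps \<Rightarrow> complex fps fps" where "\<delta> P = fps_X * fps_deriv P"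

lemma \<delta>_nth: "\<delta> P $ k = of_nat k * P $ k"
  by (cases k) (auto simp: \<delta>_def)

lemma \<delta>_mult: "\<delta> (P * Q) = \<delta> P * Q + P * \<delta> Q"
  by (simp add: \<delta>_def algebra_simps)

lemma of_nat_mult_nth: "(of_nat k * p :: complex fps) $ l = of_nat k * p $ l"
  by (simp add: fps_of_nat[symmetric] del: fps_of_nat)

lemma II_\<delta>: "II (\<lambda>s. \<delta> (P s)) t = \<delta> (II P t)"
  by (rule cf_eqI) (simp add: II_def \<delta>_nth of_nat_mult_nth Iop_mult)

lemma good_\<delta>: "good P \<Longrightarrow> good (\<lambda>s. \<delta> (P s))"
  by (simp add: good_def \<delta>_nth of_nat_mult_nth bdd_borel_mult bdd_borel_const)

text \<open>The monomial \<open>C a b\<close> in the outer variable \<open>a\<close> and the inner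
  variable \<open>b\<close>.\<close>

definition kap :: "complex \<Rightarrow> complex fps fps" where
  "kap C = fps_X * fps_const (fps_const C * fps_X)"

lemma kap_nth: "(kap C * P) $ k $ l = (if k = 0 \<or> l = 0 then 0 else C * P $ (k - 1) $ (l - 1))"
proof -
  have "kap C * P = fps_X * (fps_const (fps_const C * fps_X) * P)"
    by (simp add: kap_def mult.assoc)
  also have "\<dots> $ k $ l = (if k = 0 \<or> l = 0 then 0 else C * P $ (k - 1) $ (l - 1))"
    by (cases k) (simp_all add: mult.assoc)
  finally show ?thesis .
qed

text \<open>The generating function \<open>R\<close> of the \<open>gk\<close> is \<open>h S\<close> with the geometric series \<open>h\<close>, and \<open>S\<close> solves the Volterra
  equation \<open>S = 1 + II (kap C * h * S)\<close>; its value at 0 would be the exponential of \<open>II (kap C * h) 0\<close>. The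
  logarithmic derivative below expresses this without exponentials of power series.\<close>

theorem gk_log_deriv:
  fixes f :: "real \<Rightarrow> complex" and C :: complex
  assumes f: "bdd_borel f"
  defines "W \<equiv> cf (\<lambda>k l. \<integral>t. gk f C k l t \<partial>uniform01)"
    and "m \<equiv> cf (\<lambda>k l. \<integral>t. f t ^ k * cnj (f t) ^ l \<partial>uniform01)"
  shows "\<delta> (1 + kap C * W) = (1 + kap C * W) * \<delta> (kap C * m)"
proof -
  define R where "R t = cf (\<lambda>k l. gk f C k l t)" for t
  define h where "h t = cf (\<lambda>k l. f t ^ k * cnj (f t) ^ l)" for t
  have gR: "good R" using f by (simp add: good_def R_def bdd_borel_gk)
  have gh: "good h" using f by (simp add: good_def h_def bdd_borel_mult bdd_borel_power bdd_borel_cnj)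
  define S where "S t = 1 + II (\<lambda>s. kap C * R s) t" for t
  \<comment> \<open>\<open>a t\<close> and \<open>b t\<close> are the two denominators of the
    geometric series \<open>h t\<close>, in the outer and in the inner variable.\<close>
  define a where "a t = 1 - fps_X * fps_const (fps_const (f t))" for t
  define b where "b t = 1 - fps_const (fps_const (cnj (f t)) * fps_X)" for t
  have a_nth: "(a t * P) $ k $ l = P $ k $ l - (if k = 0 then 0 else f t * P $ (k - 1) $ l)" for t P k l
    by (simp add: a_def left_diff_distrib mult.assoc)
  have b_nth: "(b t * P) $ k $ l = P $ k $ l - (if l = 0 then 0 else cnj (f t) * P $ k $ (l - 1))" for t P k l
    by (simp add: b_def left_diff_distrib mult.assoc)
  have one_nth: "(1 :: complex fps fps) $ k $ l = (if k = 0 \<and> l = 0 then 1 else 0)" for k l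
    by (cases "k = 0") auto
  have abh: "b t * (a t * h t) = 1" for t
  proof (rule cf_eqI)
    fix k l
    show "(b t * (a t * h t)) $ k $ l = 1 $ k $ l"
      unfolding b_nth a_nth one_nth by (cases k; cases l) (simp_all add: h_def)
  qed
  \<comment> \<open>Multiplying by \<open>a t\<close> undoes the recursion in \<open>k\<close>,
    multiplying by \<open>b t\<close> the convolution over \<open>i\<close>: of that sum only the
    term \<open>i = l - 1\<close> remains.\<close>
  have S_R: "b t * (a t * R t) = S t" for t
  proof (rule cf_eqI)
    fix k l
    have S_nth: "S t $ k $ l = (if k = 0 \<and> l = 0 then 1 else 0) + 
        (if k = 0 \<or> l = 0 then 0 else C * Iop (gk f C (k - 1) (l - 1)) t)"
      unfolding S_def by (simp add: II_def kap_nth one_nth R_def Iop_mult if_distrib cong: if_cong)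
    show "(b t * (a t * R t)) $ k $ l = S t $ k $ l"
    proof (cases k)
      case 0
      then show ?thesis unfolding b_nth a_nth S_nth by (cases l) (simp_all add: R_def)
    next
      case (Suc k')
      show ?thesis
      proof (cases l)
        case 0
        then show ?thesis unfolding b_nth a_nth S_nth using Suc by (simp add: R_def)
      next
        case l: (Suc l')
        have "(\<Sum>i<l'. cnj (f t) ^ (l' - i) * Iop (gk f C k' i) t) = 
           cnj (f t) * (\<Sum>i<l'. cnj (f t) ^ (l' - 1 - i) * Iop (gk f C k' i) t)"
          unfolding sum_distrib_left
        proof (intro sum.cong refl)
          fix i assume "i \<in> {..<l'}"
          then have "l' - i = Suc (l' - 1 - i)" by auto
          then show "cnj (f t) ^ (l' - i) * Iop (gk f C k' i) t = cnj (f t) * (cnj (f t) ^ (l' - 1 - i) * Iop (gk f C k' i) t)"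
            by (simp only: power_Suc mult.assoc)
        qed
        then show ?thesis unfolding b_nth a_nth S_nth using Suc l by (simp add: R_def algebra_simps)
      qed
    qed
  qed
  have R_hS: "R t = h t * S t" for t
  proof -
    have "h t * S t = (b t * (a t * h t)) * R t"
      unfolding S_R[symmetric] by (simp add: mult_ac)
    then show ?thesis by (simp add: abh)
  qed
  define w where "w s = kap C * h s" for s
  have gw: "good w" unfolding w_def by (intro good_mult good_const gh)
  have gS: "good S" unfolding S_def by (intro good_add good_const good_II good_mult gR)
  have S_eq: "S t = 1 + II (\<lambda>s. w s * S s) t" for t
  proof -
    have "(\<lambda>s. kap C * R s) = (\<lambda>s. w s * S s)" by (simp only: R_hS w_def mult.assoc)
    then show ?thesis by (simp only: S_def[of t])
  qed
  define \<beta> where "\<beta> s = \<delta> (w s)" for s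
  define B where "B t = II \<beta> t" for t
  have g\<beta>: "good \<beta>" unfolding \<beta>_def by (intro good_\<delta> gw)
  have gB: "good B" unfolding B_def by (intro good_II g\<beta>)
  \<comment> \<open>The defect of the logarithmic derivative; it solves the homogeneous Volterra
    equation.\<close>
  define V where "V t = \<delta> (S t) - S t * B t" for t
  have gV: "good V" unfolding V_def by (intro good_diff good_\<delta> good_mult gS gB)
  have V_eq: "V t = II (\<lambda>s. w s * V s) t" for t
  proof -
    have "\<delta> (S t) = \<delta> (II (\<lambda>s. w s * S s) t)"
      by (subst S_eq) (simp add: \<delta>_def)
    also have "\<dots> = II (\<lambda>s. \<beta> s * S s + w s * \<delta> (S s)) t"
      by (simp add: II_\<delta>[symmetric] \<delta>_mult \<beta>_def)
    finally have 1: "\<delta> (S t) = II (\<lambda>s. \<beta> s * S s + w s * \<delta> (S s)) t" .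
    have "S t * B t = B t + II (\<lambda>s. w s * S s) t * II \<beta> t"
      by (subst S_eq) (simp add: B_def algebra_simps)
    \<comment> \<open>Integration by parts turns the product of two integrals into a single
      one.\<close>
    also have "II (\<lambda>s. w s * S s) t * II \<beta> t = II (\<lambda>s. w s * S s * II \<beta> s + II (\<lambda>s. w s * S s) s * \<beta> s) t"
      by (rule II_product) (intro good_mult gw gS g\<beta>)+
    also have "(\<lambda>s. w s * S s * II \<beta> s + II (\<lambda>s. w s * S s) s * \<beta> s) = (\<lambda>s. w s * S s * B s + (S s - 1) * \<beta> s)"
    proof -
      have "II (\<lambda>s. w s * S s) s = S s - 1" for s
        using S_eq[of s] by (metis add_diff_cancel_left')
      then show ?thesis by (simp add: B_def)
    qed
    also have "B t + II (\<lambda>s. w s * S s * B s + (S s - 1) * \<beta> s) t = II (\<lambda>s. \<beta> s + (w s * S s * B s + (S s - 1) * \<beta> s)) t"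
      unfolding B_def[of t]
      by (rule II_add[symmetric]) (intro good_add good_mult good_diff good_const gw gS gB g\<beta>)+
    finally have 2: "S t * B t = II (\<lambda>s. \<beta> s + (w s * S s * B s + (S s - 1) * \<beta> s)) t" .
    have "V t = II (\<lambda>s. (\<beta> s * S s + w s * \<delta> (S s)) - (\<beta> s + (w s * S s * B s + (S s - 1) * \<beta> s))) t"
      unfolding V_def 1 2
      by (rule II_diff[symmetric]) (intro good_add good_mult good_diff good_const gw gS gB g\<beta> good_\<delta>)+
    also have "(\<lambda>s. (\<beta> s * S s + w s * \<delta> (S s)) - (\<beta> s + (w s * S s * B s + (S s - 1) * \<beta> s))) = (\<lambda>s. w s * V s)"
      by (auto simp: V_def algebra_simps)
    finally show ?thesis .
  qed
  \<comment> \<open>The factor \<open>kap C\<close> raises both degrees by one, so uniqueness is an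
    induction on the outer degree.\<close>
  have V0: "V t $ k $ l = 0" for k l t
  proof (induction k arbitrary: l t rule: less_induct)
    case (less k)
    have V: "V t = kap C * II (\<lambda>s. h s * V s) t"
      unfolding V_eq[of t] by (simp add: w_def mult.assoc II_mult[OF good_mult[OF gh gV]])
    show ?case
    proof (cases "k = 0 \<or> l = 0")
      case False
      have "(h s * V s) $ (k - 1) $ (l - 1) = 0" for s
        unfolding mult_nth2 using False by (intro sum.neutral ballI) (simp add: less)
      then show ?thesis unfolding V kap_nth by (simp add: II_def)
    qed (subst V, simp add: kap_nth)
  qed
  have "V 0 = 0" by (rule cf_eqI) (simp add: V0)
  then have main: "\<delta> (S 0) = S 0 * B 0" by (simp add: V_def)
  have "II R 0 = W" "II h 0 = m"
    using f by (auto intro!: cf_eqI simp: II_def W_def m_def R_def h_def Iop_0 bdd_borel_gk bdd_borel_mult bdd_borel_power bdd_borel_cnj)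
  then have "S 0 = 1 + kap C * W" "B 0 = \<delta> (kap C * m)"
    unfolding S_def B_def \<beta>_def II_\<delta> w_def by (simp_all add: II_mult gR gh)
  with main show ?thesis by simp
qed

section \<open>The analytic contradiction\<close>

lemma one_nth2: "(1 :: complex fps fps) $ k $ l = (if k = 0 \<and> l = 0 then 1 else 0)"
  by (cases "k = 0") auto

text \<open>For \<open>f = 0\<close> and \<open>C = 1\<close> the logarithmic derivative is
  \<open>kap 1\<close>, so \<open>E\<close> is the exponential of the product of the two
  variables.\<close>

lemma quasinilpotent_moments:
  "(\<integral>t. gk (\<lambda>_. 0) 1 k l t \<partial>uniform01) = (if k = l then 1 / fact (k + 1) else 0)"
proof -
  define W where "W = cf (\<lambda>k l. \<integral>t. gk (\<lambda>_. 0) 1 k l t \<partial>uniform01)"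
  define E where "E = 1 + kap 1 * W"
  have m: "cf (\<lambda>k l. \<integral>t. 0 ^ k * cnj 0 ^ l \<partial>uniform01) = 1"
  proof (rule cf_eqI)
    fix k l
    show "cf (\<lambda>k l. \<integral>t. 0 ^ k * cnj 0 ^ l \<partial>uniform01) $ k $ l = 1 $ k $ l"
      unfolding one_nth2 using u01.prob_space by (cases k; cases l) auto
  qed
  have "\<delta> (kap 1) = kap 1"
    by (simp add: \<delta>_def kap_def)
  then have rec: "\<delta> E = kap 1 * E"
    using gk_log_deriv[of "\<lambda>_. 0" 1, OF bdd_borel_const] unfolding m W_def[symmetric] E_def by (simp add: mult.commute)
  have E0: "E $ 0 $ l = (if l = 0 then 1 else 0)" for l
    unfolding E_def fps_add_nth kap_nth one_nth2 by simp
  have E: "E $ k $ l = (if k = l then 1 / fact k else 0)" for k l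
  proof (induction k arbitrary: l)
    case (Suc k)
    have "of_nat (Suc k) * E $ Suc k $ l = (kap 1 * E) $ Suc k $ l"
      using arg_cong[OF rec, of "\<lambda>F. F $ Suc k $ l"] by (simp only: \<delta>_nth of_nat_mult_nth)
    also have "\<dots> = (if Suc k = l then 1 / fact k else 0)"
      unfolding kap_nth by (cases l) (simp_all add: Suc)
    finally have "of_nat (Suc k) * E $ Suc k $ l = (if Suc k = l then 1 / fact k else 0)" .
    then have "E $ Suc k $ l = (if Suc k = l then 1 / fact k else 0) / of_nat (Suc k)"
      by (simp add: eq_divide_eq mult.commute del: of_nat_Suc)
    then show ?case by (auto simp: field_simps)
  qed (simp add: E0)
  have "W $ k $ l = E $ Suc k $ Suc l"
    unfolding E_def fps_add_nth kap_nth one_nth2 by simp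
  then show ?thesis by (simp only: E W_def cf_nth Suc_eq_plus1) simp
qed

text \<open>If the moments are diagonal, \<open>1 + kap C * W\<close> is a series \<open>e\<close>
  in the product of the two variables; its equation is read off from the coefficients of equal outer
  and inner degree. \<open>J\<close> is the expansion of
  \<open>\<integral> 1 / (1 - t \<bar>f\<bar>\<^sup>2)\<^sup>2\<close>.\<close>

lemma diagonal_log_deriv:
  assumes f: "bdd_borel f"
    and w: "\<And>k l. (\<integral>t. gk f C k l t \<partial>uniform01) = (if k = l then \<omega> k else 0)"
    and C: "C \<noteq> 0"
  defines "e \<equiv> 1 + fps_const C * fps_X * Abs_fps \<omega>"
    and "J \<equiv> Abs_fps (\<lambda>n. of_nat (n + 1) * (\<integral>t. (f t * cnj (f t)) ^ n \<partial>uniform01))"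
  shows "fps_deriv e = e * (fps_const C * J)"
proof -
  define W where "W = cf (\<lambda>k l. \<integral>t. gk f C k l t \<partial>uniform01)"
  define m where "m = cf (\<lambda>k l. \<integral>t. f t ^ k * cnj (f t) ^ l \<partial>uniform01)"
  define E where "E = 1 + kap C * W"
  define A where "A = kap C * m"
  have rec: "\<delta> E = E * \<delta> A"
    using gk_log_deriv[OF f, of C] by (simp add: E_def A_def W_def m_def)
  have e_nth: "e $ n = (if n = 0 then 1 else C * \<omega> (n - 1))" for n
    by (simp add: e_def mult.assoc)
  have E: "E $ k $ l = (if k = l then e $ k else 0)" for k l
    unfolding E_def fps_add_nth kap_nth one_nth2 e_nth W_def cf_nth w by (cases k; cases l) auto
  have nth: "of_nat k * E $ k $ l = (\<Sum>i=0..k. if i \<le> l then e $ i * (of_nat (k - i) * A $ (k - i) $ (l - i)) else 0)" for k l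
  proof -
    have "of_nat k * E $ k $ l = (E * \<delta> A) $ k $ l"
      using arg_cong[OF rec, of "\<lambda>F. F $ k $ l"] by (simp only: \<delta>_nth of_nat_mult_nth)
    also have "\<dots> = (\<Sum>i=0..k. \<Sum>j=0..l. if i = j then e $ i * (of_nat (k - i) * A $ (k - i) $ (l - j)) else 0)"
      unfolding mult_nth2 \<delta>_nth of_nat_mult_nth E by (intro sum.cong refl) auto
    finally show ?thesis by (simp add: sum.delta' cong: if_cong)
  qed
  have A_diag: "k \<noteq> l \<Longrightarrow> A $ k $ l = 0" for k l
  proof (induction k arbitrary: l rule: less_induct)
    case (less k)
    show ?case
    proof (cases "k = 0")
      case True
      then show ?thesis unfolding A_def kap_nth by simp
    next
      case False
      have "(\<Sum>i=0..k. if i \<le> l then e $ i * (of_nat (k - i) * A $ (k - i) $ (l - i)) else 0) =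
        (\<Sum>i=0..k. if i = 0 then of_nat k * A $ k $ l else 0)"
      proof (intro sum.cong refl)
        fix i assume i: "i \<in> {0..k}"
        have "A $ (k - i) $ (l - i) = 0" if "0 < i" "i \<le> l"
          using that i less.prems False by (intro less.IH) auto
        then show "(if i \<le> l then e $ i * (of_nat (k - i) * A $ (k - i) $ (l - i)) else 0) = 
          (if i = 0 then of_nat k * A $ k $ l else 0)"
          by (auto simp: e_nth)
      qed
      then have "of_nat k * A $ k $ l = 0"
        using nth[of k l] E[of k l] less.prems by (simp add: sum.delta)
      then show ?thesis using False by simp
    qed
  qed
  \<comment> \<open>The factor \<open>n + 1\<close> in \<open>J\<close> comes from the Euler
    operator applied to \<open>A\<close>.\<close>
  have Ak: "of_nat (Suc n) * A $ Suc n $ Suc n = C * J $ n" for n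
    unfolding A_def kap_nth by (simp add: m_def J_def power_mult_distrib)
  show ?thesis
  proof (rule fps_ext)
    fix n
    have "fps_deriv e $ n = of_nat (Suc n) * E $ Suc n $ Suc n"
      by (simp add: E)
    also have "\<dots> = (\<Sum>i=0..Suc n. e $ i * (of_nat (Suc n - i) * A $ (Suc n - i) $ (Suc n - i)))"
      unfolding nth by (intro sum.cong refl) simp
    also have "\<dots> = (\<Sum>i=0..n. e $ i * (of_nat (Suc n - i) * A $ (Suc n - i) $ (Suc n - i)))"
      by simp
    also have "\<dots> = (\<Sum>i=0..n. e $ i * (C * J $ (n - i)))"
      by (intro sum.cong refl) (simp add: Suc_diff_le Ak[symmetric] del: of_nat_Suc)
    also have "\<dots> = (e * (fps_const C * J)) $ n"
      by (simp only: fps_mult_nth[of e "fps_const C * J"] fps_mult_left_const_nth)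
    finally show "fps_deriv e $ n = (e * (fps_const C * J)) $ n" .
  qed
qed

text \<open>In a term of the double sum both factors are diagonal only if
  \<open>k - 1 - i = j\<close> and \<open>i = l - 1 - j\<close>, which forces
  \<open>k = l\<close>.\<close>

lemma convolution_diagonal:
  fixes w v :: "nat \<Rightarrow> nat \<Rightarrow> complex"
  assumes w: "\<And>k l. w k l = v k l + z * (\<Sum>i<k. \<Sum>j<l. w (k - 1 - i) j * v i (l - 1 - j))"
    and v: "\<And>k l. v k l = (if k = l then \<nu> k else 0)"
  shows "k \<noteq> l \<Longrightarrow> w k l = 0" "w k k = \<nu> k + z * (\<Sum>i<k. w (k - 1 - i) (k - 1 - i) * \<nu> i)"
proof -
  show *: "w k l = 0" if "k \<noteq> l" for k l
    using that
  proof (induction k arbitrary: l rule: less_induct)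
    case (less k)
    have "(\<Sum>i<k. \<Sum>j<l. w (k - 1 - i) j * v i (l - 1 - j)) = 0"
    proof (intro sum.neutral ballI)
      fix i j assume ij: "i \<in> {..<k}" "j \<in> {..<l}"
      show "w (k - 1 - i) j * v i (l - 1 - j) = 0"
      proof (cases "k - 1 - i = j")
        case True
        then have "i \<noteq> l - 1 - j" using ij less.prems by auto
        then show ?thesis by (simp add: v)
      next
        case False
        then show ?thesis using less.IH[of "k - 1 - i" j] ij by auto
      qed
    qed
    then show ?case using w[of k l] v[of k l] less.prems by simp
  qed
  have "(\<Sum>j<k. w (k - 1 - i) j * v i (k - 1 - j)) = w (k - 1 - i) (k - 1 - i) * \<nu> i" if "i < k" for i
  proof -
    have "(\<Sum>j<k. w (k - 1 - i) j * v i (k - 1 - j)) = 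
        (\<Sum>j<k. if j = k - 1 - i then w (k - 1 - i) (k - 1 - i) * \<nu> i else 0)"
      using that by (intro sum.cong refl) (auto simp: v *)
    then show ?thesis using that by (simp add: sum.delta)
  qed
  then show "w k k = \<nu> k + z * (\<Sum>i<k. w (k - 1 - i) (k - 1 - i) * \<nu> i)"
    using w[of k k] v[of k k] by simp
qed

text \<open>The function \<open>\<integral> 1 / (1 - t \<rho>)\<^sup>2\<close> of \<open>t\<close> has its expansions around all points \<open>-K\<close>, and the disc of
  convergence around \<open>-K\<close> reaches \<open>2 \<pi> \<i>\<close> for large \<open>K\<close>.\<close>

lemma stieltjes_sums:
  fixes \<rho> :: "real \<Rightarrow> real" and t :: complex
  assumes \<rho>: "\<rho> \<in> borel_measurable borel" "\<And>s. 0 \<le> \<rho> s" "\<And>s. \<rho> s \<le> b" and b: "0 < b"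
    and K: "0 \<le> K" and t: "cmod (t + K) < K + 1 / b"
  shows "(\<lambda>n. of_nat (n + 1) * (\<integral>s. complex_of_real (\<rho> s ^ n / (1 + K * \<rho> s) ^ (n + 2)) \<partial>uniform01) * (t + K) ^ n) sums
    (\<integral>s. 1 / (1 - t * \<rho> s)\<^sup>2 \<partial>uniform01)"
proof -
  \<comment> \<open>Writing \<open>1 - t \<rho>\<close> as
    \<open>(1 + K \<rho>) - (t + K) \<rho>\<close> gives the derivative of the geometric series in
    \<open>(t + K) \<rho> / (1 + K \<rho>)\<close>.\<close>
  let ?f = "\<lambda>n s. of_nat (Suc n) * ((t + K) * complex_of_real (\<rho> s / (1 + K * \<rho> s))) ^ n * complex_of_real (1 / (1 + K * \<rho> s)\<^sup>2)"
  \<comment> \<open>A bound for the geometric ratio: \<open>r / (1 + K r)\<close> increases with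
    \<open>r\<close>, and \<open>\<rho>\<close> is at most \<open>b\<close>. The hypothesis on
    \<open>t\<close> makes it less than 1.\<close>
  define \<theta> where "\<theta> = cmod (t + K) * (b / (1 + K * b))"
  have pos: "0 < 1 + K * \<rho> s" "1 \<le> 1 + K * \<rho> s" for s
    using K \<rho>(2)[of s] by (simp_all add: add_pos_nonneg)
  have pb: "0 < 1 + K * b" using K b by (simp add: add_pos_nonneg)
  have \<theta>: "0 \<le> \<theta>" "\<theta> < 1"
  proof -
    show "0 \<le> \<theta>" using b pb by (simp add: \<theta>_def)
    have "cmod (t + K) * b < (K + 1 / b) * b" using t b by (intro mult_strict_right_mono)
    also have "\<dots> = 1 + K * b" using b by (simp add: field_simps)
    finally show "\<theta> < 1" using pb by (simp add: \<theta>_def)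
  qed
  have x: "cmod ((t + K) * complex_of_real (\<rho> s / (1 + K * \<rho> s))) \<le> \<theta>" for s
  proof -
    have le: "\<rho> s / (1 + K * \<rho> s) \<le> b / (1 + K * b)"
    proof -
      have "\<rho> s * (1 + K * b) \<le> b * (1 + K * \<rho> s)"
        using \<rho>(3)[of s] by (simp add: algebra_simps)
      then show ?thesis
        by (simp only: pos_divide_le_eq[OF pos(1)] times_divide_eq_left pos_le_divide_eq[OF pb])
    qed
    have eq: "cmod ((t + K) * complex_of_real (\<rho> s / (1 + K * \<rho> s))) = cmod (t + K) * (\<rho> s / (1 + K * \<rho> s))"
    proof -
      have "0 \<le> \<rho> s / (1 + K * \<rho> s)" using \<rho>(2)[of s] pos[of s] by simp
      then show ?thesis by (simp only: norm_mult norm_of_real abs_of_nonneg)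
    qed
    show ?thesis unfolding \<theta>_def eq by (intro mult_left_mono le norm_ge_zero)
  qed
  have fn: "norm (?f n s) \<le> real (Suc n) * \<theta> ^ n" for n s
  proof -
    have "norm (?f n s) = real (Suc n) * (cmod ((t + K) * complex_of_real (\<rho> s / (1 + K * \<rho> s)))) ^ n * (1 / (1 + K * \<rho> s)\<^sup>2)"
      using pos[of s] by (simp only: norm_mult norm_power norm_of_nat norm_of_real) simp
    also have "\<dots> \<le> real (Suc n) * \<theta> ^ n * 1"
      using x[of s] pos[of s] \<theta> by (intro mult_mono power_mono mult_left_mono) (auto simp: divide_le_eq_1)
    finally show ?thesis by simp
  qed
  have summ: "summable (\<lambda>n. real (Suc n) * \<theta> ^ n)"
    using geometric_deriv_sums[of \<theta>] \<theta> by (simp add: sums_iff)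
  have meas: "?f n \<in> borel_measurable uniform01" for n
    using \<rho>(1) by measurable
  have int: "integrable uniform01 (?f n)" for n
    by (rule u01.integrable_const_bound[OF AE_I2 meas]) (rule fn)
  have "(\<lambda>n. integral\<^sup>L uniform01 (?f n)) sums (\<integral>s. (\<Sum>n. ?f n s) \<partial>uniform01)"
  proof (rule sums_integral[OF int])
    show "AE s in uniform01. summable (\<lambda>n. norm (?f n s))"
      by (rule AE_I2, rule summable_comparison_test'[OF summ, of 0]) (use fn in simp)
    show "summable (\<lambda>n. \<integral>s. norm (?f n s) \<partial>uniform01)"
    proof (rule summable_comparison_test'[OF summ, of 0])
      fix n
      have "(\<integral>s. norm (?f n s) \<partial>uniform01) \<le> (\<integral>s. real (Suc n) * \<theta> ^ n \<partial>uniform01)"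
        by (rule integral_mono[OF integrable_norm[OF int] _ fn]) simp
      then show "norm (\<integral>s. norm (?f n s) \<partial>uniform01) \<le> real (Suc n) * \<theta> ^ n"
        using u01.prob_space by simp
    qed
  qed
  moreover have "(\<Sum>n. ?f n s) = 1 / (1 - t * \<rho> s)\<^sup>2" for s
  proof -
    let ?x = "(t + K) * complex_of_real (\<rho> s / (1 + K * \<rho> s))"
    have "(\<lambda>n. of_nat (Suc n) * ?x ^ n * complex_of_real (1 / (1 + K * \<rho> s)\<^sup>2)) sums
      (1 / (1 - ?x)\<^sup>2 * complex_of_real (1 / (1 + K * \<rho> s)\<^sup>2))"
      using x[of s] \<theta> by (intro sums_mult2 geometric_deriv_sums) simp
    moreover have "1 / (1 - ?x)\<^sup>2 * complex_of_real (1 / (1 + K * \<rho> s)\<^sup>2) = 1 / (1 - t * \<rho> s)\<^sup>2"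
    proof -
      have nz: "complex_of_real (1 + K * \<rho> s) \<noteq> 0" using pos[of s] by (simp only: of_real_eq_0_iff)
      have "(1 - ?x) * complex_of_real (1 + K * \<rho> s) = 1 - t * \<rho> s"
      proof -
        have "?x * complex_of_real (1 + K * \<rho> s) = (t + K) * \<rho> s"
          by (simp only: of_real_divide times_divide_eq_right times_divide_eq_left nonzero_mult_div_cancel_right[OF nz])
        then show ?thesis by (simp add: algebra_simps)
      qed
      then have "(1 - t * \<rho> s)\<^sup>2 = (1 - ?x)\<^sup>2 * (complex_of_real (1 + K * \<rho> s))\<^sup>2"
        by (simp only: power_mult_distrib[symmetric])
      then show ?thesis by simp
    qed
    ultimately show ?thesis by (simp add: sums_iff)
  qed
  moreover have "integral\<^sup>L uniform01 (?f n) = 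
    of_nat (n + 1) * (\<integral>s. complex_of_real (\<rho> s ^ n / (1 + K * \<rho> s) ^ (n + 2)) \<partial>uniform01) * (t + K) ^ n" for n
  proof -
    have "?f n s = of_nat (n + 1) * (t + K) ^ n * complex_of_real (\<rho> s ^ n / (1 + K * \<rho> s) ^ (n + 2))" for s
      by (simp add: power_mult_distrib power_divide power_add mult.assoc power2_eq_square)
    then show ?thesis by (simp only: integral_mult_right_zero mult_ac)
  qed
  ultimately show ?thesis by simp
qed

lemma no_stieltjes_solution:
  fixes \<rho> :: "real \<Rightarrow> real" and z C :: real
  assumes \<rho>: "\<rho> \<in> borel_measurable borel" "\<And>s. 0 \<le> \<rho> s" "\<And>s. \<rho> s \<le> b" and b: "0 < b" and z: "0 < z"
  defines "J \<equiv> Abs_fps (\<lambda>n. of_nat (n + 1) * (\<integral>s. complex_of_real (\<rho> s ^ n) \<partial>uniform01))"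
    and "u \<equiv> fps_exp 1 - (1 :: complex fps)"
  assumes eq: "J * (1 + fps_const (complex_of_real (C - z)) * u) * (1 - fps_const (complex_of_real z) * u) = fps_exp 1"
  shows False
proof -
  define \<Phi> where "\<Phi> t = (\<integral>s. 1 / (1 - t * complex_of_real (\<rho> s))\<^sup>2 \<partial>uniform01)" for t
  define P where "P t = 1 + complex_of_real (C - z) * (exp t - 1)" for t
  define Q where "Q t = 1 - complex_of_real z * (exp t - 1)" for t
  have exp_\<Phi>: "\<Phi> has_fps_expansion J"
  proof (rule has_fps_expansionI)
    have "eventually (\<lambda>t. t \<in> ball (0::complex) (1 / b)) (nhds 0)"
      using b by (intro eventually_nhds_in_open) auto
    then show "\<forall>\<^sub>F t in nhds 0. (\<lambda>n. J $ n * t ^ n) sums \<Phi> t"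
    proof eventually_elim
      case (elim t)
      then show ?case
        using stieltjes_sums[OF \<rho> b, of 0 t] by (simp add: J_def \<Phi>_def)
    qed
  qed
  have exp_u: "(\<lambda>t. exp t - 1) has_fps_expansion u"
    unfolding u_def by (intro fps_expansion_intros)
  have exp_eq: "(\<lambda>t. \<Phi> t * P t * Q t - exp t) has_fps_expansion 0"
  proof (rule has_fps_expansion_schematicI)
    show "(\<lambda>t. \<Phi> t * P t * Q t - exp t) has_fps_expansion 
       (J * (1 + fps_const (complex_of_real (C - z)) * u) * (1 - fps_const (complex_of_real z) * u) - fps_exp 1)"
      unfolding P_def Q_def by (intro fps_expansion_intros exp_\<Phi> exp_u)
  qed (use eq in simp)
  \<comment> \<open>Chosen so that \<open>2 K / b = 4 pi\<^sup>2\<close>: the squared distance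
    \<open>K\<^sup>2 + 4 pi\<^sup>2\<close> from \<open>- K\<close> to \<open>2 pi \<i>\<close> is
    then smaller than \<open>(K + 1 / b)\<^sup>2\<close>.\<close>
  define K where "K = 2 * pi\<^sup>2 * b"
  have K: "0 \<le> K" using b by (simp add: K_def)
  define S where "S = ball (- complex_of_real K) (K + 1 / b)"
  have hol: "\<Phi> holomorphic_on S"
    unfolding S_def
  proof (rule power_series_holomorphic)
    fix t assume "t \<in> ball (- complex_of_real K) (K + 1 / b)"
    then have "cmod (t + K) < K + 1 / b"
      by (simp add: dist_norm norm_minus_commute[of "- complex_of_real K"])
    from stieltjes_sums[OF \<rho> b K this]
    show "(\<lambda>n. of_nat (n + 1) * (\<integral>s. complex_of_real (\<rho> s ^ n / (1 + K * \<rho> s) ^ (n + 2)) \<partial>uniform01) * 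
        (t - - complex_of_real K) ^ n) sums \<Phi> t"
      by (simp add: \<Phi>_def)
  qed
  have "\<Phi> (2 * complex_of_real pi * \<i>) * P (2 * complex_of_real pi * \<i>) * Q (2 * complex_of_real pi * \<i>) - exp (2 * complex_of_real pi * \<i>) = 0"
  proof (rule has_fps_expansion_0_analytic_continuation[OF exp_eq, of S])
    show "(\<lambda>t. \<Phi> t * P t * Q t - exp t) holomorphic_on S"
      unfolding P_def Q_def by (intro holomorphic_intros hol)
    show "0 \<in> S" using K b by (simp add: S_def)
    have "(cmod (2 * complex_of_real pi * \<i> + K))\<^sup>2 = K\<^sup>2 + 4 * pi\<^sup>2"
      by (simp add: cmod_power2 power_mult_distrib)
    also have "\<dots> < (K + 1 / b)\<^sup>2"
    proof -
      have "K * (1 / b) = 2 * pi\<^sup>2" using b by (simp add: K_def)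
      moreover have "(K + 1 / b)\<^sup>2 = K\<^sup>2 + 2 * (K * (1 / b)) + (1 / b)\<^sup>2"
        by (simp add: power2_sum)
      moreover have "0 < (1 / b)\<^sup>2" using b by simp
      ultimately show ?thesis by linarith
    qed
    finally have "cmod (2 * complex_of_real pi * \<i> + K) < K + 1 / b"
      by (rule power2_less_imp_less) (use K b in simp)
    then show "2 * complex_of_real pi * \<i> \<in> S"
      by (simp add: S_def dist_norm norm_minus_commute[of "- complex_of_real K"])
  qed (auto simp: S_def)
  \<comment> \<open>By periodicity \<open>P\<close> and \<open>Q\<close> are both 1 at this point,
    whatever \<open>C\<close> and \<open>z\<close> are.\<close>
  moreover have "exp (2 * complex_of_real pi * \<i>) = 1"
    by (simp add: exp_eq_1 mult.commute)
  ultimately have \<Phi>1: "\<Phi> (2 * complex_of_real pi * \<i>) = 1"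
    by (simp add: P_def Q_def)
  \<comment> \<open>The modulus of the integrand at \<open>2 pi \<i>\<close>: at most 1, and equal
    to 1 only where \<open>\<rho>\<close> vanishes. As the integral over a probability space is 1,
    this happens almost everywhere.\<close>
  define r where "r s = 1 / (1 + (2 * pi * \<rho> s)\<^sup>2)" for s
  have r: "0 \<le> r s" "r s \<le> 1" for s by (auto simp: r_def divide_le_eq_1 add_pos_nonneg)
  have cr: "cmod (1 / (1 - 2 * complex_of_real pi * \<i> * complex_of_real (\<rho> s))\<^sup>2) = r s" for s
  proof -
    have "(cmod (1 - 2 * complex_of_real pi * \<i> * complex_of_real (\<rho> s)))\<^sup>2 = 1 + (2 * pi * \<rho> s)\<^sup>2"
      by (simp add: cmod_power2)
    then show ?thesis by (simp add: norm_divide norm_power r_def)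
  qed
  have intr: "integrable uniform01 r"
    using r \<rho>(1) unfolding r_def by (intro u01.integrable_const_bound[of _ 1]) (auto simp: r_def)
  have "1 \<le> (\<integral>s. r s \<partial>uniform01)"
  proof -
    have "1 = cmod (\<Phi> (2 * complex_of_real pi * \<i>))" by (simp add: \<Phi>1)
    also have "\<dots> \<le> (\<integral>s. cmod (1 / (1 - 2 * complex_of_real pi * \<i> * complex_of_real (\<rho> s))\<^sup>2) \<partial>uniform01)"
      unfolding \<Phi>_def by (rule integral_norm_bound)
    finally show ?thesis by (simp only: cr)
  qed
  then have le: "(\<integral>s. 1 - r s \<partial>uniform01) \<le> 0"
    using intr u01.prob_space by simp
  have "(\<integral>s. 1 - r s \<partial>uniform01) = 0"
    using le r by (intro antisym integral_nonneg) auto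
  then have "AE s in uniform01. 1 - r s = 0"
    using intr r by (subst (asm) integral_nonneg_eq_0_iff_AE) auto
  then have \<rho>0: "AE s in uniform01. \<rho> s = 0"
  proof eventually_elim
    case (elim s)
    then have "1 + (2 * pi * \<rho> s)\<^sup>2 = 1"
      by (simp add: r_def divide_eq_eq split: if_splits)
    then show ?case by simp
  qed
  have "J = 1"
  proof (rule fps_ext)
    fix n
    have "(\<integral>s. complex_of_real (\<rho> s ^ n) \<partial>uniform01) = (\<integral>s. complex_of_real (0 ^ n) \<partial>uniform01)"
      using \<rho>0 \<rho>(1) by (intro integral_cong_AE) auto
    then show "J $ n = 1 $ n"
      using u01.prob_space by (cases n) (auto simp: J_def)
  qed
  then have PQ: "(1 + fps_const (complex_of_real (C - z)) * u) * (1 - fps_const (complex_of_real z) * u) = fps_exp 1"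
    using eq by simp
  define p where "p = 1 + fps_const (complex_of_real (C - z)) * u"
  define q where "q = 1 - fps_const (complex_of_real z) * u"
  \<comment> \<open>Two coefficients suffice: degree 1 gives \<open>C - z = 1 + z\<close>, and then
    degree 2 gives \<open>z (1 + z) = 0\<close>.\<close>
  have p: "p $ 0 = 1" "p $ 1 = complex_of_real (C - z)" "p $ 2 = complex_of_real ((C - z) / 2)"
    by (simp_all add: p_def u_def)
  have q: "q $ 0 = 1" "q $ 1 = complex_of_real (- z)" "q $ 2 = complex_of_real (- z / 2)"
    by (simp_all add: q_def u_def)
  have pq: "p * q = fps_exp 1" using PQ by (simp only: p_def q_def)
  have "(p * q) $ 1 = p $ 0 * q $ 1 + p $ 1 * q $ 0"
    by (simp add: fps_mult_nth)
  then have "complex_of_real (- z + (C - z)) = complex_of_real 1"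
    unfolding pq p q by simp
  moreover have "(p * q) $ 2 = p $ 0 * q $ 2 + p $ 1 * q $ 1 + p $ 2 * q $ 0"
    by (simp add: fps_mult_nth numeral_2_eq_2)
  then have "complex_of_real (- z / 2 + (C - z) * (- z) + (C - z) / 2) = complex_of_real (1 / 2)"
    unfolding pq p q by simp
  ultimately have C: "- z + (C - z) = 1" and "- z / 2 + (C - z) * (- z) + (C - z) / 2 = 1 / 2"
    by (simp_all only: of_real_eq_iff)
  moreover have "C - z = 1 + z" using C by simp
  ultimately have "- z / 2 + (1 + z) * (- z) + (1 + z) / 2 = 1 / 2" by metis
  then have "z * (1 + z) = 0" by (simp add: field_simps)
  then show False using z by simp
qed

section \<open>Comparison of the two families of moments\<close>

lemma dt_model_realization:
  assumes "DT_realization M \<tau> D0 E X T"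
  shows "dt_model M \<tau> E D0 X"
  using assms unfolding DT_realization_def spectral_measure_def
  by unfold_locales auto

text \<open>The essentially bounded \<open>f\<close> is replaced by a bounded \<open>g\<close> with
  the same \<open>D\<close>, to which \<open>dt_moments\<close> applies with the unit as test
  operator.\<close>

lemma DT_realization_moments:
  assumes real: "DT_realization M \<tau> D0 E X T"
    and f: "f \<in> borel_measurable borel" "AE t in uniform01. norm (f t) \<le> b" "fun_calculus M E f D"
  obtains g where "bdd_borel g"
    "\<And>k l. \<tau> (op_power (D + c *\<^sub>R T) k o\<^sub>L op_power (adj (D + c *\<^sub>R T)) l) =
      (\<integral>t. gk g (complex_of_real c ^ 2) k l t \<partial>uniform01)"
proof -
  interpret dt_model M \<tau> E D0 X by (rule dt_model_realization[OF real])
  obtain g where g: "calc g D" using calc_of_ess_bounded[OF f] by blast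
  interpret L: dt_limit M \<tau> E D0 X T g D c
    using real g by unfold_locales (auto simp: DT_realization_def)
  show thesis
  proof (rule that)
    show "bdd_borel g" by (rule L.calc_bdd_borel[OF g])
    fix k l
    have "\<tau> (id_blinfun o\<^sub>L (op_power L.Z k o\<^sub>L op_power (adj L.Z) l)) =
        (\<integral>t. 1 * gk g (complex_of_real c ^ 2) k l t \<partial>uniform01)"
      by (rule L.dt_moments[OF calc_id])
    then show "\<tau> (op_power (D + c *\<^sub>R T) k o\<^sub>L op_power (adj (D + c *\<^sub>R T)) l) =
      (\<integral>t. gk g (complex_of_real c ^ 2) k l t \<partial>uniform01)"
      by (simp add: L.Z_def)
  qed
qed

lemma star_word_powers:
  "star_word A (replicate k False @ replicate l True) = (op_power A k o\<^sub>L op_power (adj A) l)"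
  by (simp add: star_word_def op_prod_append op_power_def)

lemma quasinilpotent_DT_moments:
  assumes "quasinilpotent_DT TYPE('k::complex_hilbert) \<tau> T"
  shows "\<tau> (op_power T k o\<^sub>L op_power (adj T) l) = (if k = l then 1 / fact (k + 1) else 0)"
proof -
  obtain M :: "'k oper set" and \<sigma> D0 E X T' where real: "DT_realization M \<sigma> D0 E X T'"
    and mom: "same_star_moments \<tau> T \<sigma> T'"
    using assms unfolding quasinilpotent_DT_def by blast
  interpret dt_model M \<sigma> E D0 X by (rule dt_model_realization[OF real])
  \<comment> \<open>The quasi-nilpotent operator is the case \<open>D = 0\<close>,
    \<open>c = 1\<close>.\<close>
  interpret L: dt_limit M \<sigma> E D0 X T' "\<lambda>_. 0" 0 1
    using real calc_zero by unfold_locales (auto simp: DT_realization_def)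
  have "\<tau> (op_power T k o\<^sub>L op_power (adj T) l) = \<sigma> (op_power T' k o\<^sub>L op_power (adj T') l)"
    using mom unfolding same_star_moments_def by (metis star_word_powers)
  also have "\<dots> = (\<integral>t. gk (\<lambda>_. 0) 1 k l t \<partial>uniform01)"
    using L.dt_moments[OF calc_id, of k l] by (simp add: L.Z_def)
  finally show ?thesis by (simp only: quasinilpotent_moments)
qed

theorem theorem4p7:
  fixes M :: "'h::complex_hilbert oper set"
    and \<tau> :: "'h oper \<Rightarrow> complex"
    and T Y :: "'h oper"
    and \<epsilon> :: real
  assumes "tracial_wstar_space M \<tau>"
    and "T \<in> M" and "quasinilpotent_DT TYPE('k::complex_hilbert) \<tau> T"
    and "Y \<in> M" and "circular M \<tau> Y"
    and "star_free \<tau> T Y"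
    and "\<epsilon> > 0"
  shows "\<not> is_DT_op TYPE('l::complex_hilbert) \<tau> (T + sqrt \<epsilon> *\<^sub>R Y)"
proof
  assume "is_DT_op TYPE('l) \<tau> (T + sqrt \<epsilon> *\<^sub>R Y)"
  then obtain \<mu> c where c: "c > 0" and "DT_op TYPE('l) \<tau> (T + sqrt \<epsilon> *\<^sub>R Y) \<mu> c"
    unfolding is_DT_op_def by blast
  then obtain M' :: "'l oper set" and \<sigma> D0 E X T' f D b where real: "DT_realization M' \<sigma> D0 E X T'"
    and f: "f \<in> borel_measurable borel" "AE t in uniform01. norm (f t) \<le> b" "fun_calculus M' E f D"
    and mom: "same_star_moments \<tau> (T + sqrt \<epsilon> *\<^sub>R Y) \<sigma> (D + c *\<^sub>R T')"
    unfolding DT_op_def by blast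
  interpret tracial M \<tau> by unfold_locales (rule assms(1))
  define Z where "Z = T + sqrt \<epsilon> *\<^sub>R Y"
  define w where "w k l = \<tau> (op_power Z k o\<^sub>L op_power (adj Z) l)" for k l
  define v where "v k l = \<tau> (op_power T k o\<^sub>L op_power (adj T) l)" for k l
  define \<nu> :: "nat \<Rightarrow> complex" where "\<nu> k = 1 / fact (k + 1)" for k
  define C where "C = c\<^sup>2"
  obtain g where g: "bdd_borel g" and "\<And>k l. \<sigma> (op_power (D + c *\<^sub>R T') k o\<^sub>L op_power (adj (D + c *\<^sub>R T')) l) =
      (\<integral>t. gk g (complex_of_real c ^ 2) k l t \<partial>uniform01)"
    using DT_realization_moments[OF real f, of c] by blast
  then have wg: "w k l = (\<integral>t. gk g (complex_of_real C) k l t \<partial>uniform01)" for k l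
    using mom unfolding same_star_moments_def w_def Z_def C_def by (metis star_word_powers of_real_power)
  have v: "v k l = (if k = l then \<nu> k else 0)" for k l
    unfolding v_def \<nu>_def by (rule quasinilpotent_DT_moments[OF assms(3)])
  have "complex_of_real (sqrt \<epsilon>) ^ 2 = complex_of_real \<epsilon>"
    using assms(7) by (simp flip: of_real_power)
  then have "w k l = v k l + complex_of_real \<epsilon> * (\<Sum>i<k. \<Sum>j<l. w (k - 1 - i) j * v i (l - 1 - j))" for k l
    using free_circular_moments[OF assms(2,4,5,6), where k = k and l = l and s = "sqrt \<epsilon>"] by (simp add: w_def v_def Z_def)
  note w = convolution_diagonal[OF this v]
  define \<omega> where "\<omega> k = w k k" for k
  define e where "e = 1 + fps_const (complex_of_real C) * fps_X * Abs_fps \<omega>"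
  define J where "J = Abs_fps (\<lambda>n. of_nat (n + 1) * (\<integral>t. (g t * cnj (g t)) ^ n \<partial>uniform01))"
  have C0: "complex_of_real C \<noteq> 0" using c by (simp add: C_def)
  have wdiag: "(\<integral>t. gk g (complex_of_real C) k l t \<partial>uniform01) = (if k = l then \<omega> k else 0)" for k l
    using w(1)[of k l] by (simp add: wg[symmetric] \<omega>_def)
  have e': "fps_deriv e = e * (fps_const (complex_of_real C) * J)"
    unfolding e_def J_def by (rule diagonal_log_deriv[OF g wdiag C0])
  define u where "u = fps_exp 1 - (1 :: complex fps)"
  define V where "V = Abs_fps \<nu>"
  have u_V: "u = fps_X * V"
    by (rule fps_ext) (simp add: u_def V_def \<nu>_def)
  have du: "fps_deriv u = fps_exp 1" by (simp add: u_def)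
  define z where "z = fps_const (complex_of_real \<epsilon>)"
  define C' where "C' = fps_const (complex_of_real C)"
  \<comment> \<open>The recursion for the diagonal moments; it says that
    \<open>Abs_fps \<omega>\<close> is \<open>V\<close> divided by
    \<open>1 - \<epsilon> t V\<close>.\<close>
  have conv: "Abs_fps \<omega> = V + z * (fps_X * (V * Abs_fps \<omega>))"
  proof (rule fps_ext)
    fix n
    show "Abs_fps \<omega> $ n = (V + z * (fps_X * (V * Abs_fps \<omega>))) $ n"
    proof (cases n)
      case 0
      then show ?thesis using w(2)[of 0] by (simp add: \<omega>_def V_def z_def)
    next
      case (Suc m)
      have "(\<Sum>i<Suc m. w (Suc m - 1 - i) (Suc m - 1 - i) * \<nu> i) = (V * Abs_fps \<omega>) $ m"
        unfolding fps_mult_nth by (intro sum.cong) (auto simp: V_def \<omega>_def mult.commute)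
      then show ?thesis using w(2)[of "Suc m"] Suc by (simp add: \<omega>_def V_def z_def)
    qed
  qed
  have dz: "fps_deriv z = 0" "fps_deriv C' = 0" by (simp_all add: z_def C'_def)
  define P where "P = 1 + fps_const (complex_of_real (C - \<epsilon>)) * u"
  define Q where "Q = 1 - z * u"
  have P: "P = 1 + (C' - z) * u" by (simp add: P_def C'_def z_def)
  \<comment> \<open>\<open>e\<close> is the quotient \<open>P / Q\<close>; multiplying through
    avoids inverses of power series.\<close>
  have eQ: "e * Q = P"
  proof -
    have "e * Q = Q + C' * (fps_X * (Abs_fps \<omega> - z * (fps_X * (V * Abs_fps \<omega>))))"
      by (simp add: e_def Q_def u_V C'_def[symmetric] algebra_simps)
    also have "Abs_fps \<omega> - z * (fps_X * (V * Abs_fps \<omega>)) = V"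
      using conv by (simp add: algebra_simps)
    finally show ?thesis by (simp add: P Q_def u_V algebra_simps)
  qed
  \<comment> \<open>The logarithmic derivative of \<open>P / Q\<close> with denominators cleared:
    the Wronskian of \<open>P\<close> and \<open>Q\<close> collapses to
    \<open>C' * fps_exp 1\<close>.\<close>
  have "fps_deriv P = fps_deriv e * Q + e * fps_deriv Q"
    by (simp add: eQ[symmetric] algebra_simps)
  then have "fps_deriv P * Q = (C' * J) * (e * Q) * Q + (e * Q) * fps_deriv Q"
    by (simp add: e' C'_def[symmetric] algebra_simps)
  then have "(C' * J) * P * Q = fps_deriv P * Q - P * fps_deriv Q"
    unfolding eQ by (simp add: algebra_simps)
  also have "\<dots> = C' * fps_exp 1"
    by (simp add: P Q_def du dz algebra_simps)
  finally have "C' * (J * P * Q) = C' * fps_exp 1" by (simp add: mult.assoc)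
  then have JPQ: "J * P * Q = fps_exp 1" using C0 by (simp add: C'_def)
  obtain K where K: "\<And>t. cmod (g t) \<le> K" "0 \<le> K" using bdd_borel_bound[OF g] by blast
  define \<rho> where "\<rho> t = (cmod (g t))\<^sup>2" for t
  have \<rho>: "g t * cnj (g t) = complex_of_real (\<rho> t)" for t
    by (simp only: \<rho>_def complex_norm_square)
  show False
  proof (rule no_stieltjes_solution[of \<rho> "K\<^sup>2 + 1" \<epsilon> C])
    show "\<rho> \<in> borel_measurable borel" using g unfolding \<rho>_def bdd_borel_def by auto
    \<comment> \<open>The summand 1 keeps the bound positive even for \<open>K = 0\<close>.\<close>
    show "\<rho> t \<le> K\<^sup>2 + 1" for t using power_mono[OF K(1)[of t], of 2] by (simp add: \<rho>_def)
    show "0 < K\<^sup>2 + 1" by (simp add: add_nonneg_pos)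
    show "Abs_fps (\<lambda>n. of_nat (n + 1) * (\<integral>t. complex_of_real (\<rho> t ^ n) \<partial>uniform01)) *
      (1 + fps_const (complex_of_real (C - \<epsilon>)) * (fps_exp 1 - 1)) * (1 - fps_const (complex_of_real \<epsilon>) * (fps_exp 1 - 1)) = fps_exp 1"
      using JPQ unfolding J_def P_def Q_def u_def z_def \<rho> of_real_power .
  qed (use assms(7) in \<open>auto simp: \<rho>_def\<close>)
qed

end
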